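(* Let $(A,\lhd,\rhd,\diamond)$ be a pre-Gel'fand-Dorfman algebra and $(A,\circ,[\cdot,\cdot])$ its associated Gel'fand-Dorfman algebra. Let $\{e_1,\ldots,e_n\}$ be a basis of $A$ with dual basis $\{e_1^\ast,\ldots,e_n^\ast\}$ of $A^\ast$, and let $r=\sum_{\alpha=1}^n(e_\alpha\otimes e_\alpha^\ast-e_\alpha^\ast\otimes e_\alpha)$, which is a skew-symmetric solution of the Gel'fand-Dorfman Yang-Baxter equation in the Gel'fand-Dorfman algebra $\hat A=A\ltimes_{L_\rhd^\ast+R_\lhd^\ast,-R_\lhd^\ast,L_\diamond^\ast}A^\ast$ (with operations denoted $\circ$ and $[\cdot,\cdot]$). Let $\hat R=\mathbf{k}[\partial]\hat A$ be the Lie conformal algebra corresponding to $\hat A$. Then there is a Lie conformal bialgebra structure $\delta$ on $\hat R$ given by $$\delta(a)=a_\lambda r|_{\lambda=-\partial^{\otimes^2}},\qquad a\in\hat R.$$ Moreover, it is exactly the one corresponding to the Gel'fand-Dorfman bialgebra $(\hat A,\circ,[\cdot,\cdot],\Delta,\delta_0)$, namely $$\delta(a)=\delta_0(a)+(\partial\otimes\mathrm{id})\Delta(a)-\tau(\partial\otimes\mathrm{id})\Delta(a),\qquad a\in\hat A,$$ where $$\Delta(a)=-(L_\circ(a)\otimes\mathrm{id}+\mathrm{id}\otimes L_\star(a))r,\qquad \delta_0(a)=(\mathrm{ad}(a)\otimes\mathrm{id}+\mathrm{id}\otimes\mathrm{ad}(a))r,\qquad a\in\hat A.$$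
   Context: Conventions: $\mathbf{k}$ is a field of characteristic $0$; vector spaces over $\mathbf{k}$ are finite-dimensional; $\otimes=\otimes_{\mathbf{k}}$; $\tau(a\otimes b)=b\otimes a$; $a\star b=a\circ b+b\circ a$. For a binary operation $\ast$: $L_\ast(a)b=a\ast b$, $R_\ast(a)b=b\ast a$; $\mathrm{ad}(a)b=[a,b]$ and $a.(b\otimes c)=[a,b]\otimes c+b\otimes[a,c]$. For $\varphi:A\to\mathrm{End}_{\mathbf{k}}(V)$ linear, $\langle\varphi^\ast(a)f,u\rangle=-\langle f,\varphi(a)u\rangle$ ($f\in V^\ast$). Skew-symmetric means $r+\tau r=0$. A Novikov algebra $(A,\circ)$ satisfies $(a\circ b)\circ c-a\circ(b\circ c)=(b\circ a)\circ c-b\circ(a\circ c)$ and $(a\circ b)\circ c=(a\circ c)\circ b$; a left-symmetric algebra satisfies only the first identity. A Gel'fand-Dorfman (GD) algebra $(A,\circ,[\cdot,\cdot])$ is a Novikov algebra and a Lie algebra with $[a\circ b,c]-[a\circ c,b]+[a,b]\circ c-[a,c]\circ b-a\circ[b,c]=0$. A pre-Novikov algebra $(A,\lhd,\rhd)$ satisfies: $a\rhd(b\rhd c)=(a\rhd b+a\lhd b)\rhd c+b\rhd(a\rhd c)-(b\rhd a+b\lhd a)\rhd c$; $a\rhd(b\lhd c)=(a\rhd b)\lhd c+b\lhd(a\lhd c+a\rhd c)-(b\lhd a)\lhd c$; $(a\lhd b+a\rhd b)\rhd c=(a\rhd c)\lhd b$; $(a\lhd b)\lhd c=(a\lhd c)\lhd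 b$. A pre-GD algebra $(A,\lhd,\rhd,\diamond)$ is a pre-Novikov algebra $(A,\lhd,\rhd)$ and a left-symmetric algebra $(A,\diamond)$ with $c\lhd(a\diamond b-b\diamond a)-a\diamond(c\lhd b)-(b\diamond c)\lhd a=-b\diamond(c\lhd a)-(a\diamond c)\lhd b$ and $(a\diamond b-b\diamond a)\rhd c+(a\lhd b+a\rhd b)\diamond c=a\rhd(b\diamond c)-b\diamond(a\rhd c)+(a\diamond c)\lhd b$. Its associated GD algebra is $A$ with $a\circ b=a\lhd b+a\rhd b$, $[a,b]=a\diamond b-b\diamond a$. $\hat A=A\ltimes_{l,r',\rho}A^\ast$ with $l=L_\rhd^\ast+R_\lhd^\ast$, $r'=-R_\lhd^\ast$, $\rho=L_\diamond^\ast$ is the GD algebra on $A\oplus A^\ast$ with products $(a+f)\cdot(b+g)=a\circ b+l(a)g+r'(b)f$ (the Novikov product of $\hat A$) and $[a+f,b+g]=[a,b]+\rho(a)g-\rho(b)f$, for $a,b\in A$, $f,g\in A^\ast$. The Gel'fand-Dorfman Yang-Baxter equation in a GD algebra for $r=\sum_\alpha x_\alpha\otimes y_\alpha$ is $\mathbf{N}(r)=\mathbf{C}(r)=0$, where $\mathbf{N}(r)=\sum_{\alpha,\beta}\big(x_\alpha\otimes x_\beta\otimes y_\alpha\circ y_\beta+x_\alpha\otimes y_\alpha\star x_\beta\otimes y_\beta+x_\alpha\circ x_\beta\otimes y_\beta\otimes y_\alpha\big)$, $\mathbf{C}(r)=\sum_{\alpha,\beta}\big([x_\alpha,x_\beta]\otimes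 y_\alpha\otimes y_\beta+x_\alpha\otimes[y_\alpha,x_\beta]\otimes y_\beta+x_\alpha\otimes x_\beta\otimes[y_\alpha,y_\beta]\big)$. A Novikov coalgebra $(A,\Delta)$: $(\mathrm{id}\otimes\Delta)\Delta-(\tau\otimes\mathrm{id})(\mathrm{id}\otimes\Delta)\Delta=(\Delta\otimes\mathrm{id})\Delta-(\tau\otimes\mathrm{id})(\Delta\otimes\mathrm{id})\Delta$ and $(\tau\otimes\mathrm{id})(\mathrm{id}\otimes\Delta)\tau\Delta=(\Delta\otimes\mathrm{id})\Delta$. A Lie coalgebra $(A,\delta)$: $\delta=-\tau\delta$ and $(\mathrm{id}\otimes\delta)\delta-(\tau\otimes\mathrm{id})(\mathrm{id}\otimes\delta)\delta=(\delta\otimes\mathrm{id})\delta$. A GD coalgebra $(A,\Delta,\delta)$: both of these and $(\mathrm{id}\otimes\delta)\Delta-(\tau\otimes\mathrm{id})(\mathrm{id}\otimes\Delta)\delta+(\tau\otimes\mathrm{id})(\mathrm{id}\otimes\delta)\tau\Delta=(\Delta\otimes\mathrm{id})\delta+(\delta\otimes\mathrm{id})\Delta$. A Novikov bialgebra $(A,\circ,\Delta)$: Novikov algebra and Novikov coalgebra with $\Delta(a\circ b)=(R_\circ(b)\otimes\mathrm{id})\Delta(a)+(\mathrm{id}\otimes L_\star(a))(\Delta(b)+\tau\Delta(b))$; $(L_\star(a)\otimes\mathrm{id})\Delta(b)-(\mathrm{id}\otimes L_\star(a))\tau\Delta(b)=(L_\star(b)\otimes\mathrm{id})\Delta(a)-(\mathrm{id}\otimes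 L_\star(b))\tau\Delta(a)$; $(\mathrm{id}\otimes R_\circ(a)-R_\circ(a)\otimes\mathrm{id})(\Delta(b)+\tau\Delta(b))=(\mathrm{id}\otimes R_\circ(b)-R_\circ(b)\otimes\mathrm{id})(\Delta(a)+\tau\Delta(a))$. A Lie bialgebra $(A,[\cdot,\cdot],\delta)$: Lie algebra and Lie coalgebra with $\delta([a,b])=a.\delta(b)-b.\delta(a)$. A GD bialgebra $(A,\circ,[\cdot,\cdot],\Delta,\delta)$: $(A,\circ,[\cdot,\cdot])$ is a GD algebra, $(A,\Delta,\delta)$ a GD coalgebra, $(A,\circ,\Delta)$ a Novikov bialgebra, $(A,[\cdot,\cdot],\delta)$ a Lie bialgebra, and $$\delta(b\circ a)+\Delta([a,b])=(R_\circ(a)\otimes\mathrm{id})\delta(b)+(L_\circ(b)\otimes\mathrm{id})\delta(a)+(\mathrm{id}\otimes L_\star(b))\delta(a)+a.\Delta(b)-(\mathrm{id}\otimes\mathrm{ad}(b))(\Delta(a)+\tau\Delta(a)).$$ A Lie conformal algebra is a $\mathbf{k}[\partial]$-module $R$ with a $\mathbf{k}$-bilinear map $[\cdot_\lambda\cdot]:R\times R\to R[\lambda]$ such that $[\partial a_\lambda b]=-\lambda[a_\lambda b]$, $[a_\lambda\partial b]=(\lambda+\partial)[a_\lambda b]$, $[a_\lambda b]=-[b_{-\lambda-\partial}a]$, $[a_\lambda[b_\mu c]]=[[a_\lambda b]_{\lambda+\mu}c]+[b_\mu[a_\lambda c]]$. The Lie conformal algebra corresponding to a GD algebra $(A,\circ,[\cdot,\cdot])$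 is the free module $\mathbf{k}[\partial]A=\mathbf{k}[\partial]\otimes_{\mathbf{k}}A$ with $[a_\lambda b]=\partial(b\circ a)+\lambda(a\star b)+[a,b]$ for $a,b\in A$, extended by the first two identities. Put $\partial^{\otimes^2}=\partial\otimes\mathrm{id}+\mathrm{id}\otimes\partial$, which makes $R\otimes R$ a $\mathbf{k}[\partial]$-module, and $a_\lambda(\sum x\otimes y)=\sum([a_\lambda x]\otimes y+x\otimes[a_\lambda y])$. A Lie conformal bialgebra $(R,[\cdot_\lambda\cdot],\delta)$: a Lie conformal algebra with a $\mathbf{k}[\partial]$-module homomorphism $\delta:R\to R\otimes R$ such that $\delta=-\tau\delta$, $(\mathrm{id}\otimes\delta)\delta-(\tau\otimes\mathrm{id})(\mathrm{id}\otimes\delta)\delta=(\delta\otimes\mathrm{id})\delta$, and $a_\lambda\delta(b)-b_{-\lambda-\partial^{\otimes^2}}\delta(a)=\delta([a_\lambda b])$ for all $a,b\in R$. *)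

theory Defs
  imports
    "HOL-Computational_Algebra.Polynomial"
    "HOL-Library.Function_Algebras"
    "HOL-Library.Product_Plus"
begin

definition bilinear_map ::
  "('k::field \<Rightarrow> 'u::ab_group_add \<Rightarrow> 'u) \<Rightarrow> ('k \<Rightarrow> 'v::ab_group_add \<Rightarrow> 'v) \<Rightarrow> ('k \<Rightarrow> 'w::ab_group_add \<Rightarrow> 'w)
    \<Rightarrow> ('u \<Rightarrow> 'v \<Rightarrow> 'w) \<Rightarrow> bool" where
  "bilinear_map s1 s2 s3 f \<longleftrightarrow>
     (\<forall>x. Vector_Spaces.linear s2 s3 (\<lambda>y. f x y)) \<and> (\<forall>y. Vector_Spaces.linear s1 s3 (\<lambda>x. f x y))"

definition trilinear_map ::
  "('k::field \<Rightarrow> 'v::ab_group_add \<Rightarrow> 'v) \<Rightarrow> ('k \<Rightarrow> 'w::ab_group_add \<Rightarrow> 'w)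
    \<Rightarrow> ('v \<Rightarrow> 'v \<Rightarrow> 'v \<Rightarrow> 'w) \<Rightarrow> bool" where
  "trilinear_map s s' f \<longleftrightarrow>
     (\<forall>x y. Vector_Spaces.linear s s' (\<lambda>z. f x y z)) \<and>
     (\<forall>x z. Vector_Spaces.linear s s' (\<lambda>y. f x y z)) \<and>
     (\<forall>y z. Vector_Spaces.linear s s' (\<lambda>x. f x y z))"

text \<open>The linear functionals on a space with a given scalar multiplication form a set, not a type.
  The dual space is therefore a type \<open>'d\<close> together with a linear isomorphism \<open>pair\<close> (the
  canonical pairing) onto the set of all linear functionals.\<close>

definition is_dual_space ::
  "('k::field \<Rightarrow> 'a::ab_group_add \<Rightarrow> 'a) \<Rightarrow> ('k \<Rightarrow> 'd::ab_group_add \<Rightarrow> 'd) \<Rightarrow> ('d \<Rightarrow> 'a \<Rightarrow> 'k) \<Rightarrow> bool" where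
  "is_dual_space s sd pair \<longleftrightarrow>
     bilinear_map sd s (*) pair \<and> bij_betw pair UNIV {f. Vector_Spaces.linear s (*) f}"

definition dual_act :: "('d \<Rightarrow> 'a \<Rightarrow> 'k::field) \<Rightarrow> ('b \<Rightarrow> 'a \<Rightarrow> 'a) \<Rightarrow> 'b \<Rightarrow> 'd \<Rightarrow> 'd" where
  "dual_act pair \<phi> a f = (THE g. \<forall>u. pair g u = - pair f (\<phi> a u))"

text \<open>\<open>V \<otimes> V\<close> and \<open>V \<otimes> V \<otimes> V\<close> are realised inside the dual of the space of bilinear
  (trilinear) forms on \<open>V\<close>, the tensor \<open>x \<otimes> y\<close> being evaluation of a form at \<open>(x, y)\<close>.
  Values at arguments that are not multilinear are set to \<open>0\<close>. For vector spaces of any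
  dimension this is the tensor product: multilinear maps factor through it, by \<open>tlift_tens_sum\<close> and
  \<open>tlift3_tens3_sum\<close> below.\<close>

type_synonym ('v, 'k) tensor2 = "('v \<Rightarrow> 'v \<Rightarrow> 'k) \<Rightarrow> 'k"
type_synonym ('v, 'k) tensor3 = "('v \<Rightarrow> 'v \<Rightarrow> 'v \<Rightarrow> 'k) \<Rightarrow> 'k"

definition tens :: "('k::field \<Rightarrow> 'v::ab_group_add \<Rightarrow> 'v) \<Rightarrow> 'v \<Rightarrow> 'v \<Rightarrow> ('v, 'k) tensor2" where
  "tens s x y = (\<lambda>B. if bilinear_map s s (*) B then B x y else 0)"

definition tens3 :: "('k::field \<Rightarrow> 'v::ab_group_add \<Rightarrow> 'v) \<Rightarrow> 'v \<Rightarrow> 'v \<Rightarrow> 'v \<Rightarrow> ('v, 'k) tensor3" where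
  "tens3 s x y z = (\<lambda>B. if trilinear_map s (*) B then B x y z else 0)"

definition tscale :: "'k::field \<Rightarrow> ('b \<Rightarrow> 'k) \<Rightarrow> 'b \<Rightarrow> 'k" where
  "tscale c t = (\<lambda>B. c * t B)"

definition tspace :: "('k::field \<Rightarrow> 'v::ab_group_add \<Rightarrow> 'v) \<Rightarrow> ('v, 'k) tensor2 set" where
  "tspace s = {t. \<exists>ps. t = (\<Sum>(x, y)\<leftarrow>ps. tens s x y)}"

text \<open>The linear map induced by a bilinear (trilinear) map \<open>f\<close>; the description is
  meaningful only if \<open>f\<close> is multilinear and \<open>t\<close> is a sum of pure tensors.\<close>

definition tlift :: "('k::field \<Rightarrow> 'v::ab_group_add \<Rightarrow> 'v) \<Rightarrow> ('v \<Rightarrow> 'v \<Rightarrow> 'w::ab_group_add)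
    \<Rightarrow> ('v, 'k) tensor2 \<Rightarrow> 'w" where
  "tlift s f t = (THE w. \<exists>ps. t = (\<Sum>(x, y)\<leftarrow>ps. tens s x y) \<and> w = (\<Sum>(x, y)\<leftarrow>ps. f x y))"

definition tlift3 :: "('k::field \<Rightarrow> 'v::ab_group_add \<Rightarrow> 'v) \<Rightarrow> ('v \<Rightarrow> 'v \<Rightarrow> 'v \<Rightarrow> 'w::ab_group_add)
    \<Rightarrow> ('v, 'k) tensor3 \<Rightarrow> 'w" where
  "tlift3 s f t = (THE w. \<exists>ps. t = (\<Sum>(x, y, z)\<leftarrow>ps. tens3 s x y z) \<and> w = (\<Sum>(x, y, z)\<leftarrow>ps. f x y z))"

definition tmap :: "('k::field \<Rightarrow> 'v::ab_group_add \<Rightarrow> 'v) \<Rightarrow> ('k \<Rightarrow> 'w::ab_group_add \<Rightarrow> 'w)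
    \<Rightarrow> ('v \<Rightarrow> 'w) \<Rightarrow> ('v \<Rightarrow> 'w) \<Rightarrow> ('v, 'k) tensor2 \<Rightarrow> ('w, 'k) tensor2" where
  "tmap s s' f g = tlift s (\<lambda>x y. tens s' (f x) (g y))"

definition tflip :: "('k::field \<Rightarrow> 'v::ab_group_add \<Rightarrow> 'v) \<Rightarrow> ('v, 'k) tensor2 \<Rightarrow> ('v, 'k) tensor2" where
  "tflip s = tlift s (\<lambda>x y. tens s y x)"

definition tflip_id :: "('k::field \<Rightarrow> 'v::ab_group_add \<Rightarrow> 'v) \<Rightarrow> ('v, 'k) tensor3 \<Rightarrow> ('v, 'k) tensor3" where
  "tflip_id s = tlift3 s (\<lambda>x y z. tens3 s y x z)"

definition id_tens :: "('k::field \<Rightarrow> 'v::ab_group_add \<Rightarrow> 'v) \<Rightarrow> ('v \<Rightarrow> ('v, 'k) tensor2)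
    \<Rightarrow> ('v, 'k) tensor2 \<Rightarrow> ('v, 'k) tensor3" where
  "id_tens s \<Delta> = tlift s (\<lambda>x y. tlift s (\<lambda>u v. tens3 s x u v) (\<Delta> y))"

definition tens_id :: "('k::field \<Rightarrow> 'v::ab_group_add \<Rightarrow> 'v) \<Rightarrow> ('v \<Rightarrow> ('v, 'k) tensor2)
    \<Rightarrow> ('v, 'k) tensor2 \<Rightarrow> ('v, 'k) tensor3" where
  "tens_id s \<Delta> = tlift s (\<lambda>x y. tlift s (\<lambda>u v. tens3 s u v y) (\<Delta> x))"

lemma vector_space_mult: "vector_space ((*) :: 'k::field \<Rightarrow> 'k \<Rightarrow> 'k)"
  by unfold_locales (auto simp: algebra_simps)

lemma linear_functional_separates:
  fixes s :: "'k::field \<Rightarrow> 'v::ab_group_add \<Rightarrow> 'v"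
  assumes "vector_space s" "\<And>\<phi>. Vector_Spaces.linear s (*) \<phi> \<Longrightarrow> \<phi> x = \<phi> y"
  shows "x = y"
proof (rule ccontr)
  assume ne: "x \<noteq> y"
  interpret vector_space s by fact
  interpret vector_space_pair s "(*) :: 'k \<Rightarrow> 'k \<Rightarrow> 'k"
    using assms(1) vector_space_mult by (simp add: vector_space_pair_def)
  have "\<not> dependent {x - y}" using ne by simp
  from linear_independent_extend[OF this, of "\<lambda>_. 1"] obtain \<phi>
    where \<phi>: "Vector_Spaces.linear s (*) \<phi>" "\<phi> (x - y) = 1" by auto
  with assms(2)[OF \<phi>(1)] show False by (auto simp: linear_diff)
qed

lemma linear_sum_list:
  assumes "Vector_Spaces.linear s s' \<phi>"
  shows "\<phi> (sum_list xs) = (\<Sum>x\<leftarrow>xs. \<phi> x)"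
proof -
  interpret Vector_Spaces.linear s s' \<phi> by fact
  show ?thesis by (induction xs) (auto simp: zero add)
qed

lemma bilinear_map_comp:
  assumes "bilinear_map s1 s2 s3 f" "Vector_Spaces.linear s3 s4 \<phi>"
  shows "bilinear_map s1 s2 s4 (\<lambda>x y. \<phi> (f x y))"
  using assms(1) unfolding bilinear_map_def
  by (intro conjI allI Vector_Spaces.linear_compose[OF _ assms(2), unfolded comp_def]) auto

lemma trilinear_map_comp:
  assumes "trilinear_map s s' f" "Vector_Spaces.linear s' s4 \<phi>"
  shows "trilinear_map s s4 (\<lambda>x y z. \<phi> (f x y z))"
  using assms(1) unfolding trilinear_map_def
  by (intro conjI allI Vector_Spaces.linear_compose[OF _ assms(2), unfolded comp_def]) auto

lemma tens_sum_apply: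
  assumes "bilinear_map s s (*) B"
  shows "(\<Sum>(x, y)\<leftarrow>ps. tens s x y) B = (\<Sum>(x, y)\<leftarrow>ps. B x y)"
  using assms by (induction ps) (auto simp: tens_def)

lemma tens3_sum_apply:
  assumes "trilinear_map s (*) B"
  shows "(\<Sum>(x, y, z)\<leftarrow>ps. tens3 s x y z) B = (\<Sum>(x, y, z)\<leftarrow>ps. B x y z)"
  using assms by (induction ps) (auto simp: tens3_def)

lemma tlift_tens_sum:
  fixes f :: "'v::ab_group_add \<Rightarrow> 'v \<Rightarrow> 'w::ab_group_add"
  assumes f: "bilinear_map s s s' f"
  shows "tlift s f (\<Sum>(x, y)\<leftarrow>ps. tens s x y) = (\<Sum>(x, y)\<leftarrow>ps. f x y)"
  unfolding tlift_def
proof (rule the_equality)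
  fix w
  assume "\<exists>qs. (\<Sum>(x, y)\<leftarrow>ps. tens s x y) = (\<Sum>(x, y)\<leftarrow>qs. tens s x y) \<and> w = (\<Sum>(x, y)\<leftarrow>qs. f x y)"
  then obtain qs where eq: "(\<Sum>(x, y)\<leftarrow>ps. tens s x y) = (\<Sum>(x, y)\<leftarrow>qs. tens s x y)"
    and w: "w = (\<Sum>(x, y)\<leftarrow>qs. f x y)" by blast
  show "w = (\<Sum>(x, y)\<leftarrow>ps. f x y)"
  proof (rule linear_functional_separates)
    show "vector_space s'"
      using f by (auto simp: bilinear_map_def Vector_Spaces.linear_def)
    fix \<phi> :: "'w \<Rightarrow> _"
    assume \<phi>: "Vector_Spaces.linear s' (*) \<phi>"
    have *: "\<phi> (\<Sum>(x, y)\<leftarrow>rs. f x y) = (\<Sum>(x, y)\<leftarrow>rs. tens s x y) (\<lambda>x y. \<phi> (f x y))" for rs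
      unfolding tens_sum_apply[OF bilinear_map_comp[OF f \<phi>]] linear_sum_list[OF \<phi>]
      by (simp add: comp_def case_prod_unfold)
    show "\<phi> w = \<phi> (\<Sum>(x, y)\<leftarrow>ps. f x y)"
      unfolding w * by (simp only: eq)
  qed
qed blast

lemma tlift3_tens3_sum:
  fixes f :: "'v::ab_group_add \<Rightarrow> 'v \<Rightarrow> 'v \<Rightarrow> 'w::ab_group_add"
  assumes f: "trilinear_map s s' f"
  shows "tlift3 s f (\<Sum>(x, y, z)\<leftarrow>ps. tens3 s x y z) = (\<Sum>(x, y, z)\<leftarrow>ps. f x y z)"
  unfolding tlift3_def
proof (rule the_equality)
  fix w
  assume "\<exists>qs. (\<Sum>(x, y, z)\<leftarrow>ps. tens3 s x y z) = (\<Sum>(x, y, z)\<leftarrow>qs. tens3 s x y z)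
    \<and> w = (\<Sum>(x, y, z)\<leftarrow>qs. f x y z)"
  then obtain qs where eq: "(\<Sum>(x, y, z)\<leftarrow>ps. tens3 s x y z) = (\<Sum>(x, y, z)\<leftarrow>qs. tens3 s x y z)"
    and w: "w = (\<Sum>(x, y, z)\<leftarrow>qs. f x y z)" by blast
  show "w = (\<Sum>(x, y, z)\<leftarrow>ps. f x y z)"
  proof (rule linear_functional_separates)
    show "vector_space s'"
      using f by (auto simp: trilinear_map_def Vector_Spaces.linear_def)
    fix \<phi> :: "'w \<Rightarrow> _"
    assume \<phi>: "Vector_Spaces.linear s' (*) \<phi>"
    have *: "\<phi> (\<Sum>(x, y, z)\<leftarrow>rs. f x y z) = (\<Sum>(x, y, z)\<leftarrow>rs. tens3 s x y z) (\<lambda>x y z. \<phi> (f x y z))" for rs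
      unfolding tens3_sum_apply[OF trilinear_map_comp[OF f \<phi>]] linear_sum_list[OF \<phi>]
      by (simp add: comp_def case_prod_unfold)
    show "\<phi> w = \<phi> (\<Sum>(x, y, z)\<leftarrow>ps. f x y z)"
      unfolding w * by (simp only: eq)
  qed
qed blast

definition left_symmetric_algebra :: "('k::field \<Rightarrow> 'a::ab_group_add \<Rightarrow> 'a) \<Rightarrow> ('a \<Rightarrow> 'a \<Rightarrow> 'a) \<Rightarrow> bool" where
  "left_symmetric_algebra s m \<longleftrightarrow> bilinear_map s s s m \<and>
     (\<forall>a b c. m (m a b) c - m a (m b c) = m (m b a) c - m b (m a c))"

definition novikov_algebra :: "('k::field \<Rightarrow> 'a::ab_group_add \<Rightarrow> 'a) \<Rightarrow> ('a \<Rightarrow> 'a \<Rightarrow> 'a) \<Rightarrow> bool" where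
  "novikov_algebra s m \<longleftrightarrow> left_symmetric_algebra s m \<and>
     (\<forall>a b c. m (m a b) c = m (m a c) b)"

definition lie_algebra :: "('k::field \<Rightarrow> 'a::ab_group_add \<Rightarrow> 'a) \<Rightarrow> ('a \<Rightarrow> 'a \<Rightarrow> 'a) \<Rightarrow> bool" where
  "lie_algebra s br \<longleftrightarrow> bilinear_map s s s br \<and>
     (\<forall>a. br a a = 0) \<and>
     (\<forall>a b c. br a (br b c) + br b (br c a) + br c (br a b) = 0)"

definition gd_algebra :: "('k::field \<Rightarrow> 'a::ab_group_add \<Rightarrow> 'a) \<Rightarrow> ('a \<Rightarrow> 'a \<Rightarrow> 'a) \<Rightarrow> ('a \<Rightarrow> 'a \<Rightarrow> 'a) \<Rightarrow> bool" where
  "gd_algebra s m br \<longleftrightarrow> novikov_algebra s m \<and> lie_algebra s br \<and>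
     (\<forall>a b c. br (m a b) c - br (m a c) b + m (br a b) c - m (br a c) b - m a (br b c) = 0)"

definition pre_novikov_algebra ::
  "('k::field \<Rightarrow> 'a::ab_group_add \<Rightarrow> 'a) \<Rightarrow> ('a \<Rightarrow> 'a \<Rightarrow> 'a) \<Rightarrow> ('a \<Rightarrow> 'a \<Rightarrow> 'a) \<Rightarrow> bool" where
  "pre_novikov_algebra s lhd rhd \<longleftrightarrow> bilinear_map s s s lhd \<and> bilinear_map s s s rhd \<and>
     (\<forall>a b c. rhd a (rhd b c) =
        rhd (rhd a b + lhd a b) c + rhd b (rhd a c) - rhd (rhd b a + lhd b a) c) \<and>
     (\<forall>a b c. rhd a (lhd b c) =
        lhd (rhd a b) c + lhd b (lhd a c + rhd a c) - lhd (lhd b a) c) \<and>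
     (\<forall>a b c. rhd (lhd a b + rhd a b) c = lhd (rhd a c) b) \<and>
     (\<forall>a b c. lhd (lhd a b) c = lhd (lhd a c) b)"

definition pre_gd_algebra ::
  "('k::field \<Rightarrow> 'a::ab_group_add \<Rightarrow> 'a) \<Rightarrow> ('a \<Rightarrow> 'a \<Rightarrow> 'a) \<Rightarrow> ('a \<Rightarrow> 'a \<Rightarrow> 'a) \<Rightarrow> ('a \<Rightarrow> 'a \<Rightarrow> 'a) \<Rightarrow> bool" where
  "pre_gd_algebra s lhd rhd dia \<longleftrightarrow>
     pre_novikov_algebra s lhd rhd \<and> left_symmetric_algebra s dia \<and>
     (\<forall>a b c. lhd c (dia a b - dia b a) - dia a (lhd c b) - lhd (dia b c) a =
        - dia b (lhd c a) - lhd (dia a c) b) \<and>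
     (\<forall>a b c. rhd (dia a b - dia b a) c + dia (lhd a b + rhd a b) c =
        rhd a (dia b c) - dia b (rhd a c) + lhd (dia a c) b)"

definition star :: "('a \<Rightarrow> 'a \<Rightarrow> 'a::plus) \<Rightarrow> 'a \<Rightarrow> 'a \<Rightarrow> 'a" where
  "star m a b = m a b + m b a"

definition prod_scale :: "('k \<Rightarrow> 'a \<Rightarrow> 'a) \<Rightarrow> ('k \<Rightarrow> 'd \<Rightarrow> 'd) \<Rightarrow> 'k \<Rightarrow> 'a \<times> 'd \<Rightarrow> 'a \<times> 'd" where
  "prod_scale s sd c = (\<lambda>(a, f). (s c a, sd c f))"

definition semidirect_mult ::
  "('a \<Rightarrow> 'a \<Rightarrow> 'a) \<Rightarrow> ('a \<Rightarrow> 'd \<Rightarrow> 'd) \<Rightarrow> ('a \<Rightarrow> 'd \<Rightarrow> 'd) \<Rightarrow> 'a \<times> 'd::plus \<Rightarrow> 'a \<times> 'd \<Rightarrow> 'a \<times> 'd" where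
  "semidirect_mult m l r = (\<lambda>(a, f) (b, g). (m a b, l a g + r b f))"

definition semidirect_bracket ::
  "('a \<Rightarrow> 'a \<Rightarrow> 'a) \<Rightarrow> ('a \<Rightarrow> 'd \<Rightarrow> 'd) \<Rightarrow> 'a \<times> 'd::minus \<Rightarrow> 'a \<times> 'd \<Rightarrow> 'a \<times> 'd" where
  "semidirect_bracket br \<rho> = (\<lambda>(a, f) (b, g). (br a b, \<rho> a g - \<rho> b f))"

text \<open>\<open>A \<ltimes> A\<^sup>*\<close> with respect to \<open>L\<^sub>\<rhd>\<^sup>* + R\<^sub>\<lhd>\<^sup>*\<close>, \<open>- R\<^sub>\<lhd>\<^sup>*\<close> and \<open>L\<^sub>\<diamond>\<^sup>*\<close>.\<close>

definition hat_mult :: "('d::ab_group_add \<Rightarrow> 'a \<Rightarrow> 'k::field) \<Rightarrow> ('a \<Rightarrow> 'a \<Rightarrow> 'a) \<Rightarrow> ('a \<Rightarrow> 'a \<Rightarrow> 'a::ab_group_add)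
    \<Rightarrow> 'a \<times> 'd \<Rightarrow> 'a \<times> 'd \<Rightarrow> 'a \<times> 'd" where
  "hat_mult pair lhd rhd =
     semidirect_mult (\<lambda>a b. lhd a b + rhd a b)
       (\<lambda>a f. dual_act pair (\<lambda>x u. rhd x u) a f + dual_act pair (\<lambda>x u. lhd u x) a f)
       (\<lambda>a f. - dual_act pair (\<lambda>x u. lhd u x) a f)"

definition hat_bracket :: "('d::ab_group_add \<Rightarrow> 'a \<Rightarrow> 'k::field) \<Rightarrow> ('a \<Rightarrow> 'a \<Rightarrow> 'a::ab_group_add)
    \<Rightarrow> 'a \<times> 'd \<Rightarrow> 'a \<times> 'd \<Rightarrow> 'a \<times> 'd" where
  "hat_bracket pair dia =
     semidirect_bracket (\<lambda>a b. dia a b - dia b a) (dual_act pair (\<lambda>x u. dia x u))"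

definition yb_N :: "('k::field \<Rightarrow> 'a::ab_group_add \<Rightarrow> 'a) \<Rightarrow> ('a \<Rightarrow> 'a \<Rightarrow> 'a) \<Rightarrow> ('a, 'k) tensor2 \<Rightarrow> ('a, 'k) tensor3" where
  "yb_N s m r = tlift s (\<lambda>x y. tlift s (\<lambda>x' y'.
      tens3 s x x' (m y y') + tens3 s x (star m y x') y' + tens3 s (m x x') y' y) r) r"

definition yb_C :: "('k::field \<Rightarrow> 'a::ab_group_add \<Rightarrow> 'a) \<Rightarrow> ('a \<Rightarrow> 'a \<Rightarrow> 'a) \<Rightarrow> ('a, 'k) tensor2 \<Rightarrow> ('a, 'k) tensor3" where
  "yb_C s br r = tlift s (\<lambda>x y. tlift s (\<lambda>x' y'.
      tens3 s (br x x') y y' + tens3 s x (br y x') y' + tens3 s x x' (br y y')) r) r"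

definition gd_ybe :: "('k::field \<Rightarrow> 'a::ab_group_add \<Rightarrow> 'a) \<Rightarrow> ('a \<Rightarrow> 'a \<Rightarrow> 'a) \<Rightarrow> ('a \<Rightarrow> 'a \<Rightarrow> 'a)
    \<Rightarrow> ('a, 'k) tensor2 \<Rightarrow> bool" where
  "gd_ybe s m br r \<longleftrightarrow> r \<in> tspace s \<and> yb_N s m r = 0 \<and> yb_C s br r = 0"

definition skew_symmetric :: "('k::field \<Rightarrow> 'a::ab_group_add \<Rightarrow> 'a) \<Rightarrow> ('a, 'k) tensor2 \<Rightarrow> bool" where
  "skew_symmetric s r \<longleftrightarrow> r + tflip s r = 0"

definition coproduct :: "('k::field \<Rightarrow> 'a::ab_group_add \<Rightarrow> 'a) \<Rightarrow> ('a \<Rightarrow> ('a, 'k) tensor2) \<Rightarrow> bool" where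
  "coproduct s \<Delta> \<longleftrightarrow> Vector_Spaces.linear s tscale \<Delta> \<and> range \<Delta> \<subseteq> tspace s"

definition novikov_coalgebra :: "('k::field \<Rightarrow> 'a::ab_group_add \<Rightarrow> 'a) \<Rightarrow> ('a \<Rightarrow> ('a, 'k) tensor2) \<Rightarrow> bool" where
  "novikov_coalgebra s \<Delta> \<longleftrightarrow> coproduct s \<Delta> \<and>
     (\<forall>a. id_tens s \<Delta> (\<Delta> a) - tflip_id s (id_tens s \<Delta> (\<Delta> a)) =
          tens_id s \<Delta> (\<Delta> a) - tflip_id s (tens_id s \<Delta> (\<Delta> a))) \<and>
     (\<forall>a. tflip_id s (id_tens s \<Delta> (tflip s (\<Delta> a))) = tens_id s \<Delta> (\<Delta> a))"

definition lie_coalgebra :: "('k::field \<Rightarrow> 'a::ab_group_add \<Rightarrow> 'a) \<Rightarrow> ('a \<Rightarrow> ('a, 'k) tensor2) \<Rightarrow> bool" where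
  "lie_coalgebra s \<delta> \<longleftrightarrow> coproduct s \<delta> \<and>
     (\<forall>a. \<delta> a = - tflip s (\<delta> a)) \<and>
     (\<forall>a. id_tens s \<delta> (\<delta> a) - tflip_id s (id_tens s \<delta> (\<delta> a)) = tens_id s \<delta> (\<delta> a))"

definition gd_coalgebra ::
  "('k::field \<Rightarrow> 'a::ab_group_add \<Rightarrow> 'a) \<Rightarrow> ('a \<Rightarrow> ('a, 'k) tensor2) \<Rightarrow> ('a \<Rightarrow> ('a, 'k) tensor2) \<Rightarrow> bool" where
  "gd_coalgebra s \<Delta> \<delta> \<longleftrightarrow> novikov_coalgebra s \<Delta> \<and> lie_coalgebra s \<delta> \<and>
     (\<forall>a. id_tens s \<delta> (\<Delta> a) - tflip_id s (id_tens s \<Delta> (\<delta> a))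
            + tflip_id s (id_tens s \<delta> (tflip s (\<Delta> a))) =
          tens_id s \<Delta> (\<delta> a) + tens_id s \<delta> (\<Delta> a))"

definition novikov_bialgebra ::
  "('k::field \<Rightarrow> 'a::ab_group_add \<Rightarrow> 'a) \<Rightarrow> ('a \<Rightarrow> 'a \<Rightarrow> 'a) \<Rightarrow> ('a \<Rightarrow> ('a, 'k) tensor2) \<Rightarrow> bool" where
  "novikov_bialgebra s m \<Delta> \<longleftrightarrow> novikov_algebra s m \<and> novikov_coalgebra s \<Delta> \<and>
     (\<forall>a b. \<Delta> (m a b) =
        tmap s s (\<lambda>x. m x b) id (\<Delta> a) + tmap s s id (star m a) (\<Delta> b + tflip s (\<Delta> b))) \<and>
     (\<forall>a b. tmap s s (star m a) id (\<Delta> b) - tmap s s id (star m a) (tflip s (\<Delta> b)) =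
        tmap s s (star m b) id (\<Delta> a) - tmap s s id (star m b) (tflip s (\<Delta> a))) \<and>
     (\<forall>a b. tmap s s id (\<lambda>x. m x a) (\<Delta> b + tflip s (\<Delta> b)) - tmap s s (\<lambda>x. m x a) id (\<Delta> b + tflip s (\<Delta> b)) =
        tmap s s id (\<lambda>x. m x b) (\<Delta> a + tflip s (\<Delta> a)) - tmap s s (\<lambda>x. m x b) id (\<Delta> a + tflip s (\<Delta> a)))"

definition tensor_act :: "('k::field \<Rightarrow> 'a::ab_group_add \<Rightarrow> 'a) \<Rightarrow> ('a \<Rightarrow> 'a \<Rightarrow> 'a) \<Rightarrow> 'a
    \<Rightarrow> ('a, 'k) tensor2 \<Rightarrow> ('a, 'k) tensor2" where
  "tensor_act s br a t = tmap s s (br a) id t + tmap s s id (br a) t"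

definition lie_bialgebra ::
  "('k::field \<Rightarrow> 'a::ab_group_add \<Rightarrow> 'a) \<Rightarrow> ('a \<Rightarrow> 'a \<Rightarrow> 'a) \<Rightarrow> ('a \<Rightarrow> ('a, 'k) tensor2) \<Rightarrow> bool" where
  "lie_bialgebra s br \<delta> \<longleftrightarrow> lie_algebra s br \<and> lie_coalgebra s \<delta> \<and>
     (\<forall>a b. \<delta> (br a b) = tensor_act s br a (\<delta> b) - tensor_act s br b (\<delta> a))"

definition gd_bialgebra ::
  "('k::field \<Rightarrow> 'a::ab_group_add \<Rightarrow> 'a) \<Rightarrow> ('a \<Rightarrow> 'a \<Rightarrow> 'a) \<Rightarrow> ('a \<Rightarrow> 'a \<Rightarrow> 'a)
    \<Rightarrow> ('a \<Rightarrow> ('a, 'k) tensor2) \<Rightarrow> ('a \<Rightarrow> ('a, 'k) tensor2) \<Rightarrow> bool" where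
  "gd_bialgebra s m br \<Delta> \<delta> \<longleftrightarrow>
     gd_algebra s m br \<and> gd_coalgebra s \<Delta> \<delta> \<and> novikov_bialgebra s m \<Delta> \<and> lie_bialgebra s br \<delta> \<and>
     (\<forall>a b. \<delta> (m b a) + \<Delta> (br a b) =
        tmap s s (\<lambda>x. m x a) id (\<delta> b) + tmap s s (m b) id (\<delta> a) + tmap s s id (star m b) (\<delta> a)
        + tensor_act s br a (\<Delta> b) - tmap s s id (br b) (\<Delta> a + tflip s (\<Delta> a)))"

text \<open>For a space \<open>M\<close>, \<open>M[\<lambda>]\<close> is the type of polynomials with coefficients in \<open>M\<close>.
  \<open>poly_subst X F p\<close> substitutes the operator \<open>X\<close> for the variable of \<open>p\<close>, after applying the
  linear map \<open>F\<close> to the coefficients: \<open>\<Sum>\<^sub>n \<lambda>\<^sup>n c\<^sub>n \<mapsto> \<Sum>\<^sub>n X\<^sup>n (F c\<^sub>n)\<close>.\<close>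

definition poly_subst :: "('n \<Rightarrow> 'n) \<Rightarrow> ('m \<Rightarrow> 'n) \<Rightarrow> 'm::zero poly \<Rightarrow> 'n::ab_group_add" where
  "poly_subst X F p = (\<Sum>n\<le>degree p. (X ^^ n) (F (coeff p n)))"

definition poly_scale :: "('k \<Rightarrow> 'v \<Rightarrow> 'v) \<Rightarrow> 'k \<Rightarrow> 'v::zero poly \<Rightarrow> 'v poly" where
  "poly_scale s c = map_poly (s c)"

abbreviation var_mult :: "'v::zero poly \<Rightarrow> 'v poly" where
  "var_mult \<equiv> pCons 0"

text \<open>A \<open>k[\<partial>]\<close>-module is a vector space with an endomorphism \<open>D\<close>. In the Jacobi identity
  \<open>R[\<lambda>, \<mu>]\<close> is \<open>R[\<lambda>][\<mu>]\<close>: multiplication by \<open>\<mu>\<close> is \<open>var_mult\<close>, multiplication by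
  \<open>\<lambda>\<close> is \<open>map_poly var_mult\<close>.\<close>

definition lie_conformal_algebra ::
  "('k::field \<Rightarrow> 'r::ab_group_add \<Rightarrow> 'r) \<Rightarrow> ('r \<Rightarrow> 'r) \<Rightarrow> ('r \<Rightarrow> 'r \<Rightarrow> 'r poly) \<Rightarrow> bool" where
  "lie_conformal_algebra s D br \<longleftrightarrow>
     Vector_Spaces.linear s s D \<and> bilinear_map s s (poly_scale s) br \<and>
     (\<forall>a b. br (D a) b = - var_mult (br a b)) \<and>
     (\<forall>a b. br a (D b) = var_mult (br a b) + map_poly D (br a b)) \<and>
     (\<forall>a b. br a b = - poly_subst (\<lambda>p. - var_mult p - map_poly D p) (\<lambda>x. [:x:]) (br b a)) \<and>
     (\<forall>a b c. poly_subst var_mult (\<lambda>x. [:br a x:]) (br b c) =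
        poly_subst (map_poly var_mult)
          (\<lambda>x. poly_subst (\<lambda>p. map_poly var_mult p + var_mult p) (\<lambda>y. [:[:y:]:]) (br x c)) (br a b)
        + poly_subst (map_poly var_mult) (\<lambda>x. map_poly (\<lambda>y. [:y:]) (br b x)) (br a c))"

text \<open>The Lie conformal algebra \<open>k[\<partial>]A\<close> of a Gel'fand-Dorfman algebra: elements of
  \<open>k[\<partial>]A\<close> are polynomials in \<open>\<partial>\<close> with coefficients in \<open>A\<close>, and
  \<open>[\<partial>\<^sup>m a\<^sub>\<lambda> \<partial>\<^sup>n b] = (-\<lambda>)\<^sup>m (\<lambda> + \<partial>)\<^sup>n [a\<^sub>\<lambda> b]\<close>.\<close>

definition gd_conformal_base :: "('a \<Rightarrow> 'a \<Rightarrow> 'a) \<Rightarrow> ('a \<Rightarrow> 'a \<Rightarrow> 'a::ab_group_add) \<Rightarrow> 'a \<Rightarrow> 'a \<Rightarrow> 'a poly poly" where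
  "gd_conformal_base m br a b = [: var_mult [:m b a:] + [:br a b:], [:star m a b:] :]"

definition gd_conformal_bracket ::
  "('a \<Rightarrow> 'a \<Rightarrow> 'a) \<Rightarrow> ('a \<Rightarrow> 'a \<Rightarrow> 'a::ab_group_add) \<Rightarrow> 'a poly \<Rightarrow> 'a poly \<Rightarrow> 'a poly poly" where
  "gd_conformal_bracket m br p q =
     poly_subst (\<lambda>u. - var_mult u)
       (\<lambda>a. poly_subst (\<lambda>u. var_mult u + map_poly var_mult u) (\<lambda>b. gd_conformal_base m br a b) q) p"

definition tensor_D :: "('k::field \<Rightarrow> 'r::ab_group_add \<Rightarrow> 'r) \<Rightarrow> ('r \<Rightarrow> 'r) \<Rightarrow> ('r, 'k) tensor2 \<Rightarrow> ('r, 'k) tensor2" where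
  "tensor_D s D t = tmap s s D id t + tmap s s id D t"

definition conformal_act :: "('k::field \<Rightarrow> 'r::ab_group_add \<Rightarrow> 'r) \<Rightarrow> ('r \<Rightarrow> 'r \<Rightarrow> 'r poly)
    \<Rightarrow> 'r \<Rightarrow> ('r, 'k) tensor2 \<Rightarrow> ('r, 'k) tensor2 poly" where
  "conformal_act s br a =
     tlift s (\<lambda>x y. map_poly (\<lambda>u. tens s u y) (br a x) + map_poly (\<lambda>v. tens s x v) (br a y))"

definition lie_conformal_bialgebra ::
  "('k::field \<Rightarrow> 'r::ab_group_add \<Rightarrow> 'r) \<Rightarrow> ('r \<Rightarrow> 'r) \<Rightarrow> ('r \<Rightarrow> 'r \<Rightarrow> 'r poly)
    \<Rightarrow> ('r \<Rightarrow> ('r, 'k) tensor2) \<Rightarrow> bool" where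
  "lie_conformal_bialgebra s D br \<delta> \<longleftrightarrow> lie_conformal_algebra s D br \<and>
     coproduct s \<delta> \<and> (\<forall>a. \<delta> (D a) = tensor_D s D (\<delta> a)) \<and>
     (\<forall>a. \<delta> a = - tflip s (\<delta> a)) \<and>
     (\<forall>a. id_tens s \<delta> (\<delta> a) - tflip_id s (id_tens s \<delta> (\<delta> a)) = tens_id s \<delta> (\<delta> a)) \<and>
     (\<forall>a b. conformal_act s br a (\<delta> b)
        - poly_subst (\<lambda>p. - var_mult p - map_poly (tensor_D s D) p) (\<lambda>t. [:t:]) (conformal_act s br b (\<delta> a))
        = map_poly \<delta> (br a b))"

end

theory Submission
  imports Defs
begin

text \<open>
  Write \<open>H = A \<oplus> A\<^sup>*\<close>. On \<open>H\<close> there is the skew form \<open>\<omega>(a + f, b + g) = f(b) - g(a)\<close>, and \<open>r\<close> is its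
  inverse: if \<open>r = \<Sum> x \<otimes> y\<close> then \<open>\<Sum> \<omega>(y, u) x = u\<close> for every \<open>u\<close>. Because the actions on \<open>A\<^sup>*\<close> are dual to
  \<open>\<rhd>\<close>, \<open>\<lhd>\<close> and \<open>\<diamond>\<close>, the form satisfies
  \<open>\<omega>([u, v], w) + \<omega>([v, w], u) + \<omega>([w, u], v) = 0\<close> and
  \<open>\<omega>(u, v \<circ> w) = \<omega>(u \<circ> w, v) - \<omega>(u \<circ> v, w) - \<omega>(v \<circ> u, w)\<close>.
  These properties, together with the fact that \<open>H\<close> is a Gel'fand-Dorfman algebra (\<open>gd_algebra_hat\<close>), are
  collected in the locale \<open>symplectic_gd\<close> and imply all the claims.

  \<^item> Pairing \<open>C(r)\<close> and \<open>N(r)\<close> with \<open>u \<otimes> v \<otimes> w\<close> through \<open>\<omega>\<close> gives the left side minus the right side of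
    the two identities for \<open>\<omega>\<close>, up to sign; so \<open>r\<close> solves the Yang-Baxter equation (\<open>gd_ybe\<close>).
  \<^item> Pairing \<open>\<Delta>(a)\<close> and \<open>\<delta>\<^sub>0(a)\<close> with \<open>p \<otimes> q\<close> gives \<open>- \<omega>(a, p \<circ> q)\<close> and \<open>- \<omega>(a, [p, q])\<close> (\<open>cop_dual\<close>,
    \<open>cobr_dual\<close>): up to sign, the coproducts are dual to the product and the bracket of \<open>H\<close> itself.
    Hence the identities of a Gel'fand-Dorfman coalgebra, which are quadratic in \<open>r\<close>, are the dual of those
    of the algebra (\<open>gd_coalgebra\<close>).
  \<^item> The compatibility conditions of a bialgebra are linear in \<open>r\<close>. Both sides have the form
    \<open>\<Sum> (P \<otimes> Q) r\<close>, and after \<open>\<Delta> + \<tau>\<Delta>\<close> has been rewritten by the skew symmetry of \<open>r\<close> the operators agree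
    (\<open>novikov_bialgebra\<close>, \<open>lie_bialgebra\<close>, \<open>gd_bialgebra\<close>).

  For the conformal statements, polynomials are replaced by their values, which determine them because the
  field is infinite. Let \<open>p(x) \<in> H\<close> be the value of \<open>p \<in> k[\<partial>]H\<close> at \<open>\<partial> = x\<close> and put
  \<open>G l d a b = d (b \<circ> a) + l (a \<star> b) + [a, b]\<close>. Then \<open>[p\<^sub>\<lambda> q]\<close> takes the value \<open>G l d (p(-l)) (q(l + d))\<close> at
  \<open>\<lambda> = l\<close>, \<open>\<partial> = d\<close>, and the axioms of a Gel'fand-Dorfman algebra give one three-parameter Jacobi identity for
  \<open>G\<close> (\<open>gd_ev_jacobi\<close>). This identity is used three times: it is the Jacobi identity of the Lie conformal
  algebra; read as an identity between the operators \<open>G l d a\<close> it is the cocycle condition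
  (\<open>conf_cocycle\<close>); and since \<open>\<delta>(a)\<close>, evaluated at \<open>(x, y)\<close> and paired with \<open>p \<otimes> q\<close>, is
  \<open>- \<omega>(a(x + y), G x (-x - y) p q)\<close> (\<open>conf_cop_dual\<close>), it is also dual to the co-Jacobi identity
  (\<open>conf_cop_coJacobi\<close>).
\<close>

section \<open>Linear and multilinear maps\<close>

lemma linear_imp_module_hom: "Vector_Spaces.linear s1 s2 f \<Longrightarrow> module_hom s1 s2 f"
  by (simp add: Vector_Spaces.linear_def module_hom_def vector_space_def module_def)

lemma linear_iff:
  "Vector_Spaces.linear s1 s2 f \<longleftrightarrow> vector_space s1 \<and> vector_space s2 \<and>
     (\<forall>x y. f (x + y) = f x + f y) \<and> (\<forall>c x. f (s1 c x) = s2 c (f x))"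
  by (auto simp: Vector_Spaces.linear_def module_hom_def module_hom_axioms_def vector_space_def module_def)

lemmas linear_0 = module_hom.zero[OF linear_imp_module_hom]
  and linear_minus = module_hom.neg[OF linear_imp_module_hom]
  and linear_diff = module_hom.diff[OF linear_imp_module_hom]

lemma linear_sum:
  assumes "Vector_Spaces.linear s s' f"
  shows "f (sum g A) = (\<Sum>x\<in>A. f (g x))"
  using module_hom.sum[OF linear_imp_module_hom[OF assms]] .

lemma bilinear_map_iff:
  "bilinear_map s1 s2 s3 f \<longleftrightarrow> vector_space s1 \<and> vector_space s2 \<and> vector_space s3 \<and>
     (\<forall>x x' y. f (x + x') y = f x y + f x' y) \<and> (\<forall>x y y'. f x (y + y') = f x y + f x y') \<and>
     (\<forall>c x y. f (s1 c x) y = s3 c (f x y)) \<and> (\<forall>c x y. f x (s2 c y) = s3 c (f x y))"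
  unfolding bilinear_map_def linear_iff by blast

lemma trilinear_map_iff:
  "trilinear_map s s' f \<longleftrightarrow> vector_space s \<and> vector_space s' \<and>
     (\<forall>x x' y z. f (x + x') y z = f x y z + f x' y z) \<and>
     (\<forall>x y y' z. f x (y + y') z = f x y z + f x y' z) \<and>
     (\<forall>x y z z'. f x y (z + z') = f x y z + f x y z') \<and>
     (\<forall>c x y z. f (s c x) y z = s' c (f x y z)) \<and>
     (\<forall>c x y z. f x (s c y) z = s' c (f x y z)) \<and>
     (\<forall>c x y z. f x y (s c z) = s' c (f x y z))"
  unfolding trilinear_map_def linear_iff by (intro iffI conjI) simp_all

lemma bilinear_map_diff:
  assumes "bilinear_map s1 s2 s3 f"
  shows "f (x - x') y = f x y - f x' y" "f x (y - y') = f x y - f x y'"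
    "f (- x) y = - f x y" "f x (- y) = - f x y"
proof -
  have "Vector_Spaces.linear s2 s3 (f x)" "Vector_Spaces.linear s1 s3 (\<lambda>x. f x y)" for x y
    using assms by (auto simp: bilinear_map_def)
  from linear_diff[OF this(1)] linear_diff[OF this(2)] linear_minus[OF this(1)] linear_minus[OF this(2)]
  show "f (x - x') y = f x y - f x' y" "f x (y - y') = f x y - f x y'"
    "f (- x) y = - f x y" "f x (- y) = - f x y" by auto
qed

lemma bilinear_prod:
  "Vector_Spaces.linear s (*) \<phi> \<Longrightarrow> Vector_Spaces.linear s' (*) \<psi> \<Longrightarrow> bilinear_map s s' (*) (\<lambda>x y. \<phi> x * \<psi> y)"
  by (simp add: bilinear_map_iff linear_iff algebra_simps)

lemma trilinear_prod:
  "Vector_Spaces.linear s (*) \<phi> \<Longrightarrow> Vector_Spaces.linear s (*) \<psi> \<Longrightarrow> Vector_Spaces.linear s (*) \<chi> \<Longrightarrow>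
    trilinear_map s (*) (\<lambda>x y z. \<phi> x * \<psi> y * \<chi> z)"
  by (simp add: trilinear_map_iff linear_iff algebra_simps)

lemma vector_space_simps:
  assumes "vector_space s"
  shows "s c (x + y) = s c x + s c y" "s (a + b) x = s a x + s b x" "s a (s b x) = s (a * b) x"
    "s 1 x = x" "s 0 x = 0" "s c 0 = 0" "s c (- x) = - s c x" "s (- c) x = - s c x"
    "s c (x - y) = s c x - s c y" "s (a - b) x = s a x - s b x"
proof -
  interpret vector_space s by fact
  show "s c (x + y) = s c x + s c y" "s (a + b) x = s a x + s b x" "s a (s b x) = s (a * b) x"
    "s 1 x = x" "s 0 x = 0" "s c 0 = 0" "s c (- x) = - s c x" "s (- c) x = - s c x"
    "s c (x - y) = s c x - s c y" "s (a - b) x = s a x - s b x"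
    by (simp_all add: scale_right_distrib scale_left_distrib scale_right_diff_distrib scale_left_diff_distrib)
qed

lemma vector_space_tscale: "vector_space (tscale :: 'k::field \<Rightarrow> ('b \<Rightarrow> 'k) \<Rightarrow> 'b \<Rightarrow> 'k)"
  by unfold_locales (auto simp: tscale_def algebra_simps fun_eq_iff)

lemma tscale_apply [simp]: "tscale c t B = c * t B"
  by (simp add: tscale_def)

lemma linear_eval: "Vector_Spaces.linear tscale (*) (\<lambda>t. t B)"
  by (simp add: linear_iff vector_space_tscale vector_space_mult)

lemma bilinear_tens: "vector_space s \<Longrightarrow> bilinear_map s s tscale (tens s)"
  by (auto simp: bilinear_map_iff vector_space_tscale tens_def fun_eq_iff)

lemma trilinear_tens3: "vector_space s \<Longrightarrow> trilinear_map s tscale (tens3 s)"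
  by (auto simp: trilinear_map_iff vector_space_tscale tens3_def fun_eq_iff)

section \<open>Tensors as functionals on multilinear forms\<close>

definition tspace3 :: "('k::field \<Rightarrow> 'v::ab_group_add \<Rightarrow> 'v) \<Rightarrow> ('v, 'k) tensor3 set" where
  "tspace3 s = {t. \<exists>ps. t = (\<Sum>(x, y, z)\<leftarrow>ps. tens3 s x y z)}"

lemma tspaceE:
  assumes "t \<in> tspace s"
  obtains ps where "t = (\<Sum>(x, y)\<leftarrow>ps. tens s x y)"
    "\<And>B. bilinear_map s s (*) B \<Longrightarrow> t B = (\<Sum>(x, y)\<leftarrow>ps. B x y)"
  using assms by (auto simp: tspace_def intro: tens_sum_apply)

lemma tspace3E:
  assumes "t \<in> tspace3 s"
  obtains ps where "t = (\<Sum>(x, y, z)\<leftarrow>ps. tens3 s x y z)"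
    "\<And>B. trilinear_map s (*) B \<Longrightarrow> t B = (\<Sum>(x, y, z)\<leftarrow>ps. B x y z)"
  using assms by (auto simp: tspace3_def intro: tens3_sum_apply)

lemma tens_in: "tens s x y \<in> tspace s"
  unfolding tspace_def by (auto intro: exI[of _ "[(x, y)]"])

lemma tens3_in: "tens3 s x y z \<in> tspace3 s"
  unfolding tspace3_def by (auto intro: exI[of _ "[(x, y, z)]"])

lemma tspace_0: "0 \<in> tspace s"
  unfolding tspace_def by (auto intro: exI[of _ "[]"])

lemma tspace3_0: "0 \<in> tspace3 s"
  unfolding tspace3_def by (auto intro: exI[of _ "[]"])

lemma tspace_add: "t \<in> tspace s \<Longrightarrow> t' \<in> tspace s \<Longrightarrow> t + t' \<in> tspace s"
proof (elim tspaceE)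
  fix ps qs assume "t = (\<Sum>(x, y)\<leftarrow>ps. tens s x y)" "t' = (\<Sum>(x, y)\<leftarrow>qs. tens s x y)"
  then show "t + t' \<in> tspace s" unfolding tspace_def by (intro CollectI exI[of _ "ps @ qs"]) simp
qed

lemma tspace3_add: "t \<in> tspace3 s \<Longrightarrow> t' \<in> tspace3 s \<Longrightarrow> t + t' \<in> tspace3 s"
proof (elim tspace3E)
  fix ps qs assume "t = (\<Sum>(x, y, z)\<leftarrow>ps. tens3 s x y z)" "t' = (\<Sum>(x, y, z)\<leftarrow>qs. tens3 s x y z)"
  then show "t + t' \<in> tspace3 s" unfolding tspace3_def by (intro CollectI exI[of _ "ps @ qs"]) simp
qed

lemma sum_list_closed:
  assumes "0 \<in> S" "\<And>t t'. t \<in> S \<Longrightarrow> t' \<in> S \<Longrightarrow> t + t' \<in> S" "\<And>x y. (x, y) \<in> set ps \<Longrightarrow> f x y \<in> S"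
  shows "(\<Sum>(x, y)\<leftarrow>ps. f x y) \<in> S"
  using assms(3) by (induction ps) (auto simp: assms(1,2))

lemma sum_list_closed3:
  assumes "0 \<in> S" "\<And>t t'. t \<in> S \<Longrightarrow> t' \<in> S \<Longrightarrow> t + t' \<in> S" "\<And>x y z. f x y z \<in> S"
  shows "(\<Sum>(x, y, z)\<leftarrow>ps. f x y z) \<in> S"
  by (induction ps) (auto simp: assms)

lemma tspace_scale:
  assumes "vector_space s" "t \<in> tspace s"
  shows "tscale c t \<in> tspace s"
proof -
  obtain ps where ps: "t = (\<Sum>(x, y)\<leftarrow>ps. tens s x y)" using assms(2) by (rule tspaceE)
  have "tscale c t = (\<Sum>(x, y)\<leftarrow>ps. tens s (s c x) y)"
    unfolding ps using bilinear_tens[OF assms(1)]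
    by (induction ps) (auto simp: bilinear_map_iff fun_eq_iff algebra_simps)
  also have "\<dots> \<in> tspace s" by (intro sum_list_closed tspace_0 tspace_add tens_in)
  finally show ?thesis .
qed

lemma tspace3_scale:
  assumes "vector_space s" "t \<in> tspace3 s"
  shows "tscale c t \<in> tspace3 s"
proof -
  obtain ps where ps: "t = (\<Sum>(x, y, z)\<leftarrow>ps. tens3 s x y z)" using assms(2) by (rule tspace3E)
  have "tscale c t = (\<Sum>(x, y, z)\<leftarrow>ps. tens3 s (s c x) y z)"
    unfolding ps using trilinear_tens3[OF assms(1)]
    by (induction ps) (auto simp: trilinear_map_iff fun_eq_iff algebra_simps)
  also have "\<dots> \<in> tspace3 s" by (intro sum_list_closed3 tspace3_0 tspace3_add tens3_in)
  finally show ?thesis .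
qed

lemma tspace_minus: "vector_space s \<Longrightarrow> t \<in> tspace s \<Longrightarrow> - t \<in> tspace s"
  using tspace_scale[of s t "-1"] by (simp add: tscale_def fun_Compl_def)

lemma tspace_diff: "vector_space s \<Longrightarrow> t \<in> tspace s \<Longrightarrow> t' \<in> tspace s \<Longrightarrow> t - t' \<in> tspace s"
  using tspace_add[OF _ tspace_minus, of t s t'] by simp

lemma tspace3_diff: "vector_space s \<Longrightarrow> t \<in> tspace3 s \<Longrightarrow> t' \<in> tspace3 s \<Longrightarrow> t - t' \<in> tspace3 s"
  using tspace3_add[OF _ tspace3_scale, of t s t' "-1"]
  by (simp add: tscale_def plus_fun_def fun_diff_def)

text \<open>Tensors are functionals on all maps, so their values at maps that are not bilinear matter for equality;
  these values vanish by convention.\<close>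

lemma tspace_not_bilinear: "t \<in> tspace s \<Longrightarrow> \<not> bilinear_map s s (*) B \<Longrightarrow> t B = 0"
proof (erule tspaceE)
  fix ps assume "\<not> bilinear_map s s (*) B" "t = (\<Sum>(x, y)\<leftarrow>ps. tens s x y)"
  then show "t B = 0" by (induction ps arbitrary: t) (auto simp: tens_def)
qed

lemma tspace3_not_trilinear:
  assumes "t \<in> tspace3 s" "\<not> trilinear_map s (*) B" shows "t B = 0"
proof -
  obtain ps where "t = (\<Sum>(x, y, z)\<leftarrow>ps. tens3 s x y z)" using assms(1) by (rule tspace3E)
  then show ?thesis using assms(2) by (induction ps arbitrary: t) (auto simp: tens3_def)
qed

text \<open>The working rule for induced maps: a functional of the image of a tensor is the value of that tensor at
  a form. It removes every \<open>tlift\<close> from the identities to be proved.\<close>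

lemma tlift_eval:
  assumes "bilinear_map s s s' f" "Vector_Spaces.linear s' (*) \<phi>" "t \<in> tspace s"
  shows "\<phi> (tlift s f t) = t (\<lambda>x y. \<phi> (f x y))"
proof -
  obtain ps where ps: "t = (\<Sum>(x, y)\<leftarrow>ps. tens s x y)"
    "\<And>B. bilinear_map s s (*) B \<Longrightarrow> t B = (\<Sum>(x, y)\<leftarrow>ps. B x y)"
    using assms(3) by (rule tspaceE) blast
  show ?thesis
    unfolding ps(2)[OF bilinear_map_comp[OF assms(1,2)]]
    unfolding ps(1) tlift_tens_sum[OF assms(1)] linear_sum_list[OF assms(2)]
    by (simp add: comp_def case_prod_unfold)
qed

lemma tlift_closed:
  assumes "bilinear_map s s s' f" "t \<in> tspace s"
    "0 \<in> S" "\<And>t t'. t \<in> S \<Longrightarrow> t' \<in> S \<Longrightarrow> t + t' \<in> S" "\<And>x y. f x y \<in> S"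
  shows "tlift s f t \<in> S"
proof -
  obtain ps where ps: "t = (\<Sum>(x, y)\<leftarrow>ps. tens s x y)" using assms(2) by (rule tspaceE)
  show ?thesis unfolding ps tlift_tens_sum[OF assms(1)] by (intro sum_list_closed assms(3-))
qed

lemma tlift_linear:
  assumes "bilinear_map s s s' f" "t \<in> tspace s"
  shows "t' \<in> tspace s \<Longrightarrow> tlift s f (t + t') = tlift s f t + tlift s f t'"
    and "tlift s f (tscale c t) = s' c (tlift s f t)"
proof -
  have vs: "vector_space s" "vector_space s'" using assms(1) by (auto simp: bilinear_map_iff)
  show "tlift s f (t + t') = tlift s f t + tlift s f t'" if "t' \<in> tspace s"
    using vs(2)
  proof (rule linear_functional_separates)
    fix \<phi> assume \<phi>: "Vector_Spaces.linear s' (*) \<phi>"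
    then show "\<phi> (tlift s f (t + t')) = \<phi> (tlift s f t + tlift s f t')"
      using that assms by (simp add: tlift_eval[OF assms(1) \<phi>] tspace_add linear_iff)
  qed
  show "tlift s f (tscale c t) = s' c (tlift s f t)"
    using vs(2)
  proof (rule linear_functional_separates)
    fix \<phi> assume \<phi>: "Vector_Spaces.linear s' (*) \<phi>"
    then show "\<phi> (tlift s f (tscale c t)) = \<phi> (s' c (tlift s f t))"
      using assms vs by (simp add: tlift_eval[OF assms(1) \<phi>] tspace_scale linear_iff)
  qed
qed

lemma tlift3_eval:
  assumes "trilinear_map s s' f" "Vector_Spaces.linear s' (*) \<phi>" "t \<in> tspace3 s"
  shows "\<phi> (tlift3 s f t) = t (\<lambda>x y z. \<phi> (f x y z))"
proof -
  obtain ps where ps: "t = (\<Sum>(x, y, z)\<leftarrow>ps. tens3 s x y z)"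
    "\<And>B. trilinear_map s (*) B \<Longrightarrow> t B = (\<Sum>(x, y, z)\<leftarrow>ps. B x y z)"
    using assms(3) by (rule tspace3E) blast
  show ?thesis
    unfolding ps(2)[OF trilinear_map_comp[OF assms(1,2)]]
    unfolding ps(1) tlift3_tens3_sum[OF assms(1)] linear_sum_list[OF assms(2)]
    by (simp add: comp_def case_prod_unfold)
qed

lemma tmap_bilinear:
  assumes "Vector_Spaces.linear s s' f" "Vector_Spaces.linear s s' g"
  shows "bilinear_map s s tscale (\<lambda>x y. tens s' (f x) (g y))"
proof -
  have "vector_space s'" using assms by (simp add: linear_iff)
  from bilinear_tens[OF this] show ?thesis using assms by (simp add: bilinear_map_iff linear_iff)
qed

lemma tmap_eval:
  assumes "Vector_Spaces.linear s s' f" "Vector_Spaces.linear s s' g" "t \<in> tspace s"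
    "bilinear_map s' s' (*) B"
  shows "tmap s s' f g t B = t (\<lambda>x y. B (f x) (g y))"
  unfolding tmap_def tlift_eval[OF tmap_bilinear[OF assms(1,2)] linear_eval assms(3)]
  using assms(4) by (simp add: tens_def)

lemma tmap_in:
  assumes "Vector_Spaces.linear s s' f" "Vector_Spaces.linear s s' g" "t \<in> tspace s"
  shows "tmap s s' f g t \<in> tspace s'"
  unfolding tmap_def
  by (rule tlift_closed[OF tmap_bilinear[OF assms(1,2)] assms(3)]) (simp_all add: tspace_0 tspace_add tens_in)

lemma tflip_bilinear: "vector_space s \<Longrightarrow> bilinear_map s s tscale (\<lambda>x y. tens s y x)"
  using bilinear_tens[of s] by (simp add: bilinear_map_iff)

lemma bilinear_map_flip: "bilinear_map s s s' B \<Longrightarrow> bilinear_map s s s' (\<lambda>x y. B y x)"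
  by (simp add: bilinear_map_iff)

lemma tflip_eval:
  assumes "t \<in> tspace s" "bilinear_map s s (*) B"
  shows "tflip s t B = t (\<lambda>x y. B y x)"
proof -
  have "vector_space s" using assms(2) by (simp add: bilinear_map_iff)
  then show ?thesis
    unfolding tflip_def using assms
    by (subst tlift_eval[OF tflip_bilinear linear_eval]) (simp_all add: tens_def)
qed

lemma tflip_in: "vector_space s \<Longrightarrow> t \<in> tspace s \<Longrightarrow> tflip s t \<in> tspace s"
  unfolding tflip_def by (rule tlift_closed[OF tflip_bilinear]) (simp_all add: tspace_0 tspace_add tens_in)

lemma tflip_id_trilinear: "vector_space s \<Longrightarrow> trilinear_map s tscale (\<lambda>x y z. tens3 s y x z)"
  using trilinear_tens3[of s] by (simp add: trilinear_map_iff)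

lemma tflip_id_eval:
  assumes "t \<in> tspace3 s" "trilinear_map s (*) B"
  shows "tflip_id s t B = t (\<lambda>x y z. B y x z)"
proof -
  have "vector_space s" using assms(2) by (simp add: trilinear_map_iff)
  then show ?thesis
    unfolding tflip_id_def using assms
    by (subst tlift3_eval[OF tflip_id_trilinear linear_eval]) (simp_all add: tens3_def)
qed

lemma tflip_id_in:
  assumes "vector_space s" "t \<in> tspace3 s"
  shows "tflip_id s t \<in> tspace3 s"
proof -
  obtain ps where ps: "t = (\<Sum>(x, y, z)\<leftarrow>ps. tens3 s x y z)" using assms(2) by (rule tspace3E)
  show ?thesis unfolding tflip_id_def ps tlift3_tens3_sum[OF tflip_id_trilinear[OF assms(1)]]
    by (intro sum_list_closed3 tspace3_0 tspace3_add tens3_in)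
qed

lemma coproductD:
  assumes "coproduct s \<Delta>"
  shows "vector_space s" "\<Delta> (x + y) = \<Delta> x + \<Delta> y" "\<Delta> (s c x) = tscale c (\<Delta> x)" "\<Delta> x \<in> tspace s"
  using assms by (auto simp: coproduct_def linear_iff)

text \<open>The shape of both Yang-Baxter tensors: a map on \<open>V \<otimes> V \<otimes> V \<otimes> V\<close>, applied to \<open>r \<otimes> r'\<close>.\<close>

lemma tlift_tlift:
  fixes s :: "'k::field \<Rightarrow> 'v::ab_group_add \<Rightarrow> 'v"
  assumes f: "\<And>x y. bilinear_map s s tscale (f x y)"
    and f': "\<And>u v. bilinear_map s s tscale (\<lambda>x y. f x y u v)"
    and r: "r \<in> tspace s" "r' \<in> tspace s" 
  shows "bilinear_map s s tscale (\<lambda>x y. tlift s (f x y) r')"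
    and "tlift s (\<lambda>x y. tlift s (f x y) r') r B = r (\<lambda>x y. r' (\<lambda>u v. f x y u v B))"
proof -
  have 1: "tlift s (f x y) r' B = r' (\<lambda>u v. f x y u v B)" for x y B
    by (rule tlift_eval[OF f linear_eval r(2)])
  obtain ps where ps: "\<And>B. bilinear_map s s (*) B \<Longrightarrow> r' B = (\<Sum>(x, y)\<leftarrow>ps. B x y)"
    using r(2) by (rule tspaceE) blast
  have 2: "r' (\<lambda>u v. f x y u v B) = (\<Sum>(u, v)\<leftarrow>ps. f x y u v B)" for x y B
    by (rule ps[OF bilinear_map_comp[OF f linear_eval]])
  show 3: "bilinear_map s s tscale (\<lambda>x y. tlift s (f x y) r')"
  proof -
    have *: "f (x + x') y u v B = f x y u v B + f x' y u v B" "f x (y + y') u v B = f x y u v B + f x y' u v B"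
       "f (s c x) y u v B = c * f x y u v B" "f x (s c y) u v B = c * f x y u v B" for x x' y y' u v c B
      using f'[of u v] by (simp_all add: bilinear_map_iff)
    show ?thesis using f[of 0 0] unfolding bilinear_map_iff fun_eq_iff plus_fun_apply tscale_apply 1 2
      by (simp add: * case_prod_unfold sum_list_addf sum_list_const_mult)
  qed
  show "tlift s (\<lambda>x y. tlift s (f x y) r') r B = r (\<lambda>x y. r' (\<lambda>u v. f x y u v B))"
    unfolding tlift_eval[OF 3 linear_eval r(1)] 1 ..
qed

text \<open>A tensor is linear in its argument only on bilinear forms, so these rules carry side conditions.\<close>

lemma tspace_eval:
  assumes "t \<in> tspace s" "bilinear_map s s (*) f"
  shows "bilinear_map s s (*) g \<Longrightarrow> t (\<lambda>x y. f x y + g x y) = t f + t g"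
    and "bilinear_map s s (*) g \<Longrightarrow> t (\<lambda>x y. f x y - g x y) = t f - t g"
    and "t (\<lambda>x y. - f x y) = - t f"
    and "t (\<lambda>x y. c * f x y) = c * t f"
proof -
  obtain ps where ps: "\<And>B. bilinear_map s s (*) B \<Longrightarrow> t B = (\<Sum>(x, y)\<leftarrow>ps. B x y)"
    using assms(1) by (rule tspaceE) blast
  show "t (\<lambda>x y. f x y + g x y) = t f + t g" if "bilinear_map s s (*) g"
  proof -
    have "bilinear_map s s (*) (\<lambda>x y. f x y + g x y)"
      using that assms(2) by (simp add: bilinear_map_iff algebra_simps)
    from ps[OF this] ps[OF that] ps[OF assms(2)] show ?thesis
      by (simp add: case_prod_unfold sum_list_addf)
  qed
  show "t (\<lambda>x y. f x y - g x y) = t f - t g" if "bilinear_map s s (*) g"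
  proof -
    have "bilinear_map s s (*) (\<lambda>x y. f x y - g x y)"
      using that assms(2) by (simp add: bilinear_map_iff algebra_simps)
    from ps[OF this] ps[OF that] ps[OF assms(2)] show ?thesis
      by (simp add: case_prod_unfold sum_list_subtractf)
  qed
  show sc: "t (\<lambda>x y. c * f x y) = c * t f" for c
  proof -
    have "bilinear_map s s (*) (\<lambda>x y. c * f x y)"
      using assms(2) by (simp add: bilinear_map_iff algebra_simps)
    from ps[OF this] ps[OF assms(2)] show ?thesis
      by (simp add: case_prod_unfold sum_list_const_mult)
  qed
  from sc[of "-1"] show "t (\<lambda>x y. - f x y) = - t f" by simp
qed

lemma id_tens_bilinear:
  assumes "coproduct s \<Delta>"
  shows "bilinear_map s s tscale (\<lambda>x y. tlift s (\<lambda>u v. tens3 s x u v) (\<Delta> y))"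
    and "bilinear_map s s tscale (\<lambda>x y. tlift s (\<lambda>u v. tens3 s u v y) (\<Delta> x))"
proof -
  note D = coproductD[OF assms]
  have tri: "trilinear_map s tscale (tens3 s)" by (rule trilinear_tens3[OF D(1)])
  have b1: "bilinear_map s s tscale (\<lambda>u v. tens3 s x u v)" for x
    using tri by (simp add: bilinear_map_iff trilinear_map_iff)
  have b2: "bilinear_map s s tscale (\<lambda>u v. tens3 s u v x)" for x
    using tri by (simp add: bilinear_map_iff trilinear_map_iff)
  have e: "tens3 s (x + x') u v B = tens3 s x u v B + tens3 s x' u v B"
      "tens3 s u v (x + x') B = tens3 s u v x B + tens3 s u v x' B"
      "tens3 s (s c x) u v B = c * tens3 s x u v B"
      "tens3 s u v (s c x) B = c * tens3 s u v x B" for x x' u v c B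
    using tri by (simp_all add: trilinear_map_iff)
  note be1 = bilinear_map_comp[OF b1 linear_eval] and be2 = bilinear_map_comp[OF b2 linear_eval]
  show "bilinear_map s s tscale (\<lambda>x y. tlift s (\<lambda>u v. tens3 s x u v) (\<Delta> y))"
    unfolding bilinear_map_iff using D tlift_linear[OF b1]
    by (simp add: vector_space_tscale)
      (simp add: fun_eq_iff tlift_eval[OF b1 linear_eval D(4)] e
        tspace_eval(1)[OF D(4) be1 be1] tspace_eval(4)[OF D(4) be1])
  show "bilinear_map s s tscale (\<lambda>x y. tlift s (\<lambda>u v. tens3 s u v y) (\<Delta> x))"
    unfolding bilinear_map_iff using D tlift_linear[OF b2]
    by (simp add: vector_space_tscale)
      (simp add: fun_eq_iff tlift_eval[OF b2 linear_eval D(4)] e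
        tspace_eval(1)[OF D(4) be2 be2] tspace_eval(4)[OF D(4) be2])
qed

lemma id_tens_eval:
  assumes "coproduct s \<Delta>" "t \<in> tspace s" "trilinear_map s (*) B"
  shows "id_tens s \<Delta> t B = t (\<lambda>x y. \<Delta> y (\<lambda>u v. B x u v))"
    and "tens_id s \<Delta> t B = t (\<lambda>x y. \<Delta> x (\<lambda>u v. B u v y))"
proof -
  note D = coproductD[OF assms(1)]
  have tri: "trilinear_map s tscale (tens3 s)" by (rule trilinear_tens3[OF D(1)])
  have b1: "bilinear_map s s tscale (\<lambda>u v. tens3 s x u v)"
    and b2: "bilinear_map s s tscale (\<lambda>u v. tens3 s u v x)" for x
    using tri by (simp_all add: bilinear_map_iff trilinear_map_iff)
  show "id_tens s \<Delta> t B = t (\<lambda>x y. \<Delta> y (\<lambda>u v. B x u v))"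
    using assms(3) unfolding id_tens_def tlift_eval[OF id_tens_bilinear(1)[OF assms(1)] linear_eval assms(2)]
    unfolding tlift_eval[OF b1 linear_eval D(4)] by (simp add: tens3_def)
  show "tens_id s \<Delta> t B = t (\<lambda>x y. \<Delta> x (\<lambda>u v. B u v y))"
    using assms(3) unfolding tens_id_def tlift_eval[OF id_tens_bilinear(2)[OF assms(1)] linear_eval assms(2)]
    unfolding tlift_eval[OF b2 linear_eval D(4)] by (simp add: tens3_def)
qed

lemma id_tens_in:
  assumes "coproduct s \<Delta>" "t \<in> tspace s"
  shows "id_tens s \<Delta> t \<in> tspace3 s" and "tens_id s \<Delta> t \<in> tspace3 s"
proof -
  note D = coproductD[OF assms(1)]
  have tri: "trilinear_map s tscale (tens3 s)" by (rule trilinear_tens3[OF D(1)])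
  have b1: "bilinear_map s s tscale (\<lambda>u v. tens3 s x u v)"
    and b2: "bilinear_map s s tscale (\<lambda>u v. tens3 s u v x)" for x
    using tri by (simp_all add: bilinear_map_iff trilinear_map_iff)
  have "tlift s (\<lambda>u v. tens3 s x u v) (\<Delta> y) \<in> tspace3 s"
    and "tlift s (\<lambda>u v. tens3 s u v x) (\<Delta> y) \<in> tspace3 s" for x y
    by (rule tlift_closed[OF b1 D(4) tspace3_0 tspace3_add tens3_in]
        tlift_closed[OF b2 D(4) tspace3_0 tspace3_add tens3_in]; assumption)+
  then show "id_tens s \<Delta> t \<in> tspace3 s" and "tens_id s \<Delta> t \<in> tspace3 s"
    unfolding id_tens_def tens_id_def
    by (auto intro!: tlift_closed[OF id_tens_bilinear(1)[OF assms(1)] assms(2) tspace3_0 tspace3_add]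
        tlift_closed[OF id_tens_bilinear(2)[OF assms(1)] assms(2) tspace3_0 tspace3_add])
qed

section \<open>Products of functionals separate tensors\<close>

definition separating :: "('k::field \<Rightarrow> 'v::ab_group_add \<Rightarrow> 'v) \<Rightarrow> ('v \<Rightarrow> 'k) set \<Rightarrow> bool" where
  "separating s \<Phi> \<longleftrightarrow> vector_space s \<and> (\<forall>\<phi>\<in>\<Phi>. Vector_Spaces.linear s (*) \<phi>) \<and>
     (\<forall>u. (\<forall>\<phi>\<in>\<Phi>. \<phi> u = 0) \<longrightarrow> u = 0)"

text \<open>If every \<open>\<phi> \<in> \<Phi>\<close> kills \<open>\<Sum> \<phi>(u) w\<close>, then \<open>\<Sum> u \<otimes> w = 0\<close>. By induction on the number of terms: if the
  first vector \<open>u\<close> is not zero, some \<open>\<phi>\<^sub>0 \<in> \<Phi>\<close> has \<open>\<phi>\<^sub>0(u) \<noteq> 0\<close>; the hypothesis for \<open>\<phi>\<^sub>0\<close> expresses the first \<open>w\<close>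
  by the others, and substituting it leaves a sum with one term less. The map \<open>B\<close> needs to be linear in its
  first argument only at the given \<open>w\<close>, since evaluation \<open>t \<mapsto> t (B x)\<close> is linear in \<open>x\<close> only for tensors \<open>t\<close>.\<close>

lemma separating_sum_zero:
  assumes sep: "separating s \<Phi>" and B: "\<And>x. Vector_Spaces.linear s' s'' (B x)"
    and "\<And>u w. (u, w) \<in> set ps \<Longrightarrow> Vector_Spaces.linear s s'' (\<lambda>x. B x w)"
    and "\<And>\<phi>. \<phi> \<in> \<Phi> \<Longrightarrow> (\<Sum>(u, w)\<leftarrow>ps. s' (\<phi> u) w) = 0"
  shows "(\<Sum>(u, w)\<leftarrow>ps. B u w) = 0"
  using assms(3,4)
proof (induction "length ps" arbitrary: ps)
  case 0
  then show ?case by simp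
next
  case (Suc n)
  then obtain u w qs where ps: "ps = (u, w) # qs" and n: "n = length qs"
    by (cases ps) auto
  have vs: "vector_space s" "vector_space s'" "vector_space s''"
    using B sep by (auto simp: linear_iff separating_def)
  have Bw: "Vector_Spaces.linear s s'' (\<lambda>x. B x w)" by (rule Suc.prems(1)[of u]) (simp add: ps)
  have Bqs: "Vector_Spaces.linear s s'' (\<lambda>x. B x w)" if "(u, w) \<in> set qs" for u w
    by (rule Suc.prems(1)[of u]) (simp add: ps that)
  show ?case
  proof (cases "u = 0")
    case True
    have B0: "B 0 w = 0" using linear_0[OF Bw] .
    have "(\<Sum>(u, w)\<leftarrow>qs. s' (\<phi> u) w) = 0" if "\<phi> \<in> \<Phi>" for \<phi>
      using Suc.prems(2)[OF that] linear_0[of s "(*)" \<phi>] sep that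
      by (simp add: ps True separating_def vector_space_simps[OF vs(2)])
    from Suc.hyps(1)[OF n Bqs this] show ?thesis by (simp add: ps True B0)
  next
    case False
    with sep obtain \<phi>0 where \<phi>0: "\<phi>0 \<in> \<Phi>" "\<phi>0 u \<noteq> 0" by (auto simp: separating_def)
    \<comment> \<open>the projection along \<open>u\<close> onto the kernel of \<open>\<phi>\<^sub>0\<close>\<close>
    define f where "f x = x - s (\<phi>0 x / \<phi>0 u) u" for x
    have w: "(\<Sum>(u, w)\<leftarrow>qs. s' (\<phi>0 u) w) = - s' (\<phi>0 u) w"
      using Suc.prems(2)[OF \<phi>0(1)] by (simp add: ps eq_neg_iff_add_eq_0 add.commute)
    have "(\<Sum>(u, w)\<leftarrow>map (\<lambda>(u, w). (f u, w)) qs. s' (\<phi> u) w) = 0" if "\<phi> \<in> \<Phi>" for \<phi>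
    proof -
      have l: "Vector_Spaces.linear s (*) \<phi>" using sep that by (simp add: separating_def)
      have "(\<Sum>(u, w)\<leftarrow>map (\<lambda>(u, w). (f u, w)) qs. s' (\<phi> u) w) =
          (\<Sum>(u', w)\<leftarrow>qs. s' (\<phi> u') w - s' (\<phi> u / \<phi>0 u) (s' (\<phi>0 u') w))"
        using l unfolding f_def linear_diff[OF l]
        by (simp add: comp_def case_prod_unfold vector_space_simps[OF vs(2)] linear_iff mult.commute
            linear_diff[OF l])
      also have "\<dots> = (\<Sum>(u', w)\<leftarrow>qs. s' (\<phi> u') w) - s' (\<phi> u / \<phi>0 u) (\<Sum>(u', w)\<leftarrow>qs. s' (\<phi>0 u') w)"
        using vs(2) by (induction qs) (auto simp: vector_space_simps[OF vs(2)])
      also have "\<dots> = (\<Sum>(u', w)\<leftarrow>qs. s' (\<phi> u') w) + s' (\<phi> u) w"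
        unfolding w using \<phi>0(2) by (simp add: vector_space_simps[OF vs(2)])
      also have "\<dots> = 0" using Suc.prems(2)[OF that] by (simp add: ps add.commute)
      finally show ?thesis .
    qed
    from Suc.hyps(1)[OF _ _ this] n Bqs have "(\<Sum>(u', w)\<leftarrow>qs. B (f u') w) = 0"
      by (force simp: comp_def case_prod_unfold)
    also have "(\<Sum>(u', w)\<leftarrow>qs. B (f u') w) =
        (\<Sum>(u', w)\<leftarrow>qs. B u' w) - s'' (1 / \<phi>0 u) (B u (\<Sum>(u', w)\<leftarrow>qs. s' (\<phi>0 u') w))"
      using Bqs
    proof (induction qs)
      case Nil
      then show ?case using linear_0[OF B, of u] by (simp add: vector_space_simps[OF vs(3)])
    next
      case (Cons p qs)
      obtain u' w' where p: "p = (u', w')" by (cases p)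
      have l: "Vector_Spaces.linear s s'' (\<lambda>x. B x w')" by (rule Cons.prems[of u']) (simp add: p)
      have "B (f u') w' = B u' w' - s'' (\<phi>0 u' / \<phi>0 u) (B u w')"
        using l unfolding f_def linear_diff[OF l] by (simp add: linear_iff)
      moreover have "B u (s' (\<phi>0 u') w' + z) = s'' (\<phi>0 u') (B u w') + B u z" for z
        using B[of u] by (simp add: linear_iff)
      moreover have "(\<Sum>(u', w)\<leftarrow>qs. B (f u') w) =
        (\<Sum>(u', w)\<leftarrow>qs. B u' w) - s'' (1 / \<phi>0 u) (B u (\<Sum>(u', w)\<leftarrow>qs. s' (\<phi>0 u') w))"
        using Cons.prems by (intro Cons.IH) (meson list.set_intros(2))
      ultimately show ?case by (simp add: p vector_space_simps[OF vs(3)])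
    qed
    also have "B u (\<Sum>(u', w)\<leftarrow>qs. s' (\<phi>0 u') w) = - s'' (\<phi>0 u) (B u w)"
      unfolding w linear_minus[OF B] using B[of u] by (simp add: linear_iff)
    finally show ?thesis using \<phi>0(2) by (simp add: ps vector_space_simps[OF vs(3)] add.commute)
  qed
qed

text \<open>Separation in one factor at a time: for fixed \<open>\<phi>\<close> the vector \<open>(\<phi> \<otimes> id) t\<close> is killed by all \<open>\<psi>\<close>, hence is
  zero, and \<open>separating_sum_zero\<close> applies to the first factor.\<close>

lemma tspace_zeroI:
  assumes sep: "separating s \<Phi>" and t: "t \<in> tspace s"
    and z: "\<And>\<phi> \<psi>. \<phi> \<in> \<Phi> \<Longrightarrow> \<psi> \<in> \<Phi> \<Longrightarrow> t (\<lambda>x y. \<phi> x * \<psi> y) = 0"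
  shows "t = 0"
proof
  fix B
  obtain ps where ps: "\<And>B. bilinear_map s s (*) B \<Longrightarrow> t B = (\<Sum>(x, y)\<leftarrow>ps. B x y)"
    using t by (rule tspaceE) blast
  have vs: "vector_space s" using sep by (simp add: separating_def)
  show "t B = 0 B"
  proof (cases "bilinear_map s s (*) B")
    case True
    have "(\<Sum>(x, y)\<leftarrow>ps. s (\<phi> x) y) = 0" if \<phi>: "\<phi> \<in> \<Phi>" for \<phi>
    proof -
      have "\<psi> (\<Sum>(x, y)\<leftarrow>ps. s (\<phi> x) y) = 0" if \<psi>: "\<psi> \<in> \<Phi>" for \<psi>
      proof -
        have l: "Vector_Spaces.linear s (*) \<phi>" "Vector_Spaces.linear s (*) \<psi>"
          using sep \<phi> \<psi> by (auto simp: separating_def)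
        have "bilinear_map s s (*) (\<lambda>x y. \<phi> x * \<psi> y)"
          by (rule bilinear_prod[OF l])
        from ps[OF this] z[OF \<phi> \<psi>] have "(\<Sum>(x, y)\<leftarrow>ps. \<phi> x * \<psi> y) = 0" by simp
        then show ?thesis
          unfolding linear_sum_list[OF l(2)] using l(2) by (simp add: comp_def case_prod_unfold linear_iff)
      qed
      then show ?thesis using sep by (simp add: separating_def)
    qed
    from separating_sum_zero[where B = B and s' = s and s'' = "(*)", OF sep _ _ this] True have "(\<Sum>(x, y)\<leftarrow>ps. B x y) = 0"
      by (simp add: bilinear_map_def)
    then show ?thesis using ps[OF True] by simp
  qed (simp add: tspace_not_bilinear[OF t])
qed

lemma tspace_eqI:
  assumes "separating s \<Phi>" "t \<in> tspace s" "t' \<in> tspace s"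
    and "\<And>\<phi> \<psi>. \<phi> \<in> \<Phi> \<Longrightarrow> \<psi> \<in> \<Phi> \<Longrightarrow> t (\<lambda>x y. \<phi> x * \<psi> y) = t' (\<lambda>x y. \<phi> x * \<psi> y)"
  shows "t = t'"
  using tspace_zeroI[OF assms(1) tspace_diff[OF _ assms(2,3)]] assms(1,4) by (simp add: separating_def)

text \<open>As for two factors, with \<open>(\<phi> \<otimes> id \<otimes> id) t\<close> zero by \<open>tspace_zeroI\<close>.\<close>

lemma tspace3_zeroI:
  assumes sep: "separating s \<Phi>" and t: "t \<in> tspace3 s"
    and z: "\<And>\<phi> \<psi> \<chi>. \<phi> \<in> \<Phi> \<Longrightarrow> \<psi> \<in> \<Phi> \<Longrightarrow> \<chi> \<in> \<Phi> \<Longrightarrow> t (\<lambda>x y z. \<phi> x * \<psi> y * \<chi> z) = 0"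
  shows "t = 0"
proof
  fix B
  obtain ps where ps: "\<And>B. trilinear_map s (*) B \<Longrightarrow> t B = (\<Sum>(x, y, z)\<leftarrow>ps. B x y z)"
    using t by (rule tspace3E) blast
  have vs: "vector_space s" using sep by (simp add: separating_def)
  show "t B = 0 B"
  proof (cases "trilinear_map s (*) B")
    case True
    have bil: "bilinear_map s s (*) (B x)" for x using True by (simp add: bilinear_map_iff trilinear_map_iff)
    have "(\<Sum>(x, y, z)\<leftarrow>ps. tscale (\<phi> x) (tens s y z)) = 0" (is "?T = 0") if \<phi>: "\<phi> \<in> \<Phi>" for \<phi>
    proof (rule tspace_zeroI[OF sep])
      show "?T \<in> tspace s" by (intro sum_list_closed3 tspace_0 tspace_add tspace_scale tens_in vs)
      fix \<psi> \<chi> assume \<psi>: "\<psi> \<in> \<Phi>" "\<chi> \<in> \<Phi>"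
      have l: "Vector_Spaces.linear s (*) \<phi>" "Vector_Spaces.linear s (*) \<psi>" "Vector_Spaces.linear s (*) \<chi>"
        using sep \<phi> \<psi> by (auto simp: separating_def)
      have b: "bilinear_map s s (*) (\<lambda>x y. \<psi> x * \<chi> y)"
        by (rule bilinear_prod[OF l(2,3)])
      have "trilinear_map s (*) (\<lambda>x y z. \<phi> x * \<psi> y * \<chi> z)"
        by (rule trilinear_prod[OF l])
      from ps[OF this] z[OF \<phi> \<psi>] have "(\<Sum>(x, y, z)\<leftarrow>ps. \<phi> x * \<psi> y * \<chi> z) = 0" by simp
      moreover have "(\<Sum>(x, y, z)\<leftarrow>qs. tscale (\<phi> x) (tens s y z)) (\<lambda>x y. \<psi> x * \<chi> y) =
          (\<Sum>(x, y, z)\<leftarrow>qs. \<phi> x * \<psi> y * \<chi> z)" for qs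
        using b by (induction qs) (auto simp: tens_def mult.assoc)
      ultimately show "?T (\<lambda>x y. \<psi> x * \<chi> y) = 0" by simp
    qed
    then have z': "(\<Sum>(x, t)\<leftarrow>map (\<lambda>(x, y, z). (x, tens s y z)) ps. tscale (\<phi> x) t) = 0" if "\<phi> \<in> \<Phi>" for \<phi>
      using that by (simp add: comp_def case_prod_unfold)
    have "Vector_Spaces.linear s (*) (\<lambda>x. tens s y z (B x))" for y z
      using True bil by (simp add: tens_def trilinear_map_def)
    with separating_sum_zero[where B = "\<lambda>x t. t (B x)", OF sep linear_eval _ z'] have "(\<Sum>(x, y, z)\<leftarrow>ps. tens s y z (B x)) = 0"
      by (auto simp: comp_def case_prod_unfold)
    then show ?thesis using ps[OF True] bil by (simp add: tens_def)
  qed (simp add: tspace3_not_trilinear[OF t])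
qed

lemma tspace3_eqI:
  assumes "separating s \<Phi>" "t \<in> tspace3 s" "t' \<in> tspace3 s"
    and "\<And>\<phi> \<psi> \<chi>. \<phi> \<in> \<Phi> \<Longrightarrow> \<psi> \<in> \<Phi> \<Longrightarrow> \<chi> \<in> \<Phi> \<Longrightarrow>
      t (\<lambda>x y z. \<phi> x * \<psi> y * \<chi> z) = t' (\<lambda>x y z. \<phi> x * \<psi> y * \<chi> z)"
  shows "t = t'"
  using tspace3_zeroI[OF assms(1) tspace3_diff[OF _ assms(2,3)]] assms(1,4) by (simp add: separating_def)

section \<open>Evaluating polynomials with vector coefficients\<close>

definition poly_ev :: "('k \<Rightarrow> 'v \<Rightarrow> 'v) \<Rightarrow> 'k::field \<Rightarrow> 'v::ab_group_add poly \<Rightarrow> 'v" where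
  "poly_ev s c = poly_subst (s c) id"

lemma poly_subst_sum:
  assumes "X 0 = 0" "F 0 = 0" "degree p \<le> N"
  shows "poly_subst X F p = (\<Sum>n\<le>N. (X ^^ n) (F (coeff p n)))"
proof -
  have "(X ^^ n) 0 = 0" for n by (induction n) (auto simp: assms(1))
  then show ?thesis unfolding poly_subst_def using assms
    by (intro sum.mono_neutral_left) (auto simp: coeff_eq_0)
qed

lemma scale_funpow: "vector_space s \<Longrightarrow> (s c ^^ n) x = s (c ^ n) x"
  by (induction n) (auto simp: vector_space_simps)

lemma poly_ev_sum:
  assumes "vector_space s" "degree p \<le> N"
  shows "poly_ev s c p = (\<Sum>n\<le>N. s (c ^ n) (coeff p n))"
  unfolding poly_ev_def
  by (subst poly_subst_sum[OF _ _ assms(2)]) (simp_all add: vector_space_simps[OF assms(1)] scale_funpow[OF assms(1)])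

lemma coeff_poly_scale: "vector_space s \<Longrightarrow> coeff (poly_scale s c p) n = s c (coeff p n)"
  by (simp add: poly_scale_def coeff_map_poly vector_space_simps)

lemma vector_space_poly_scale: "vector_space s \<Longrightarrow> vector_space (poly_scale s)"
  by unfold_locales (simp_all add: poly_eq_iff coeff_poly_scale vector_space_simps)

lemma linear_var_mult: "vector_space s \<Longrightarrow> Vector_Spaces.linear (poly_scale s) (poly_scale s) var_mult"
  by (auto simp: linear_iff vector_space_poly_scale poly_eq_iff coeff_poly_scale coeff_pCons
      vector_space_simps split: nat.split)

lemma linear_const_poly: "vector_space s \<Longrightarrow> Vector_Spaces.linear s (poly_scale s) (\<lambda>x. [:x:])"
  by (auto simp: linear_iff vector_space_poly_scale poly_eq_iff coeff_poly_scale coeff_pCons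
      vector_space_simps split: nat.split)

lemma linear_poly_ev:
  fixes s :: "'k::field \<Rightarrow> 'v::ab_group_add \<Rightarrow> 'v"
  assumes "vector_space s"
  shows "Vector_Spaces.linear (poly_scale s) s (poly_ev s c)"
  unfolding linear_iff
proof (intro conjI allI vector_space_poly_scale assms)
  fix p q :: "'v poly" and k :: 'k
  let ?N = "max (degree p) (degree q)"
  have d: "degree (p + q) \<le> ?N" "degree (poly_scale s k p) \<le> degree p"
    by (auto simp: degree_add_le_max poly_scale_def map_poly_degree_leq)
  show "poly_ev s c (p + q) = poly_ev s c p + poly_ev s c q"
    using d by (simp add: poly_ev_sum[OF assms, of _ ?N] vector_space_simps[OF assms] sum.distrib)
  interpret vector_space s by fact
  show "poly_ev s c (poly_scale s k p) = s k (poly_ev s c p)"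
    using d by (simp add: poly_ev_sum[OF assms, of _ "degree p"] coeff_poly_scale[OF assms]
      scale_sum_right mult.commute)
qed

lemma poly_ev_pCons:
  assumes "vector_space s"
  shows "poly_ev s c (pCons a p) = a + s c (poly_ev s c p)"
proof -
  interpret vector_space s by fact
  have "poly_ev s c (pCons a p) = (\<Sum>n\<le>Suc (degree p). s (c ^ n) (coeff (pCons a p) n))"
    by (rule poly_ev_sum[OF assms]) (simp add: degree_pCons_le)
  also have "\<dots> = a + s c (poly_ev s c p)"
    unfolding sum.atMost_Suc_shift by (simp add: poly_ev_sum[OF assms, of p "degree p"] scale_sum_right)
  finally show ?thesis .
qed

lemma poly_ev_simps:
  assumes "vector_space s"
  shows "poly_ev s c 0 = 0" "poly_ev s c (p + q) = poly_ev s c p + poly_ev s c q"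
    "poly_ev s c (- p) = - poly_ev s c p" "poly_ev s c (p - q) = poly_ev s c p - poly_ev s c q"
    "poly_ev s c (poly_scale s k p) = s k (poly_ev s c p)"
    "poly_ev s c [:x:] = x" "poly_ev s c (var_mult p) = s c (poly_ev s c p)"
  using linear_poly_ev[OF assms, of c] linear_0[OF linear_poly_ev[OF assms, of c]]
  by (simp_all add: linear_minus[OF linear_poly_ev] linear_diff[OF linear_poly_ev] assms
    poly_ev_pCons vector_space_simps linear_iff)

lemma poly_ev_map_poly:
  assumes f: "Vector_Spaces.linear s s' f"
  shows "poly_ev s' c (map_poly f p) = f (poly_ev s c p)"
proof -
  have vs: "vector_space s" "vector_space s'" using f by (auto simp: linear_iff)
  have "poly_ev s' c (map_poly f p) = (\<Sum>n\<le>degree p. s' (c ^ n) (coeff (map_poly f p) n))"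
    by (rule poly_ev_sum[OF vs(2)]) (simp add: map_poly_degree_leq)
  then show ?thesis
    unfolding poly_ev_sum[OF vs(1) order.refl] linear_sum[OF f]
    using f linear_0[OF f] by (simp add: coeff_map_poly linear_iff)
qed

lemma poly_ev_mult: "poly_ev (*) c p = poly p c"
  by (simp add: poly_ev_sum[OF vector_space_mult order.refl] poly_altdef mult.commute)

text \<open>Apply functionals to reduce to polynomials over the infinite field \<open>k\<close>.\<close>

lemma poly_ev_eqI:
  fixes s :: "'k::field_char_0 \<Rightarrow> 'v::ab_group_add \<Rightarrow> 'v"
  assumes vs: "vector_space s" and eq: "\<And>c. poly_ev s c p = poly_ev s c q"
  shows "p = q"
proof (rule poly_eqI)
  fix n
  show "coeff p n = coeff q n"
    using vs
  proof (rule linear_functional_separates)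
    fix \<phi> assume \<phi>: "Vector_Spaces.linear s (*) \<phi>"
    have "poly (map_poly \<phi> p) c = poly (map_poly \<phi> q) c" for c
      using poly_ev_map_poly[OF \<phi>, of c] eq[of c] by (simp add: poly_ev_mult)
    then have "map_poly \<phi> p = map_poly \<phi> q"
      by (simp add: poly_eq_poly_eq_iff[symmetric] fun_eq_iff)
    then show "\<phi> (coeff p n) = \<phi> (coeff q n)"
      using linear_0[OF \<phi>] by (metis coeff_map_poly)
  qed
qed

lemma poly_subst_closed:
  assumes "0 \<in> S" "\<And>u v. u \<in> S \<Longrightarrow> v \<in> S \<Longrightarrow> u + v \<in> S"
    and X: "\<And>v. v \<in> S \<Longrightarrow> X v \<in> S" and F: "\<And>n. F (coeff p n) \<in> S"
  shows "poly_subst X F p \<in> S"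
proof -
  have "(X ^^ n) v \<in> S" if "v \<in> S" for n v using that by (induction n) (auto intro: X)
  note pow = this[OF F]
  have "(\<Sum>n\<in>A. (X ^^ n) (F (coeff p n))) \<in> S" if "finite A" for A
    using that by induction (simp_all add: assms pow)
  then show ?thesis by (simp add: poly_subst_def)
qed

text \<open>A substitution followed by a map \<open>E\<close> that turns the substituted operator \<open>X\<close> into a scalar \<open>c\<close> is evaluation
  at \<open>c\<close>. In this way all substitutions in the conformal axioms become evaluations. The set \<open>S\<close> allows for
  operators such as \<open>\<partial> \<otimes> id + id \<otimes> \<partial>\<close>, which are well behaved only on actual tensors.\<close>

lemma poly_subst_ev:
  assumes S: "0 \<in> S" "\<And>u v. u \<in> S \<Longrightarrow> v \<in> S \<Longrightarrow> u + v \<in> S" "\<And>v. v \<in> S \<Longrightarrow> X v \<in> S"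
    and F: "\<And>n. F (coeff p n) \<in> S"
    and E: "E 0 = 0" "\<And>u v. u \<in> S \<Longrightarrow> v \<in> S \<Longrightarrow> E (u + v) = E u + E v"
      "\<And>v. v \<in> S \<Longrightarrow> E (X v) = s' c (E v)"
    and lin: "Vector_Spaces.linear s s' (\<lambda>a. E (F a))"
  shows "E (poly_subst X F p) = E (F (poly_ev s c p))"
proof -
  have vs: "vector_space s" "vector_space s'" using lin by (auto simp: linear_iff)
  have pow: "(X ^^ n) v \<in> S \<and> E ((X ^^ n) v) = s' (c ^ n) (E v)" if "v \<in> S" for n v
    using that by (induction n) (auto simp: S(3) E(3) vector_space_simps[OF vs(2)])
  have "(\<Sum>n\<in>A. (X ^^ n) (F (coeff p n))) \<in> S \<and>
      E (\<Sum>n\<in>A. (X ^^ n) (F (coeff p n))) = (\<Sum>n\<in>A. s' (c ^ n) (E (F (coeff p n))))"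
    if "finite A" for A
    using that by (induction A) (simp_all add: S E pow F)
  then have "E (poly_subst X F p) = (\<Sum>n\<le>degree p. s' (c ^ n) (E (F (coeff p n))))"
    by (simp add: poly_subst_def)
  then show ?thesis
    unfolding poly_ev_sum[OF vs(1) order.refl] linear_sum[OF lin]
    using lin by (simp add: linear_iff)
qed

lemmas poly_subst_ev_UNIV = poly_subst_ev[where S = UNIV, simplified]

section \<open>The Lie conformal algebra of a Gel'fand-Dorfman algebra\<close>

text \<open>The bracket \<open>[a\<^sub>\<lambda> b]\<close> of \<open>a, b \<in> A\<close> at \<open>\<lambda> = l\<close>, \<open>\<partial> = d\<close>.\<close>

definition gd_ev :: "('k \<Rightarrow> 'v \<Rightarrow> 'v) \<Rightarrow> ('v \<Rightarrow> 'v \<Rightarrow> 'v) \<Rightarrow> ('v \<Rightarrow> 'v \<Rightarrow> 'v)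
    \<Rightarrow> 'k \<Rightarrow> 'k \<Rightarrow> 'v \<Rightarrow> 'v \<Rightarrow> 'v::ab_group_add" where
  "gd_ev s m br l d a b = s d (m b a) + s l (star m a b) + br a b"

lemma gd_algebraD:
  assumes "gd_algebra s m br"
  shows "vector_space s" "bilinear_map s s s m" "bilinear_map s s s br"
    and "m (m a b) c - m a (m b c) = m (m b a) c - m b (m a c)"
    and "m (m a b) c = m (m a c) b"
    and "br a b = - br b a"
    and "br a (br b c) + br b (br c a) + br c (br a b) = 0"
    and "br (m a b) c - br (m a c) b + m (br a b) c - m (br a c) b - m a (br b c) = 0"
proof -
  show b: "bilinear_map s s s m" "bilinear_map s s s br"
    using assms by (auto simp: gd_algebra_def novikov_algebra_def left_symmetric_algebra_def lie_algebra_def)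
  then show "vector_space s" by (simp add: bilinear_map_iff)
  have z: "br x x = 0" for x using assms by (simp add: gd_algebra_def lie_algebra_def)
  have "br (a + b) (a + b) = br a a + br b b + (br a b + br b a)"
    using b(2) by (simp add: bilinear_map_iff algebra_simps)
  then show "br a b = - br b a" by (simp add: z eq_neg_iff_add_eq_0)
qed (use assms in \<open>auto simp: gd_algebra_def novikov_algebra_def left_symmetric_algebra_def lie_algebra_def\<close>)

lemma bilinear_gd_ev:
  assumes "bilinear_map s s s m" "bilinear_map s s s br"
  shows "bilinear_map s s s (gd_ev s m br l d)"
proof -
  have vs: "vector_space s" using assms by (simp add: bilinear_map_iff)
  show ?thesis using assms
    by (simp add: bilinear_map_iff gd_ev_def star_def vector_space_simps[OF vs] algebra_simps)
qed

lemma gd_ev_skew: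
  assumes "gd_algebra s m br"
  shows "gd_ev s m br l d a b = - gd_ev s m br (- l - d) d b a"
proof -
  note vs = gd_algebraD(1)[OF assms]
  show ?thesis using gd_algebraD(6)[OF assms, of a b]
    by (simp add: gd_ev_def star_def vector_space_simps[OF vs] algebra_simps)
qed

text \<open>The coefficients of the monomials in \<open>l\<close>, \<open>k\<close>, \<open>d\<close> are consequences of the Novikov identities (degree 2), of
  the Gel'fand-Dorfman identity (degree 1) and of the Jacobi identity (degree 0).\<close>

lemma gd_ev_jacobi:
  fixes s :: "'k::field \<Rightarrow> 'v::ab_group_add \<Rightarrow> 'v"
  assumes gd: "gd_algebra s m br"
  shows "gd_ev s m br l d a (gd_ev s m br k (l + d) b c) =
    gd_ev s m br (l + k) d (gd_ev s m br l (- l - k) a b) c + gd_ev s m br k d b (gd_ev s m br l (k + d) a c)"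
proof (rule linear_functional_separates)
  note D = gd_algebraD[OF gd]
  show "vector_space s" by (rule D(1))
  fix \<phi> assume \<phi>: "Vector_Spaces.linear s (*) \<phi>"
  note \<phi>s = linear_minus[OF \<phi>] linear_diff[OF \<phi>]
  have \<phi>a: "\<phi> (x + y) = \<phi> x + \<phi> y" "\<phi> (s t x) = t * \<phi> x" for x y t using \<phi> by (auto simp: linear_iff)
  have b: "m (x + x') y = m x y + m x' y" "m x (y + y') = m x y + m x y'" "m (s t x) y = s t (m x y)"
    "m x (s t y) = s t (m x y)" "br (x + x') y = br x y + br x' y" "br x (y + y') = br x y + br x y'"
    "br (s t x) y = s t (br x y)" "br x (s t y) = s t (br x y)" for x y x' y' t
    using D(2,3) by (auto simp: bilinear_map_iff)
  have b': "m (- x) y = - m x y" "m x (- y) = - m x y" "br (- x) y = - br x y" "br x (- y) = - br x y" for x y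
    using D(2,3) by (auto simp: bilinear_map_def intro: linear_minus)
  have r: "\<phi> (m (m x y) z) = \<phi> (m (m x z) y)" for x y z using D(5) by simp
  have l: "\<phi> (m x (m y z)) = \<phi> (m (m x y) z) - \<phi> (m (m y x) z) + \<phi> (m y (m x z))" for x y z
    using arg_cong[OF D(4)[of x y z], of \<phi>] unfolding \<phi>s by (simp add: algebra_simps)
  have g: "\<phi> (m x (br y z)) = \<phi> (br (m x y) z) - \<phi> (br (m x z) y) + \<phi> (m (br x y) z) - \<phi> (m (br x z) y)" for x y z
    using arg_cong[OF D(8)[of x y z], of \<phi>] unfolding \<phi>s \<phi>a linear_0[OF \<phi>] by (simp add: algebra_simps)
  have s1: "br b a = - br a b" "br c a = - br a c" "br c b = - br b c" by (rule D(6))+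
  have s2: "br x (m y z) = - br (m y z) x" "br (br y z) x = - br x (br y z)" for x y z by (rule D(6))+
  have j: "\<phi> (br a (br b c)) = \<phi> (br b (br a c)) - \<phi> (br c (br a b))"
    using arg_cong[OF D(7)[of a b c], of \<phi>] s1(2) unfolding \<phi>a linear_0[OF \<phi>] 
    by (simp add: b' \<phi>s algebra_simps)
  \<comment> \<open>Both sides are brought to a normal form. Each of the instances below eliminates a different word in
    \<open>a\<close>, \<open>b\<close>, \<open>c\<close>; left symmetry as a general rewrite rule would not terminate.\<close>
  note R = r[of a c b] r[of b c a] r[of c b a] l[of a b c] l[of a c b] l[of b c a]
    g[of a b c] g[of b a c] g[of c a b]
  show "\<phi> (gd_ev s m br l d a (gd_ev s m br k (l + d) b c)) = \<phi> (gd_ev s m br (l + k) d (gd_ev s m br l (- l - k) a b) c +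
      gd_ev s m br k d b (gd_ev s m br l (k + d) a c))"
    unfolding gd_ev_def star_def b s1 s2 b' \<phi>a \<phi>s R j by (simp add: b b' s1 s2 \<phi>a \<phi>s R j algebra_simps)
qed

definition poly_ev2 :: "('k \<Rightarrow> 'v \<Rightarrow> 'v) \<Rightarrow> 'k \<Rightarrow> 'k::field \<Rightarrow> 'v::ab_group_add poly poly \<Rightarrow> 'v" where
  "poly_ev2 s l d u = poly_ev s d (poly_ev (poly_scale s) l u)"

lemma poly_ev2_simps:
  assumes vs: "vector_space s"
  shows "poly_ev2 s l d 0 = 0" "poly_ev2 s l d (u + v) = poly_ev2 s l d u + poly_ev2 s l d v"
  "poly_ev2 s l d (- u) = - poly_ev2 s l d u" "poly_ev2 s l d (u - v) = poly_ev2 s l d u - poly_ev2 s l d v"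
  "poly_ev2 s l d (poly_scale (poly_scale s) k u) = s k (poly_ev2 s l d u)"
  "poly_ev2 s l d (var_mult u) = s l (poly_ev2 s l d u)"
  "poly_ev2 s l d (map_poly var_mult u) = s d (poly_ev2 s l d u)"
  "poly_ev2 s l d [:p:] = poly_ev s d p"
  by (simp_all add: poly_ev2_def poly_ev_simps vector_space_poly_scale vs poly_ev_map_poly[OF linear_var_mult])

lemma poly_ev2_eqI:
  fixes s :: "'k::field_char_0 \<Rightarrow> 'v::ab_group_add \<Rightarrow> 'v"
  assumes vs: "vector_space s" and "\<And>l d. poly_ev2 s l d u = poly_ev2 s l d v"
  shows "u = v"
  using assms(2) unfolding poly_ev2_def
  by (intro poly_ev_eqI[OF vector_space_poly_scale[OF vs]] poly_ev_eqI[OF vs])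

text \<open>Sesquilinearity in values: \<open>\<partial>\<close> acts on the first argument as \<open>-\<lambda>\<close> and on the second as \<open>\<lambda> + \<partial>\<close>.\<close>

lemma poly_ev2_bracket:
  assumes m: "bilinear_map s s s m" and br: "bilinear_map s s s br"
  shows "poly_ev2 s l d (gd_conformal_bracket m br p q) =
    gd_ev s m br l d (poly_ev s (- l) p) (poly_ev s (l + d) q)"
proof -
  have vs: "vector_space s" "vector_space (poly_scale s)"
    using m by (simp_all add: bilinear_map_iff vector_space_poly_scale)
  have base: "poly_ev2 s l d (gd_conformal_base m br a b) = gd_ev s m br l d a b" for a b
    by (simp add: gd_conformal_base_def gd_ev_def poly_ev2_def poly_ev_pCons vs
      vector_space_simps[OF vs(1)] vector_space_simps[OF vs(2)] poly_ev_simps add.commute)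
  note bil = bilinear_gd_ev[OF m br, of l d]
  have lin: "Vector_Spaces.linear s s (gd_ev s m br l d a)" "Vector_Spaces.linear s s (\<lambda>a. gd_ev s m br l d a b)" for a b
    using bil by (auto simp: bilinear_map_def)
  have inner: "poly_ev2 s l d (poly_subst (\<lambda>u. var_mult u + map_poly var_mult u) (\<lambda>b. gd_conformal_base m br a b) q)
    = gd_ev s m br l d a (poly_ev s (l + d) q)" for a
    by (subst poly_subst_ev_UNIV[where s' = s and c = "l + d" and s = s])
      (simp_all add: poly_ev2_simps[OF vs(1)] base lin vector_space_simps[OF vs(1)])
  show ?thesis unfolding gd_conformal_bracket_def
    by (subst poly_subst_ev_UNIV[where s' = s and c = "- l" and s = s])
      (simp_all add: poly_ev2_simps[OF vs(1)] inner lin vector_space_simps[OF vs(1)])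
qed

lemma lie_conformal_algebra_gd:
  fixes s :: "'k::field_char_0 \<Rightarrow> 'v::ab_group_add \<Rightarrow> 'v"
  assumes gd: "gd_algebra s m br"
  shows "lie_conformal_algebra (poly_scale s) var_mult (gd_conformal_bracket m br)"
proof -
  note D = gd_algebraD[OF gd]
  have vs: "vector_space s" "vector_space (poly_scale s)" "vector_space (poly_scale (poly_scale s))"
    by (simp_all add: D(1) vector_space_poly_scale)
  note simps = poly_ev2_simps[OF D(1)] and eqI = poly_ev2_eqI[OF D(1)]
    and ev = poly_ev2_bracket[OF D(2,3)] and p = poly_ev_simps[OF vs(1)]
  have bil: "bilinear_map s s s (gd_ev s m br l d)" for l d by (rule bilinear_gd_ev[OF D(2,3)])
  then have b: "gd_ev s m br l d (x + x') y = gd_ev s m br l d x y + gd_ev s m br l d x' y"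
    "gd_ev s m br l d x (y + y') = gd_ev s m br l d x y + gd_ev s m br l d x y'"
    "gd_ev s m br l d (s t x) y = s t (gd_ev s m br l d x y)"
    "gd_ev s m br l d x (s t y) = s t (gd_ev s m br l d x y)" for l d x x' y y' t
    by (auto simp: bilinear_map_iff)
  have lin: "Vector_Spaces.linear s s (gd_ev s m br l d a)" "Vector_Spaces.linear s s (\<lambda>a. gd_ev s m br l d a b)" for a b l d
    using bil by (auto simp: bilinear_map_def)
  have bm: "gd_ev s m br l d (- x) y = - gd_ev s m br l d x y" for l d x y
    by (rule linear_minus[OF lin(2)])
  let ?b = "gd_conformal_bracket m br"
  show ?thesis unfolding lie_conformal_algebra_def
  proof (intro conjI allI)
    show "Vector_Spaces.linear (poly_scale s) (poly_scale s) var_mult" by (rule linear_var_mult[OF vs(1)])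
    show "bilinear_map (poly_scale s) (poly_scale s) (poly_scale (poly_scale s)) ?b"
      unfolding bilinear_map_iff
      by (intro conjI allI vs eqI) (simp_all only: ev simps b p)
    fix x y z
    show "?b (var_mult x) y = - var_mult (?b x y)"
      by (rule eqI) (simp add: ev simps b bm p vector_space_simps[OF vs(1)])
    show "?b x (var_mult y) = var_mult (?b x y) + map_poly var_mult (?b x y)"
      by (rule eqI) (simp add: ev simps b p vector_space_simps[OF vs(1)])
    show "?b x y = - poly_subst (\<lambda>p. - var_mult p - map_poly var_mult p) (\<lambda>x. [:x:]) (?b y x)"
    proof (rule eqI)
      fix l d
      have "poly_ev2 s l d (poly_subst (\<lambda>p. - var_mult p - map_poly var_mult p) (\<lambda>x. [:x:]) (?b y x))
          = poly_ev2 s l d [:poly_ev (poly_scale s) (- l - d) (?b y x):]"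
        by (subst poly_subst_ev_UNIV[where s' = s and c = "- l - d" and s = "poly_scale s"])
          (simp_all add: simps vector_space_simps[OF vs(1)] linear_poly_ev vs(1))
      also have "\<dots> = poly_ev2 s (- l - d) d (?b y x)" by (simp add: simps poly_ev2_def[symmetric])
      finally show "poly_ev2 s l d (?b x y) = poly_ev2 s l d (- poly_subst (\<lambda>p. - var_mult p - map_poly var_mult p) (\<lambda>x. [:x:]) (?b y x))"
        by (simp add: simps ev) (subst gd_ev_skew[OF gd], simp add: add.commute)
    qed
    show "poly_subst var_mult (\<lambda>u. [:?b x u:]) (?b y z) =
        poly_subst (map_poly var_mult)
          (\<lambda>u. poly_subst (\<lambda>p. map_poly var_mult p + var_mult p) (\<lambda>y. [:[:y:]:]) (?b u z)) (?b x y)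
        + poly_subst (map_poly var_mult) (\<lambda>u. map_poly (\<lambda>y. [:y:]) (?b y u)) (?b x z)" (is "?L = ?M + ?N")
    proof (rule poly_ev_eqI[OF vs(3)], rule eqI)
      \<comment> \<open>values at \<open>\<mu> = k\<close>, \<open>\<lambda> = l\<close>, \<open>\<partial> = d\<close>; the two sides then are those of \<open>gd_ev_jacobi\<close>\<close>
      fix k l d
      let ?E = "\<lambda>u. poly_ev2 s l d (poly_ev (poly_scale (poly_scale s)) k u)"
      note q = poly_ev_simps[OF vs(3)] 
      have q': "poly_ev (poly_scale (poly_scale s)) k (map_poly var_mult u) = var_mult (poly_ev (poly_scale (poly_scale s)) k u)" for u
        by (rule poly_ev_map_poly[OF linear_var_mult[OF vs(2)]])
      have "?E ?L = ?E [:?b x (poly_ev (poly_scale s) k (?b y z)):]"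
        by (rule poly_subst_ev_UNIV[where s' = s])
          (simp_all add: q simps ev b p vector_space_simps[OF vs(1)] linear_iff vs)
      then have L: "?E ?L = gd_ev s m br l d (poly_ev s (- l) x) (gd_ev s m br k (l + d) (poly_ev s (- k) y) (poly_ev s (k + (l + d)) z))"
        by (simp add: q ev poly_ev2_def[symmetric])
      have M1: "?E (poly_subst (\<lambda>p. map_poly var_mult p + var_mult p) (\<lambda>y. [:[:y:]:]) v) =
          poly_ev s d (poly_ev (poly_scale s) (l + k) v)" for v
        by (subst poly_subst_ev_UNIV[where s' = s and c = "l + k" and s = "poly_scale s"])
          (simp_all add: q q' simps vector_space_simps[OF vs(1)] linear_poly_ev vs(1))
      have "?E ?M = ?E (poly_subst (\<lambda>p. map_poly var_mult p + var_mult p) (\<lambda>y. [:[:y:]:]) (?b (poly_ev (poly_scale s) l (?b x y)) z))"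
        by (rule poly_subst_ev_UNIV[where s' = s])
          (simp_all add: q q' simps M1 ev b p vector_space_simps[OF vs(1)] linear_iff vs poly_ev2_def[symmetric])
      then have M: "?E ?M = gd_ev s m br (l + k) d (gd_ev s m br l (- l - k) (poly_ev s (- l) x) (poly_ev s (- k) y)) (poly_ev s (l + k + d) z)"
        by (simp add: M1 ev poly_ev2_def[symmetric])
      have N1: "poly_ev (poly_scale (poly_scale s)) k (map_poly (\<lambda>y. [:y:]) u) = [:poly_ev (poly_scale s) k u:]" for u
        by (rule poly_ev_map_poly[OF linear_const_poly[OF vs(2)]])
      have "?E ?N = ?E (map_poly (\<lambda>y. [:y:]) (?b y (poly_ev (poly_scale s) l (?b x z))))"
        by (rule poly_subst_ev_UNIV[where s' = s])
          (simp_all add: q q' N1 simps ev b p vector_space_simps[OF vs(1)] linear_iff vs poly_ev2_def[symmetric])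
      then have N: "?E ?N = gd_ev s m br k d (poly_ev s (- k) y) (gd_ev s m br l (k + d) (poly_ev s (- l) x) (poly_ev s (l + (k + d)) z))"
        by (simp add: N1 simps ev poly_ev2_def[symmetric])
      show "?E ?L = ?E (?M + ?N)"
        unfolding q simps L M N gd_ev_jacobi[OF gd, of l d _ k] by (simp add: algebra_simps)
    qed
  qed
qed

section \<open>Coproducts dual to products\<close>

text \<open>Let the functionals \<open>P p\<close> be indexed by a set with a binary operation \<open>g\<close>. If a coproduct is dual to \<open>g\<close>, then
  its iterates are dual to the iterates \<open>g p (g q w)\<close> and \<open>g (g p q) w\<close>, so a coalgebra identity can be
  read off from an identity for \<open>g\<close>. Here \<open>g\<close> is the negative product or bracket of the algebra, or, in the
  conformal case, an operation on pairs of a scalar and a vector.\<close>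

lemma dual_coproduct:
  assumes \<Delta>: "coproduct s \<Delta>" and t: "t \<in> tspace s"
    and P: "\<And>p. Vector_Spaces.linear s (*) (P p)"
    and dual: "\<And>a p q. \<Delta> a (\<lambda>x y. P p x * P q y) = P (g p q) a"
  shows "id_tens s \<Delta> t (\<lambda>x y z. P p x * P q y * P w z) = t (\<lambda>x y. P p x * P (g q w) y)"
    and "tens_id s \<Delta> t (\<lambda>x y z. P p x * P q y * P w z) = t (\<lambda>x y. P (g p q) x * P w y)"
    and "tflip_id s (id_tens s \<Delta> t) (\<lambda>x y z. P p x * P q y * P w z) = t (\<lambda>x y. P q x * P (g p w) y)"
    and "tflip_id s (tens_id s \<Delta> t) (\<lambda>x y z. P p x * P q y * P w z) = t (\<lambda>x y. P (g q p) x * P w y)"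
proof -
  note tri = trilinear_prod[OF P P P] and bil = bilinear_prod[OF P P]
  show i: "id_tens s \<Delta> t (\<lambda>x y z. P p x * P q y * P w z) = t (\<lambda>x y. P p x * P (g q w) y)" for p q w
    unfolding id_tens_eval(1)[OF \<Delta> t tri]
    by (simp add: mult.assoc tspace_eval(4)[OF coproductD(4)[OF \<Delta>] bil] dual)
  have "\<Delta> x (\<lambda>u v. P p u * P q v * P w y) = P w y * \<Delta> x (\<lambda>u v. P p u * P q v)" for x y p q w
    unfolding tspace_eval(4)[OF coproductD(4)[OF \<Delta>] bil, symmetric] by (simp add: ac_simps)
  then show j: "tens_id s \<Delta> t (\<lambda>x y z. P p x * P q y * P w z) = t (\<lambda>x y. P (g p q) x * P w y)" for p q w
    unfolding id_tens_eval(2)[OF \<Delta> t tri] by (simp add: dual mult.commute)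
  show "tflip_id s (id_tens s \<Delta> t) (\<lambda>x y z. P p x * P q y * P w z) = t (\<lambda>x y. P q x * P (g p w) y)"
    unfolding tflip_id_eval[OF id_tens_in(1)[OF \<Delta> t] tri] i[symmetric] by (simp add: ac_simps)
  show "tflip_id s (tens_id s \<Delta> t) (\<lambda>x y z. P p x * P q y * P w z) = t (\<lambda>x y. P (g q p) x * P w y)"
    unfolding tflip_id_eval[OF id_tens_in(2)[OF \<Delta> t] tri] j[symmetric] by (simp add: ac_simps)
qed

lemma coproductI:
  assumes sep: "separating s \<Phi>" and "\<And>a. \<Delta> a \<in> tspace s"
    and "\<And>\<phi> \<psi>. \<phi> \<in> \<Phi> \<Longrightarrow> \<psi> \<in> \<Phi> \<Longrightarrow> Vector_Spaces.linear s (*) (\<lambda>a. \<Delta> a (\<lambda>x y. \<phi> x * \<psi> y))"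
  shows "coproduct s \<Delta>"
  unfolding coproduct_def linear_iff
proof (intro conjI allI)
  show vs: "vector_space s" using sep by (simp add: separating_def)
  show "\<Delta> (x + y) = \<Delta> x + \<Delta> y" for x y
    using assms(3) by (intro tspace_eqI[OF sep] tspace_add assms(2)) (simp add: linear_iff)
  show "\<Delta> (s c x) = tscale c (\<Delta> x)" for c x
    using assms(3) by (intro tspace_eqI[OF sep] tspace_scale vs assms(2)) (simp add: linear_iff)
qed (auto simp: assms(2) vector_space_tscale)

section \<open>Gel'fand-Dorfman algebras with a compatible symplectic form\<close>

text \<open>The last assumption says that \<open>r\<close> is inverse to \<open>\<omega>\<close>; it implies that \<open>\<omega>\<close> is nondegenerate and that \<open>r\<close> is skew.
  The two identities for \<open>\<omega>\<close> are what makes the inverse tensor a solution of the Yang-Baxter equation.\<close>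

locale symplectic_gd =
  fixes s :: "'k::field_char_0 \<Rightarrow> 'v::ab_group_add \<Rightarrow> 'v" and m br :: "'v \<Rightarrow> 'v \<Rightarrow> 'v"
    and \<omega> :: "'v \<Rightarrow> 'v \<Rightarrow> 'k" and r :: "('v, 'k) tensor2"
  assumes gd: "gd_algebra s m br"
    and bilinear_\<omega>: "bilinear_map s s (*) \<omega>"
    and \<omega>_skew: "\<omega> x y = - \<omega> y x"
    and \<omega>_br: "\<omega> (br x y) z + \<omega> (br y z) x + \<omega> (br z x) y = 0"
    and \<omega>_m: "\<omega> x (m y z) = \<omega> (m x z) y - \<omega> (m x y) z - \<omega> (m y x) z"
    and r_in: "r \<in> tspace s"
    and r_contract: "Vector_Spaces.linear s (*) \<phi> \<Longrightarrow> r (\<lambda>x y. \<phi> x * \<omega> y u) = \<phi> u"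
begin

lemmas gdD = gd_algebraD[OF gd]
lemmas vs = gdD(1)
lemmas vs_simps = vector_space_simps[OF vs]

lemma lin:
  "m (x + x') y = m x y + m x' y" "m x (y + y') = m x y + m x y'" "m (s t x) y = s t (m x y)"
  "m x (s t y) = s t (m x y)" "br (x + x') y = br x y + br x' y" "br x (y + y') = br x y + br x y'"
  "br (s t x) y = s t (br x y)" "br x (s t y) = s t (br x y)"
  "\<omega> (x + x') y = \<omega> x y + \<omega> x' y" "\<omega> x (y + y') = \<omega> x y + \<omega> x y'" "\<omega> (s t x) y = t * \<omega> x y"
  "\<omega> x (s t y) = t * \<omega> x y"
  "star m (x + x') y = star m x y + star m x' y" "star m x (y + y') = star m x y + star m x y'" 
  "star m (s t x) y = s t (star m x y)" "star m x (s t y) = s t (star m x y)"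
  using gdD(2,3) bilinear_\<omega> by (simp_all add: bilinear_map_iff star_def vs_simps)

lemma linear_ops:
  "Vector_Spaces.linear s s (m x)" "Vector_Spaces.linear s s (\<lambda>y. m y x)"
  "Vector_Spaces.linear s s (br x)" "Vector_Spaces.linear s s (\<lambda>y. br y x)"
  "Vector_Spaces.linear s s (star m x)" "Vector_Spaces.linear s s id"
  "Vector_Spaces.linear s (*) (\<omega> x)" "Vector_Spaces.linear s (*) (\<lambda>y. \<omega> y x)"
  by (simp_all add: linear_iff vs lin vector_space_mult)

lemma lin_minus:
  "m (- x) y = - m x y" "m x (- y) = - m x y" "br (- x) y = - br x y" "br x (- y) = - br x y"
  "\<omega> (- x) y = - \<omega> x y" "\<omega> x (- y) = - \<omega> x y"
  by (rule linear_minus[OF linear_ops(2)] linear_minus[OF linear_ops(1)] linear_minus[OF linear_ops(4)]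
    linear_minus[OF linear_ops(3)] linear_minus[OF linear_ops(8)] linear_minus[OF linear_ops(7)])+

definition \<Phi> :: "('v \<Rightarrow> 'k) set" where "\<Phi> = range (\<lambda>p x. \<omega> x p)"

lemma separating_\<Phi>: "separating s \<Phi>"
  unfolding separating_def
proof (intro conjI vs ballI allI impI)
  show "Vector_Spaces.linear s (*) \<phi>" if "\<phi> \<in> \<Phi>" for \<phi>
    using that linear_ops(8) by (auto simp: \<Phi>_def)
  fix u assume "\<forall>\<phi>\<in>\<Phi>. \<phi> u = 0"
  then have "\<omega> u y = 0" for y by (auto simp: \<Phi>_def)
  then have u: "\<omega> y u = 0" for y by (subst \<omega>_skew) simp
  show "u = 0" using vs
  proof (rule linear_functional_separates)
    fix \<phi> assume \<phi>: "Vector_Spaces.linear s (*) \<phi>"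
    have "\<phi> u = r (\<lambda>x y. 0 * (\<phi> x * \<omega> y u))"
      using r_contract[OF \<phi>, of u] by (simp add: u)
    also have "\<dots> = 0" by (subst tspace_eval(4)[OF r_in bilinear_prod[OF \<phi> linear_ops(8)]]) simp
    finally show "\<phi> u = \<phi> 0" by (simp add: linear_0[OF \<phi>])
  qed
qed

text \<open>The inverse of a skew form is skew: pairing \<open>r + \<tau> r\<close> with \<open>p \<otimes> q\<close> gives \<open>\<omega>(q, p) + \<omega>(p, q)\<close>.\<close>

lemma r_skew: "r + tflip s r = 0"
proof (rule tspace_zeroI[OF separating_\<Phi>])
  show "r + tflip s r \<in> tspace s" by (intro tspace_add r_in tflip_in vs)
  fix \<phi> \<psi> assume "\<phi> \<in> \<Phi>" "\<psi> \<in> \<Phi>"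
  then obtain p q where \<phi>: "\<phi> = (\<lambda>x. \<omega> x p)" "\<psi> = (\<lambda>x. \<omega> x q)" by (auto simp: \<Phi>_def)
  have "r (\<lambda>x y. \<omega> y p * \<omega> x q) = \<omega> p q"
    using r_contract[OF linear_ops(8), of q p] by (simp add: mult.commute)
  then show "(r + tflip s r) (\<lambda>x y. \<phi> x * \<psi> y) = 0"
    unfolding \<phi> by (simp add: tflip_eval[OF r_in bilinear_prod[OF linear_ops(8,8)]]
      r_contract[OF linear_ops(8)]) (metis \<omega>_skew add.left_inverse add.right_inverse)
qed

lemma r_flip: "bilinear_map s s (*) B \<Longrightarrow> r (\<lambda>x y. B y x) = - r B"
  using fun_cong[OF r_skew, of B] tflip_eval[OF r_in, of B] by (simp add: eq_neg_iff_add_eq_0 add.commute)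

lemma r_contract': "Vector_Spaces.linear s (*) \<phi> \<Longrightarrow> r (\<lambda>x y. \<omega> x u * \<phi> y) = - \<phi> u"
  using r_flip[OF bilinear_prod[of s \<phi> s "\<lambda>y. \<omega> y u"]] r_contract[of \<phi> u]
  by (simp add: linear_ops mult.commute)

lemma r_contract_eq:
  assumes "Vector_Spaces.linear s (*) \<phi>"
  shows "(\<And>x y. f x y = \<phi> x * \<omega> y u) \<Longrightarrow> r f = \<phi> u"
    and "(\<And>x y. f x y = \<omega> x u * \<phi> y) \<Longrightarrow> r f = - \<phi> u"
  using r_contract[OF assms, of u] r_contract'[OF assms, of u] by presburger+

text \<open>Pair with \<open>p \<otimes> q \<otimes> w\<close> and contract both copies of \<open>r\<close>. What remains are the identities \<open>\<omega>_m\<close> and \<open>\<omega>_br\<close>.\<close>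

lemma gd_ybe: "gd_ybe s m br r"
  unfolding gd_ybe_def
proof (intro conjI r_in)
  have tri: "trilinear_map s tscale (tens3 s)" by (rule trilinear_tens3[OF vs])
  have t3: "tens3 s (x + x') y z = tens3 s x y z + tens3 s x' y z"
    "tens3 s x (y + y') z = tens3 s x y z + tens3 s x y' z"
    "tens3 s x y (z + z') = tens3 s x y z + tens3 s x y z'"
    "tens3 s (s c x) y z = tscale c (tens3 s x y z)"
    "tens3 s x (s c y) z = tscale c (tens3 s x y z)"
    "tens3 s x y (s c z) = tscale c (tens3 s x y z)"
    "tscale c (t + t') = tscale c t + tscale c (t' :: ('v, 'k) tensor3)" for x x' y y' z z' c t t'
    using tri vector_space_simps(1)[OF vector_space_tscale] by (simp_all add: trilinear_map_iff)
  have t3_eval: "tens3 s x y z (\<lambda>x y z. \<omega> x p * \<omega> y q * \<omega> z w) = \<omega> x p * \<omega> y q * \<omega> z w" for x y z p q w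
    using trilinear_prod[OF linear_ops(8,8,8)] by (simp add: tens3_def)
  note lins = linear_iff bilinear_map_iff vs vector_space_mult vector_space_tscale lin t3 algebra_simps
  let ?N = "\<lambda>x y x' y'. tens3 s x x' (m y y') + tens3 s x (star m y x') y' + tens3 s (m x x') y' y"
  let ?C = "\<lambda>x y x' y'. tens3 s (br x x') y y' + tens3 s x (br y x') y' + tens3 s x x' (br y y')"
  have N: "bilinear_map s s tscale (?N x y)" "bilinear_map s s tscale (\<lambda>x y. ?N x y u v)" for x y u v
    by (simp_all add: lins)
  have C: "bilinear_map s s tscale (?C x y)" "bilinear_map s s tscale (\<lambda>x y. ?C x y u v)" for x y u v
    by (simp_all add: lins)
  note NN = tlift_tlift[OF N r_in r_in] and CC = tlift_tlift[OF C r_in r_in]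
  show "yb_N s m r = 0"
  proof (rule tspace3_zeroI[OF separating_\<Phi>])
    show "yb_N s m r \<in> tspace3 s" unfolding yb_N_def
      by (intro tlift_closed[OF NN(1) r_in] tlift_closed[OF N(1) r_in] tspace3_0 tspace3_add tens3_in)
    fix \<phi> \<psi> \<chi> assume "\<phi> \<in> \<Phi>" "\<psi> \<in> \<Phi>" "\<chi> \<in> \<Phi>"
    then obtain p q w where \<phi>: "\<phi> = (\<lambda>x. \<omega> x p)" "\<psi> = (\<lambda>x. \<omega> x q)" "\<chi> = (\<lambda>x. \<omega> x w)"
      by (auto simp: \<Phi>_def)
    have inner: "r (\<lambda>x' y'. \<omega> x p * \<omega> x' q * \<omega> (m y y') w + \<omega> x p * \<omega> (star m y x') q * \<omega> y' w
        + \<omega> (m x x') p * \<omega> y' q * \<omega> y w) =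
        \<omega> x p * (\<omega> (star m y w) q - \<omega> (m y q) w) + \<omega> (m x q) p * \<omega> y w" for x y
    proof -
      have "r (\<lambda>x' y'. \<omega> x p * \<omega> x' q * \<omega> (m y y') w) = - (\<omega> x p * \<omega> (m y q) w)"
        by (rule r_contract_eq(2)) (simp_all add: lins)
      moreover have "r (\<lambda>x' y'. \<omega> x p * \<omega> (star m y x') q * \<omega> y' w) = \<omega> x p * \<omega> (star m y w) q"
        by (rule r_contract_eq(1)) (simp_all add: lins)
      moreover have "r (\<lambda>x' y'. \<omega> (m x x') p * \<omega> y' q * \<omega> y w) = \<omega> (m x q) p * \<omega> y w"
        by (rule r_contract_eq(1)) (simp_all add: lins)
      ultimately show ?thesis
        by (subst tspace_eval(1)[OF r_in], simp add: lins, simp add: lins,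
            subst tspace_eval(1)[OF r_in], simp add: lins, simp add: lins) (simp add: algebra_simps)
    qed
    have 1: "r (\<lambda>x y. \<omega> x p * (\<omega> (star m y w) q - \<omega> (m y q) w)) = - (\<omega> (star m p w) q - \<omega> (m p q) w)"
      by (rule r_contract_eq(2)) (simp_all add: lins)
    have 2: "r (\<lambda>x y. \<omega> (m x q) p * \<omega> y w) = \<omega> (m w q) p"
      by (rule r_contract_eq(1)) (simp_all add: lins)
    show "yb_N s m r (\<lambda>x y z. \<phi> x * \<psi> y * \<chi> z) = 0"
      unfolding \<phi> yb_N_def NN(2) plus_fun_apply t3_eval inner
      by (subst tspace_eval(1)[OF r_in], simp add: lins, simp add: lins, simp only: 1 2)
        (simp add: star_def lin \<omega>_skew[of "m p q" w] \<omega>_m[of w p q])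
  qed
  show "yb_C s br r = 0"
  proof (rule tspace3_zeroI[OF separating_\<Phi>])
    show "yb_C s br r \<in> tspace3 s" unfolding yb_C_def
      by (intro tlift_closed[OF CC(1) r_in] tlift_closed[OF C(1) r_in] tspace3_0 tspace3_add tens3_in)
    fix \<phi> \<psi> \<chi> assume "\<phi> \<in> \<Phi>" "\<psi> \<in> \<Phi>" "\<chi> \<in> \<Phi>"
    then obtain p q w where \<phi>: "\<phi> = (\<lambda>x. \<omega> x p)" "\<psi> = (\<lambda>x. \<omega> x q)" "\<chi> = (\<lambda>x. \<omega> x w)"
      by (auto simp: \<Phi>_def)
    have inner: "r (\<lambda>x' y'. \<omega> (br x x') p * \<omega> y q * \<omega> y' w + \<omega> x p * \<omega> (br y x') q * \<omega> y' w
        + \<omega> x p * \<omega> x' q * \<omega> (br y y') w) =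
        \<omega> x p * (\<omega> (br y w) q - \<omega> (br y q) w) + \<omega> (br x w) p * \<omega> y q" for x y
    proof -
      have "r (\<lambda>x' y'. \<omega> (br x x') p * \<omega> y q * \<omega> y' w) = \<omega> (br x w) p * \<omega> y q"
        by (rule r_contract_eq(1)) (simp_all add: lins)
      moreover have "r (\<lambda>x' y'. \<omega> x p * \<omega> (br y x') q * \<omega> y' w) = \<omega> x p * \<omega> (br y w) q"
        by (rule r_contract_eq(1)) (simp_all add: lins)
      moreover have "r (\<lambda>x' y'. \<omega> x p * \<omega> x' q * \<omega> (br y y') w) = - (\<omega> x p * \<omega> (br y q) w)"
        by (rule r_contract_eq(2)) (simp_all add: lins)
      ultimately show ?thesis
        by (subst tspace_eval(1)[OF r_in], simp add: lins, simp add: lins,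
            subst tspace_eval(1)[OF r_in], simp add: lins, simp add: lins) (simp add: algebra_simps)
    qed
    have 1: "r (\<lambda>x y. \<omega> x p * (\<omega> (br y w) q - \<omega> (br y q) w)) = - (\<omega> (br p w) q - \<omega> (br p q) w)"
      by (rule r_contract_eq(2)) (simp_all add: lins)
    have 2: "r (\<lambda>x y. \<omega> (br x w) p * \<omega> y q) = \<omega> (br q w) p"
      by (rule r_contract_eq(1)) (simp_all add: lins)
    show "yb_C s br r (\<lambda>x y z. \<phi> x * \<psi> y * \<chi> z) = 0"
      unfolding \<phi> yb_C_def CC(2) plus_fun_apply t3_eval inner
      using \<omega>_br[of p q w] gdD(6)[of w p]
      by (subst tspace_eval(1)[OF r_in], simp add: lins, simp add: lins, simp only: 1 2)
        (simp add: lin_minus algebra_simps)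
  qed
qed

section \<open>The bialgebra of a symplectic form\<close>

definition cop :: "'v \<Rightarrow> ('v, 'k) tensor2" where
  "cop a = - (tmap s s (m a) id r + tmap s s id (star m a) r)"

definition cobr :: "'v \<Rightarrow> ('v, 'k) tensor2" where
  "cobr a = tmap s s (br a) id r + tmap s s id (br a) r"

lemma cop_in: "cop a \<in> tspace s" and cobr_in: "cobr a \<in> tspace s"
  unfolding cop_def cobr_def by (intro tspace_minus tspace_add tmap_in vs linear_ops r_in)+

text \<open>The values of the coproducts at a form. In the third one, \<open>\<Delta>(a) + \<tau> \<Delta>(a) = (R(a) \<otimes> id - id \<otimes> R(a)) r\<close>, the
  terms with \<open>L(a)\<close> cancel since \<open>r\<close> is skew.\<close>

lemma cop_eval:
  assumes B: "bilinear_map s s (*) B"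
  shows "cop a B = r (\<lambda>x y. - (B (m a x) y + B x (star m a y)))"
    and "tflip s (cop a) B = r (\<lambda>x y. B (star m a x) y + B x (m a y))"
    and "(cop a + tflip s (cop a)) B = r (\<lambda>x y. B (m x a) y - B x (m y a))"
    and "cobr a B = r (\<lambda>x y. B (br a x) y + B x (br a y))"
proof -
  have b: "bilinear_map s s (*) (\<lambda>x y. B (m a x) y)" "bilinear_map s s (*) (\<lambda>x y. B x (star m a y))"
      "bilinear_map s s (*) (\<lambda>x y. B x (m a y))" "bilinear_map s s (*) (\<lambda>x y. B (star m a x) y)"
      "bilinear_map s s (*) (\<lambda>x y. B (m a x) y + B x (star m a y))"
      "bilinear_map s s (*) (\<lambda>x y. B (br a x) y)" "bilinear_map s s (*) (\<lambda>x y. B x (br a y))"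
      "bilinear_map s s (*) (\<lambda>x y. B (m x a) y)" "bilinear_map s s (*) (\<lambda>x y. B x (m y a))"
    using B by (simp_all add: bilinear_map_iff lin algebra_simps)
  have 1: "cop a B = - (r (\<lambda>x y. B (m a x) y) + r (\<lambda>x y. B x (star m a y)))"
    unfolding cop_def using B by (simp add: tmap_eval linear_ops r_in)
  then show "cop a B = r (\<lambda>x y. - (B (m a x) y + B x (star m a y)))"
    unfolding tspace_eval(3)[OF r_in b(5)] tspace_eval(1)[OF r_in b(1,2)] .
  have "cop a (\<lambda>x y. B y x) = - (r (\<lambda>x y. B y (m a x)) + r (\<lambda>x y. B (star m a y) x))"
    unfolding cop_def using B bilinear_map_flip[OF B] by (simp add: tmap_eval linear_ops r_in)
  then have 2: "tflip s (cop a) B = r (\<lambda>x y. B x (m a y)) + r (\<lambda>x y. B (star m a x) y)"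
    unfolding tflip_eval[OF cop_in B] r_flip[OF b(3)] r_flip[OF b(4)] by simp
  then show "tflip s (cop a) B = r (\<lambda>x y. B (star m a x) y + B x (m a y))"
    unfolding tspace_eval(1)[OF r_in b(4,3)] by simp
  have st: "(\<lambda>x y. B (star m a x) y) = (\<lambda>x y. B (m a x) y + B (m x a) y)"
    "(\<lambda>x y. B x (star m a y)) = (\<lambda>x y. B x (m a y) + B x (m y a))"
    using B by (simp_all add: star_def bilinear_map_iff)
  show "(cop a + tflip s (cop a)) B = r (\<lambda>x y. B (m x a) y - B x (m y a))"
    unfolding tspace_eval(2)[OF r_in b(8,9)] plus_fun_apply 1 2 st tspace_eval(1)[OF r_in b(1,8)]
      tspace_eval(1)[OF r_in b(3,9)] by simp
  show "cobr a B = r (\<lambda>x y. B (br a x) y + B x (br a y))"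
    unfolding tspace_eval(1)[OF r_in b(6,7)] cobr_def using B by (simp add: tmap_eval linear_ops r_in)
qed

text \<open>The form \<open>\<omega>\<close> carries the coproducts to the negatives of the product and the bracket; contracting \<open>r\<close> leaves
  exactly the right sides of \<open>\<omega>_m\<close> and \<open>\<omega>_br\<close>.\<close>

lemma cop_dual: "cop a (\<lambda>x y. \<omega> x p * \<omega> y q) = \<omega> a (- m p q)"
proof -
  have b: "bilinear_map s s (*) (\<lambda>x y. \<omega> (m a x) p * \<omega> y q)" "bilinear_map s s (*) (\<lambda>x y. \<omega> x p * \<omega> (star m a y) q)"
    by (simp_all add: bilinear_map_iff lin vs vector_space_mult algebra_simps)
  have "bilinear_map s s (*) (\<lambda>x y. \<omega> (m a x) p * \<omega> y q + \<omega> x p * \<omega> (star m a y) q)"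
    by (simp add: bilinear_map_iff lin vs vector_space_mult algebra_simps)
  note e = tspace_eval(3)[OF r_in this] tspace_eval(1)[OF r_in b]
  have l: "Vector_Spaces.linear s (*) (\<lambda>x. \<omega> (m a x) p)" "Vector_Spaces.linear s (*) (\<lambda>y. \<omega> (star m a y) q)"
    by (simp_all add: linear_iff lin vs vector_space_mult)
  show ?thesis
    unfolding cop_eval(1)[OF bilinear_prod[OF linear_ops(8,8)]] e r_contract[OF l(1)] r_contract'[OF l(2)]
    by (simp add: lin_minus \<omega>_m[of a p q] star_def lin)
qed

lemma cobr_dual: "cobr a (\<lambda>x y. \<omega> x p * \<omega> y q) = \<omega> a (- br p q)"
proof -
  have b: "bilinear_map s s (*) (\<lambda>x y. \<omega> (br a x) p * \<omega> y q)" "bilinear_map s s (*) (\<lambda>x y. \<omega> x p * \<omega> (br a y) q)"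
    by (simp_all add: bilinear_map_iff lin vs vector_space_mult algebra_simps)
  have l: "Vector_Spaces.linear s (*) (\<lambda>x. \<omega> (br a x) p)" "Vector_Spaces.linear s (*) (\<lambda>y. \<omega> (br a y) q)"
    by (simp_all add: linear_iff lin vs vector_space_mult)
  show ?thesis
    unfolding cop_eval(4)[OF bilinear_prod[OF linear_ops(8,8)]] tspace_eval(1)[OF r_in b]
      r_contract[OF l(1)] r_contract'[OF l(2)]
    using \<omega>_br[of a q p] \<omega>_skew[of "br q p" a] gdD(6)[of p q] gdD(6)[of p a] by (simp add: lin_minus algebra_simps)
qed

lemma coproduct_cop: "coproduct s cop" and coproduct_cobr: "coproduct s cobr"
  by (rule coproductI[OF separating_\<Phi>];
      auto simp: \<Phi>_def cop_in cobr_in cop_dual cobr_dual linear_ops)+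

text \<open>By \<open>dual_coproduct\<close> each coalgebra identity is dual to the algebra identity cited in its proof.\<close>

lemma gd_coalgebra: "gd_coalgebra s cop cobr"
proof -
  note n = dual_coproduct[where P = "\<lambda>p x. \<omega> x p", OF coproduct_cop _ linear_ops(8) cop_dual]
  note b = dual_coproduct[where P = "\<lambda>p x. \<omega> x p", OF coproduct_cobr _ linear_ops(8) cobr_dual]
  note bil = bilinear_prod[OF linear_ops(8,8)]
  have ft: "tflip s (cop a) (\<lambda>x y. \<omega> x p * \<omega> y q) = \<omega> a (- m q p)"
    "tflip s (cobr a) (\<lambda>x y. \<omega> x p * \<omega> y q) = \<omega> a (- br q p)" for a p q
    unfolding cop_dual[symmetric] cobr_dual[symmetric] tflip_eval[OF cop_in bil] tflip_eval[OF cobr_in bil]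
    by (simp_all add: mult.commute)
  note ins = tspace3_add tspace3_diff[OF vs] tflip_id_in[OF vs] id_tens_in[OF coproduct_cop]
     id_tens_in[OF coproduct_cobr] cop_in cobr_in tflip_in[OF vs]
  note ev = n[OF cop_in] n[OF cobr_in] b[OF cop_in] b[OF cobr_in] n[OF tflip_in[OF vs cop_in]]
    b[OF tflip_in[OF vs cop_in]] ft cop_dual cobr_dual
  have E: "t = t'" if "t \<in> tspace3 s" "t' \<in> tspace3 s" "\<And>p q w. t (\<lambda>x y z. \<omega> x p * \<omega> y q * \<omega> z w) =
    t' (\<lambda>x y z. \<omega> x p * \<omega> y q * \<omega> z w)" for t t'
    using that by (intro tspace3_eqI[OF separating_\<Phi>]) (auto simp: \<Phi>_def)
  show ?thesis unfolding gd_coalgebra_def novikov_coalgebra_def lie_coalgebra_def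
  proof (intro conjI allI coproduct_cop coproduct_cobr)
    fix a
    show "id_tens s cop (cop a) - tflip_id s (id_tens s cop (cop a)) =
          tens_id s cop (cop a) - tflip_id s (tens_id s cop (cop a))" (is "?L = ?R")
    proof (rule E)
      fix p q w
      have "\<omega> a (m p (m q w)) - \<omega> a (m q (m p w)) = \<omega> a (m (m p q) w) - \<omega> a (m (m q p) w)"
        using arg_cong[OF gdD(4)[of p q w], of "\<omega> a"]
        unfolding linear_diff[OF linear_ops(7)] by (simp add: algebra_simps)
      then show "?L (\<lambda>x y z. \<omega> x p * \<omega> y q * \<omega> z w) = ?R (\<lambda>x y z. \<omega> x p * \<omega> y q * \<omega> z w)"
        by (simp add: ev) (simp add: lin_minus)
    qed (intro ins)+
    show "tflip_id s (id_tens s cop (tflip s (cop a))) = tens_id s cop (cop a)"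
      by (rule E, (intro ins)+, simp add: ev, simp add: lin_minus gdD(5))
    show "cobr a = - tflip s (cobr a)"
    proof (rule tspace_eqI[OF separating_\<Phi>])
      fix \<phi> \<psi> assume "\<phi> \<in> \<Phi>" "\<psi> \<in> \<Phi>"
      then obtain p q where \<phi>: "\<phi> = (\<lambda>x. \<omega> x p)" "\<psi> = (\<lambda>x. \<omega> x q)" by (auto simp: \<Phi>_def)
      show "cobr a (\<lambda>x y. \<phi> x * \<psi> y) = (- tflip s (cobr a)) (\<lambda>x y. \<phi> x * \<psi> y)"
        unfolding \<phi> by (simp add: ev lin_minus) (simp add: gdD(6)[of p q] lin_minus)
    qed (intro ins tspace_minus vs)+
    show "id_tens s cobr (cobr a) - tflip_id s (id_tens s cobr (cobr a)) = tens_id s cobr (cobr a)" (is "?L = ?R")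
    proof (rule E)
      fix p q w
      have "\<omega> a (br p (br q w)) - \<omega> a (br q (br p w)) = \<omega> a (br (br p q) w)"
        using arg_cong[OF gdD(7)[of p q w], of "\<omega> a"] gdD(6)[of w p] gdD(6)[of "br p q" w]
        by (simp add: linear_diff[OF linear_ops(7)] lin lin_minus linear_0[OF linear_ops(7)] algebra_simps)
      then show "?L (\<lambda>x y z. \<omega> x p * \<omega> y q * \<omega> z w) = ?R (\<lambda>x y z. \<omega> x p * \<omega> y q * \<omega> z w)"
        by (simp add: ev) (simp add: lin_minus)
    qed (intro ins)+
    show "id_tens s cobr (cop a) - tflip_id s (id_tens s cop (cobr a)) + tflip_id s (id_tens s cobr (tflip s (cop a))) =
          tens_id s cop (cobr a) + tens_id s cobr (cop a)" (is "?L = ?R")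
    proof (rule E)
      fix p q w
      have "\<omega> a (m p (br q w)) - \<omega> a (br q (m p w)) + \<omega> a (m (br p w) q) = \<omega> a (br (m p q) w) + \<omega> a (m (br p q) w)"
        using arg_cong[OF gdD(8)[of p q w], of "\<omega> a"] gdD(6)[of q "m p w"]
        by (simp add: linear_diff[OF linear_ops(7)] lin lin_minus linear_0[OF linear_ops(7)] algebra_simps)
      then show "?L (\<lambda>x y z. \<omega> x p * \<omega> y q * \<omega> z w) = ?R (\<lambda>x y z. \<omega> x p * \<omega> y q * \<omega> z w)"
        by (simp add: ev) (simp add: lin_minus)
    qed (intro ins)+
  qed
qed

lemma tspace_ext:
  assumes "t \<in> tspace s" "t' \<in> tspace s" "\<And>B. bilinear_map s s (*) B \<Longrightarrow> t B = t' B"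
  shows "t = t'"
  using assms separating_\<Phi> by (intro tspace_eqI[OF separating_\<Phi>]) (auto simp: separating_def bilinear_prod)

lemma r_as_sum:
  obtains rs where "\<And>B. bilinear_map s s (*) B \<Longrightarrow> r B = (\<Sum>z\<leftarrow>rs. B (fst z) (snd z))"
proof -
  obtain ps where "\<And>B. bilinear_map s s (*) B \<Longrightarrow> r B = (\<Sum>(x, y)\<leftarrow>ps. B x y)"
    using r_in by (rule tspaceE) blast
  then show thesis using that[of ps] by (simp add: case_prod_unfold)
qed

text \<open>The three conditions hold because of the operator identities \<open>L(a \<circ> b) = R(b) L(a)\<close> and
  \<open>L\<^sub>\<star>(a \<circ> b) = L\<^sub>\<star>(a) R(b)\<close>; because \<open>L\<^sub>\<star>(a) L(b) = L\<^sub>\<star>(b) L(a)\<close>; and because right multiplications commute.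
  The mixed terms, with an operator on each factor, cancel or are symmetric in \<open>a\<close> and \<open>b\<close>.\<close>

lemma novikov_bialgebra: "novikov_bialgebra s m cop"
  unfolding novikov_bialgebra_def
proof (intro conjI allI)
  show "novikov_algebra s m" "novikov_coalgebra s cop"
    using gd gd_coalgebra by (auto simp: gd_algebra_def gd_coalgebra_def)
  obtain rs where rs: "\<And>B. bilinear_map s s (*) B \<Longrightarrow> r B = (\<Sum>z\<leftarrow>rs. B (fst z) (snd z))"
    by (rule r_as_sum) blast
  note ins = tspace_add tspace_diff[OF vs] tmap_in linear_ops cop_in cobr_in tflip_in[OF vs]
  fix a b
  have st: "star m (m a b) y = star m a (m y b)" for y
    using gdD(4)[of a y b] gdD(5)[of a y b] gdD(5)[of y b a] by (simp add: star_def algebra_simps)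
  have sc: "star m a (m b y) = star m b (m a y)" for y
    using gdD(4)[of a b y] gdD(5)[of a y b] gdD(5)[of b y a] by (simp add: star_def algebra_simps)
  show "cop (m a b) = tmap s s (\<lambda>x. m x b) id (cop a) + tmap s s id (star m a) (cop b + tflip s (cop b))"
    (is "?L = ?R")
  proof (rule tspace_ext)
    fix B :: "'v \<Rightarrow> 'v \<Rightarrow> 'k" assume B: "bilinear_map s s (*) B"
    have b: "B (x + x') y = B x y + B x' y" "B x (y + y') = B x y + B x y'" "B (s c x) y = c * B x y"
      "B x (s c y) = c * B x y" for x x' y y' c using B by (auto simp: bilinear_map_iff)
    note rs' = rs bilinear_map_iff vs vector_space_mult lin b sum_list_addf sum_list_subtractf uminus_sum_list_map[unfolded comp_def, symmetric] algebra_simps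
    have i: "cop b + tflip s (cop b) \<in> tspace s" by (intro ins)
    have bs: "bilinear_map s s (*) (\<lambda>x y. B (m x b) y)" "bilinear_map s s (*) (\<lambda>x y. B x (star m a y))"
      by (simp_all add: bilinear_map_iff vs vector_space_mult lin b)
    show "?L B = ?R B"
      unfolding plus_fun_apply[of "tmap _ _ _ _ _"] tmap_eval[OF linear_ops(2,6) cop_in B] 
        tmap_eval[OF linear_ops(6,5) i B] id_apply cop_eval(1)[OF B] cop_eval(1)[OF bs(1)] cop_eval(3)[OF bs(2)]
      by (simp add: st gdD(5)[of a b] add: rs')
  qed (intro ins)+
  show "tmap s s (star m a) id (cop b) - tmap s s id (star m a) (tflip s (cop b)) =
        tmap s s (star m b) id (cop a) - tmap s s id (star m b) (tflip s (cop a))" (is "?L = ?R")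
  proof (rule tspace_ext)
    fix B :: "'v \<Rightarrow> 'v \<Rightarrow> 'k" assume B: "bilinear_map s s (*) B"
    have b: "B (x + x') y = B x y + B x' y" "B x (y + y') = B x y + B x y'" "B (s c x) y = c * B x y"
      "B x (s c y) = c * B x y" for x x' y y' c using B by (auto simp: bilinear_map_iff)
    note rs' = rs bilinear_map_iff vs vector_space_mult lin b sum_list_addf sum_list_subtractf uminus_sum_list_map[unfolded comp_def, symmetric] algebra_simps
    have bs: "bilinear_map s s (*) (\<lambda>x y. B (star m a x) y)" "bilinear_map s s (*) (\<lambda>x y. B x (star m a y))"
      "bilinear_map s s (*) (\<lambda>x y. B (star m b x) y)" "bilinear_map s s (*) (\<lambda>x y. B x (star m b y))"
      by (simp_all add: bilinear_map_iff vs vector_space_mult lin b)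
    show "?L B = ?R B"
      by (simp add: tmap_eval linear_ops ins cop_eval B bs)
         (simp add: sc rs')
  qed (intro ins)+
  show "tmap s s id (\<lambda>x. m x a) (cop b + tflip s (cop b)) - tmap s s (\<lambda>x. m x a) id (cop b + tflip s (cop b)) =
        tmap s s id (\<lambda>x. m x b) (cop a + tflip s (cop a)) - tmap s s (\<lambda>x. m x b) id (cop a + tflip s (cop a))" (is "?L = ?R")
  proof (rule tspace_ext)
    fix B :: "'v \<Rightarrow> 'v \<Rightarrow> 'k" assume B: "bilinear_map s s (*) B"
    have b: "B (x + x') y = B x y + B x' y" "B x (y + y') = B x y + B x y'" "B (s c x) y = c * B x y"
      "B x (s c y) = c * B x y" for x x' y y' c using B by (auto simp: bilinear_map_iff)
    note rs' = rs bilinear_map_iff vs vector_space_mult lin b sum_list_addf sum_list_subtractf uminus_sum_list_map[unfolded comp_def, symmetric] algebra_simps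
    have bs: "bilinear_map s s (*) (\<lambda>x y. B (m x c) y)" "bilinear_map s s (*) (\<lambda>x y. B x (m y c))" for c
      by (simp_all add: bilinear_map_iff vs vector_space_mult lin b)
    have i: "cop c + tflip s (cop c) \<in> tspace s" for c by (intro ins)
    show "?L B = ?R B"
      by (simp add: tmap_eval[OF linear_ops(2,6) i B] tmap_eval[OF linear_ops(6,2) i B] cop_eval(3) bs del: plus_fun_apply)
         (simp add: gdD(5)[of _ a b] rs')
  qed (intro ins)+
qed

text \<open>\<open>\<delta>\<^sub>0\<close> is the coboundary of \<open>r\<close>, and a coboundary is a cocycle by the Jacobi identity.\<close>

lemma lie_bialgebra: "lie_bialgebra s br cobr"
  unfolding lie_bialgebra_def
proof (intro conjI allI)
  show "lie_algebra s br" "lie_coalgebra s cobr"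
    using gd gd_coalgebra by (auto simp: gd_algebra_def gd_coalgebra_def)
  obtain rs where rs: "\<And>B. bilinear_map s s (*) B \<Longrightarrow> r B = (\<Sum>z\<leftarrow>rs. B (fst z) (snd z))"
    by (rule r_as_sum) blast
  note ins = tspace_add tspace_diff[OF vs] tmap_in linear_ops cop_in cobr_in tflip_in[OF vs]
  fix a b
  have j: "br (br a b) y = br a (br b y) - br b (br a y)" for y
    using gdD(7)[of a b y] gdD(6)[of y a] gdD(6)[of "br a b" y] by (simp add: lin_minus algebra_simps)
  show "cobr (br a b) = tensor_act s br a (cobr b) - tensor_act s br b (cobr a)" (is "?L = ?R")
  proof (rule tspace_ext)
    fix B :: "'v \<Rightarrow> 'v \<Rightarrow> 'k" assume B: "bilinear_map s s (*) B"
    have b: "B (x + x') y = B x y + B x' y" "B x (y + y') = B x y + B x y'" "B (s c x) y = c * B x y"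
      "B x (s c y) = c * B x y" for x x' y y' c using B by (auto simp: bilinear_map_iff)
    note rs' = rs bilinear_map_iff vs vector_space_mult lin b sum_list_addf sum_list_subtractf uminus_sum_list_map[unfolded comp_def, symmetric] algebra_simps
    have bs: "bilinear_map s s (*) (\<lambda>x y. B (br c x) y)" "bilinear_map s s (*) (\<lambda>x y. B x (br c y))" for c
      by (simp_all add: bilinear_map_iff vs vector_space_mult lin b)
    note bd = bilinear_map_diff[OF B]
    show "?L B = ?R B"
      unfolding tensor_act_def
      by (simp add: tmap_eval linear_ops ins cop_eval B bs j bd)
         (simp add: rs')
  qed (unfold tensor_act_def, (intro ins)+)
qed

text \<open>Comparing the operators on the first and on the second factor of \<open>r\<close> gives two identities in the algebra,
  both consequences of the Gel'fand-Dorfman identity; the mixed terms cancel.\<close>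

lemma gd_bialgebra: "gd_bialgebra s m br cop cobr"
  unfolding gd_bialgebra_def
proof (intro conjI allI gd gd_coalgebra novikov_bialgebra lie_bialgebra)
  obtain rs where rs: "\<And>B. bilinear_map s s (*) B \<Longrightarrow> r B = (\<Sum>z\<leftarrow>rs. B (fst z) (snd z))"
    by (rule r_as_sum) blast
  note ins = tspace_add tspace_diff[OF vs] tmap_in linear_ops cop_in cobr_in tflip_in[OF vs]
  fix a b
  show "cobr (m b a) + cop (br a b) =
        tmap s s (\<lambda>x. m x a) id (cobr b) + tmap s s (m b) id (cobr a) + tmap s s id (star m b) (cobr a)
        + tensor_act s br a (cop b) - tmap s s id (br b) (cop a + tflip s (cop a))" (is "?L = ?R")
  proof (rule tspace_ext)
    fix B :: "'v \<Rightarrow> 'v \<Rightarrow> 'k" assume B: "bilinear_map s s (*) B"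
    have b: "B (x + x') y = B x y + B x' y" "B x (y + y') = B x y + B x y'" "B (s c x) y = c * B x y"
      "B x (s c y) = c * B x y" for x x' y y' c using B by (auto simp: bilinear_map_iff)
    note rs' = rs bilinear_map_iff vs vector_space_mult lin b sum_list_addf sum_list_subtractf uminus_sum_list_map[unfolded comp_def, symmetric] algebra_simps
    have bs: "bilinear_map s s (*) (\<lambda>x y. B (br c x) y)" "bilinear_map s s (*) (\<lambda>x y. B x (br c y))"
      "bilinear_map s s (*) (\<lambda>x y. B (m x c) y)" "bilinear_map s s (*) (\<lambda>x y. B (m c x) y)"
      "bilinear_map s s (*) (\<lambda>x y. B x (star m c y))" for c
      by (simp_all add: bilinear_map_iff vs vector_space_mult lin b)
    note bd = bilinear_map_diff[OF B]
    have i: "cop a + tflip s (cop a) \<in> tspace s" by (intro ins)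
    have 1: "br (m b a) x = m (br b x) a + m b (br a x) - br a (m b x) - m (br b a) x" for x
      using gdD(8)[of b a x] gdD(6)[of a "m b x"] by (simp add: lin_minus algebra_simps)
    have 2: "m x (br a b) = m (br b x) a - m (br a x) b + br a (m x b) - br b (m x a)" for x
      using gdD(8)[of x a b] gdD(6)[of a "m x b"] gdD(6)[of b "m x a"] gdD(6)[of x a] gdD(6)[of x b]
      by (simp add: lin_minus algebra_simps)
    show "?L B = ?R B"
      unfolding tensor_act_def plus_fun_apply[of "tmap _ _ _ _ _"] fun_diff_def
      by (simp add: tmap_eval[OF linear_ops(6,3) i B] cop_eval(3)[OF bs(2)] del: plus_fun_apply)
        (simp add: tmap_eval linear_ops ins cop_eval B bs, 
         simp add: 1 2 bd star_def gdD(6)[of b a] lin_minus rs')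
  qed (unfold tensor_act_def, (intro ins)+)
qed

end

section \<open>The conformal coboundary\<close>

lemma conformal_act_aux:
  fixes s :: "'k::field \<Rightarrow> 'r::ab_group_add \<Rightarrow> 'r"
  assumes br: "bilinear_map s s (poly_scale s) br"
  shows "bilinear_map s s (poly_scale tscale)
    (\<lambda>x y. map_poly (\<lambda>u. tens s u y) (br a x) + map_poly (\<lambda>v. tens s x v) (br a y))"
proof -
  have vs: "vector_space s" using br by (simp add: bilinear_map_iff)
  have tb: "tens s (x + x') y = tens s x y + tens s x' y" "tens s x (y + y') = tens s x y + tens s x y'"
    "tens s (s c x) y = tscale c (tens s x y)" "tens s x (s c y) = tscale c (tens s x y)"
    "tscale c (t + t') = tscale c t + tscale c (t' :: ('r, 'k) tensor2)" for x x' y y' c t t'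
    using bilinear_tens[OF vs] vector_space_simps(1)[OF vector_space_tscale] by (simp_all add: bilinear_map_iff)
  have t0: "tens s 0 y = 0" "tens s x 0 = 0" for x y
    using bilinear_map_diff(1)[OF bilinear_tens[OF vs], of 0 0] bilinear_map_diff(2)[OF bilinear_tens[OF vs], of _ 0 0] by simp_all
  have b: "br a (x + y) = br a x + br a y" "br a (s c x) = poly_scale s c (br a x)" for x y c
    using br by (auto simp: bilinear_map_iff)
  show ?thesis
    by (simp add: bilinear_map_iff vs vector_space_poly_scale vector_space_tscale poly_eq_iff coeff_map_poly t0 tb b
      coeff_poly_scale vector_space_simps(6)[OF vector_space_tscale])
qed

text \<open>The coefficients are actual tensors, which is needed before \<open>\<partial> \<otimes> id + id \<otimes> \<partial>\<close> may be applied to them.\<close>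

lemma conformal_act_coeff:
  assumes br: "bilinear_map s s (poly_scale s) br" and t: "t \<in> tspace s"
  shows "coeff (conformal_act s br a t) n \<in> tspace s"
proof -
  have vs: "vector_space s" using br by (simp add: bilinear_map_iff)
  have t0: "tens s 0 y = 0" "tens s x 0 = 0" for x y
    using bilinear_map_diff(1)[OF bilinear_tens[OF vs], of 0 0] bilinear_map_diff(2)[OF bilinear_tens[OF vs], of _ 0 0] by simp_all
  have "conformal_act s br a t \<in> {P. \<forall>n. coeff P n \<in> tspace s}"
    unfolding conformal_act_def
    by (rule tlift_closed[OF conformal_act_aux[OF br] t])
      (auto simp: tspace_0 coeff_map_poly t0 intro!: tspace_add tens_in)
  then show ?thesis by simp
qed

lemma poly_ev_in:
  assumes "vector_space s" "\<And>n. coeff P n \<in> tspace s"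
  shows "poly_ev tscale l P \<in> tspace s"
  unfolding poly_ev_def
  by (rule poly_subst_closed[OF tspace_0 tspace_add tspace_scale]) (simp_all add: assms)

lemma conformal_act_ev:
  assumes br: "bilinear_map s s (poly_scale s) br" and t: "t \<in> tspace s" and B: "bilinear_map s s (*) B"
  shows "poly_ev tscale l (conformal_act s br a t) B =
    t (\<lambda>x y. B (poly_ev s l (br a x)) y + B x (poly_ev s l (br a y)))"
proof -
  have vs: "vector_space s" using br by (simp add: bilinear_map_iff)
  have l: "Vector_Spaces.linear s tscale (tens s x)" "Vector_Spaces.linear s tscale (\<lambda>u. tens s u y)" for x y
    using bilinear_tens[OF vs] by (auto simp: bilinear_map_def)
  have "Vector_Spaces.linear (poly_scale tscale) (*) (\<lambda>P. poly_ev tscale l P B)"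
    by (simp add: linear_iff vector_space_mult vector_space_poly_scale vector_space_tscale
      poly_ev_simps[OF vector_space_tscale])
  note e = tlift_eval[OF conformal_act_aux[OF br] this t]
  have te: "tens s x y B = B x y" for x y using B by (simp add: tens_def)
  show ?thesis
    unfolding conformal_act_def e
    by (simp add: poly_ev_simps[OF vector_space_tscale] poly_ev_map_poly[OF l(1)] poly_ev_map_poly[OF l(2)] te)
qed

context symplectic_gd
begin

abbreviation "sR \<equiv> poly_scale s"
abbreviation "brR \<equiv> gd_conformal_bracket m br"
abbreviation "emb \<equiv> tmap s sR (\<lambda>x. [:x:]) (\<lambda>x. [:x:])"
abbreviation "G \<equiv> gd_ev s m br"

definition conf_cop :: "'v poly \<Rightarrow> ('v poly, 'k) tensor2" where
  "conf_cop = (\<lambda>a. poly_subst (\<lambda>t. - tensor_D sR var_mult t) id (conformal_act sR brR a (emb r)))"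

lemma vsR: "vector_space sR" by (rule vector_space_poly_scale[OF vs])

lemma conf: "lie_conformal_algebra sR var_mult brR" by (rule lie_conformal_algebra_gd[OF gd])

lemma bilinear_brR: "bilinear_map sR sR (poly_scale sR) brR"
  using conf by (simp add: lie_conformal_algebra_def)

lemma bilinear_G: "bilinear_map s s s (G l d)"
  by (rule bilinear_gd_ev[OF gdD(2,3)])

lemma lin_G:
  "G l d (x + x') y = G l d x y + G l d x' y" "G l d x (y + y') = G l d x y + G l d x y'"
  "G l d (s c x) y = s c (G l d x y)" "G l d x (s c y) = s c (G l d x y)"
  using bilinear_G by (auto simp: bilinear_map_iff)

lemma lin_ev: "poly_ev s x (u + v) = poly_ev s x u + poly_ev s x v" "poly_ev s x (sR c u) = s c (poly_ev s x u)"
  by (simp_all add: poly_ev_simps vs)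

lemma ev_br: "poly_ev s d (poly_ev sR l (brR p q)) = G l d (poly_ev s (- l) p) (poly_ev s (l + d) q)"
  using poly_ev2_bracket[OF gdD(2,3), of l d p q] by (simp add: poly_ev2_def)

lemma emb_in: "t \<in> tspace s \<Longrightarrow> emb t \<in> tspace sR"
  by (intro tmap_in linear_const_poly vs)

lemma emb_eval: "t \<in> tspace s \<Longrightarrow> bilinear_map sR sR (*) B \<Longrightarrow> emb t B = t (\<lambda>x y. B [:x:] [:y:])"
  by (intro tmap_eval linear_const_poly vs)

text \<open>A form on the conformal algebra that evaluates a tensor in \<open>\<partial> \<otimes> id = x\<close>, \<open>id \<otimes> \<partial> = y\<close> and pairs the result
  with the form \<open>C\<close>. On such forms \<open>\<partial> \<otimes> id + id \<otimes> \<partial>\<close> is the scalar \<open>x + y\<close>.\<close>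

definition "ev_form C x y = (\<lambda>u v. C (poly_ev s x u) (poly_ev s y v))"

lemma bilinear_ev_form: "bilinear_map s s (*) C \<Longrightarrow> bilinear_map sR sR (*) (ev_form C x y)"
  by (simp add: bilinear_map_iff ev_form_def lin_ev vsR)

definition "\<Phi>R = {\<lambda>u. \<omega> (poly_ev s x u) p | x p. True}"

lemma separating_\<Phi>R: "separating sR \<Phi>R"
  unfolding separating_def
proof (intro conjI vsR ballI allI impI)
  show "Vector_Spaces.linear sR (*) \<phi>" if "\<phi> \<in> \<Phi>R" for \<phi>
    using that by (auto simp: \<Phi>R_def linear_iff vsR vector_space_mult lin_ev lin)
  fix u assume u: "\<forall>\<phi>\<in>\<Phi>R. \<phi> u = 0"
  have "poly_ev s x u = 0" for x
  proof -
    have "\<omega> (poly_ev s x u) p = 0" for p using u by (auto simp: \<Phi>R_def)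
    then show ?thesis using separating_\<Phi> unfolding separating_def \<Phi>_def by blast
  qed
  then show "u = 0" by (intro poly_ev_eqI[OF vs]) (simp add: poly_ev_simps vs)
qed

lemma tensR_eqI:
  assumes "t \<in> tspace sR" "t' \<in> tspace sR"
    and "\<And>C x y. bilinear_map s s (*) C \<Longrightarrow> t (ev_form C x y) = t' (ev_form C x y)"
  shows "t = t'"
proof (rule tspace_eqI[OF separating_\<Phi>R assms(1,2)])
  fix \<phi> \<psi> assume "\<phi> \<in> \<Phi>R" "\<psi> \<in> \<Phi>R"
  then obtain x p y q where "\<phi> = (\<lambda>u. \<omega> (poly_ev s x u) p)" "\<psi> = (\<lambda>u. \<omega> (poly_ev s y u) q)"
    by (auto simp: \<Phi>R_def)
  then show "t (\<lambda>x y. \<phi> x * \<psi> y) = t' (\<lambda>x y. \<phi> x * \<psi> y)"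
    using assms(3)[OF bilinear_prod[OF linear_ops(8,8)], of p q x y] by (simp add: ev_form_def)
qed

lemma tensor_D_in: "t \<in> tspace sR \<Longrightarrow> tensor_D sR var_mult t \<in> tspace sR"
  unfolding tensor_D_def using linear_var_mult[OF vs]
  by (intro tspace_add tmap_in) (simp_all add: linear_iff)

lemma tensor_D_eval:
  assumes t: "t \<in> tspace sR" and C: "bilinear_map s s (*) C"
  shows "tensor_D sR var_mult t (ev_form C x y) = (x + y) * t (ev_form C x y)"
proof -
  have i: "Vector_Spaces.linear sR sR id" by (simp add: linear_iff vsR)
  note B = bilinear_ev_form[OF C, of x y]
  have "(\<lambda>u v. ev_form C x y (var_mult u) (id v)) = (\<lambda>u v. x * ev_form C x y u v)"
    "(\<lambda>u v. ev_form C x y (id u) (var_mult v)) = (\<lambda>u v. y * ev_form C x y u v)"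
    using C by (simp_all add: ev_form_def poly_ev_simps vs bilinear_map_iff)
  then show ?thesis
    unfolding tensor_D_def plus_fun_apply tmap_eval[OF linear_var_mult[OF vs] i t B]
      tmap_eval[OF i linear_var_mult[OF vs] t B]
    by (simp add: tspace_eval(4)[OF t B] algebra_simps)
qed

text \<open>The substitution \<open>\<lambda> = - (\<partial> \<otimes> id + id \<otimes> \<partial>)\<close> becomes evaluation at \<open>\<lambda> = - x - y\<close>.\<close>

lemma conf_cop_in: "conf_cop a \<in> tspace sR"
  and conf_cop_eval: "bilinear_map s s (*) C \<Longrightarrow> conf_cop a (ev_form C x y) =
    r (\<lambda>u v. C (G (- x - y) x (poly_ev s (x + y) a) u) v + C u (G (- x - y) y (poly_ev s (x + y) a) v))"
proof -
  let ?X = "\<lambda>t. - tensor_D sR var_mult t"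
  let ?P = "conformal_act sR brR a (emb r)"
  note co = conformal_act_coeff[OF bilinear_brR emb_in[OF r_in]]
  have X: "?X t \<in> tspace sR" if "t \<in> tspace sR" for t
    by (intro tspace_minus[OF vsR] tensor_D_in that)
  show "conf_cop a \<in> tspace sR"
    unfolding conf_cop_def by (rule poly_subst_closed[OF tspace_0 tspace_add X]) (simp_all add: co)
  assume C: "bilinear_map s s (*) C"
  have "conf_cop a (ev_form C x y) = id (poly_ev tscale (- x - y) ?P) (ev_form C x y)"
    unfolding conf_cop_def
    by (rule poly_subst_ev[where S = "tspace sR" and E = "\<lambda>t. t (ev_form C x y)" and s' = "(*)"])
      (simp_all add: tspace_0 tspace_add X[simplified] co tensor_D_eval C linear_eval algebra_simps)
  also have "\<dots> = r (\<lambda>u v. C (G (- x - y) x (poly_ev s (x + y) a) u) v + C u (G (- x - y) y (poly_ev s (x + y) a) v))"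
  proof -
    have "bilinear_map sR sR (*) (\<lambda>u v. ev_form C x y (poly_ev sR (- x - y) (brR a u)) v
        + ev_form C x y u (poly_ev sR (- x - y) (brR a v)))"
      using C by (simp add: bilinear_map_iff ev_form_def lin_ev ev_br lin_G vsR algebra_simps)
    then show ?thesis
      unfolding id_apply conformal_act_ev[OF bilinear_brR emb_in[OF r_in] bilinear_ev_form[OF C]]
      by (simp add: emb_eval[OF r_in]) (simp add: ev_form_def ev_br poly_ev_simps vs add.commute)
  qed
  finally show "conf_cop a (ev_form C x y) =
    r (\<lambda>u v. C (G (- x - y) x (poly_ev s (x + y) a) u) v + C u (G (- x - y) y (poly_ev s (x + y) a) v))" .
qed

text \<open>The value at \<open>(x, y)\<close> of the left side is
  \<open>(G (-x - y) x a \<otimes> id + id \<otimes> G (-x - y) y a) r\<close>; sorting it by powers of \<open>x\<close> and \<open>y\<close> gives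
  \<open>\<delta>\<^sub>0(a) + x \<Delta>(a) - y \<tau> \<Delta>(a)\<close>.\<close>

lemma conf_cop_const:
  "conf_cop [:a:] = emb (cobr a) + tmap sR sR var_mult id (emb (cop a)) - tflip sR (tmap sR sR var_mult id (emb (cop a)))"
  (is "_ = ?R")
proof (rule tensR_eqI[OF conf_cop_in])
  have i: "Vector_Spaces.linear sR sR id" by (simp add: linear_iff vsR)
  note V = linear_var_mult[OF vs]
  have Vin: "tmap sR sR var_mult id (emb (cop a)) \<in> tspace sR" by (intro tmap_in V i emb_in cop_in)
  show "?R \<in> tspace sR"
    by (intro tspace_add tspace_diff vsR tflip_in Vin emb_in cobr_in)
  fix C x y assume C: "bilinear_map s s (*) C"
  note B = bilinear_ev_form[OF C]
  have fl: "ev_form (\<lambda>u v. C v u) y x = (\<lambda>u v. ev_form C x y v u)" by (simp add: ev_form_def)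
  have 1: "emb t (ev_form C x y) = t C" if "t \<in> tspace s" "bilinear_map s s (*) C" for t C x y
    using that by (simp add: emb_eval bilinear_ev_form) (simp add: ev_form_def poly_ev_simps vs)
  have 2: "tmap sR sR var_mult id (emb t) (ev_form C x y) = x * t C" if t: "t \<in> tspace s" "bilinear_map s s (*) C" for t C x y
  proof -
    have "(\<lambda>u v. ev_form C x y (var_mult u) (id v)) = (\<lambda>u v. x * ev_form C x y u v)"
      using t by (simp add: ev_form_def poly_ev_simps vs bilinear_map_iff)
    then show ?thesis
      using t by (simp add: tmap_eval[OF V i emb_in] bilinear_ev_form 1 tspace_eval(4)[OF emb_in bilinear_ev_form])
  qed
  have 3: "tflip sR (tmap sR sR var_mult id (emb (cop a))) (ev_form C x y) = y * tflip s (cop a) C"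
    unfolding tflip_eval[OF Vin B] fl[symmetric] 2[OF cop_in bilinear_map_flip[OF C]] tflip_eval[OF cop_in C] ..
  obtain rs where rs: "\<And>B. bilinear_map s s (*) B \<Longrightarrow> r B = (\<Sum>z\<leftarrow>rs. B (fst z) (snd z))"
    by (rule r_as_sum) blast
  have b: "C (x + x') y = C x y + C x' y" "C x (y + y') = C x y + C x y'" "C (s c x) y = c * C x y"
      "C x (s c y) = c * C x y" for x x' y y' c using C by (auto simp: bilinear_map_iff)
  show "conf_cop [:a:] (ev_form C x y) = ?R (ev_form C x y)"
    by (simp add: 1[OF cobr_in C] 2[OF cop_in C] 3 cop_eval[OF C] conf_cop_eval[OF C])
      (simp add: rs bilinear_map_iff vs vector_space_mult lin lin_G b poly_ev_simps gd_ev_def star_def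
        sum_list_addf sum_list_subtractf uminus_sum_list_map[unfolded comp_def, symmetric] sum_list_const_mult algebra_simps)
qed

text \<open>The conformal analogue of \<open>cop_dual\<close> and \<open>cobr_dual\<close>: the coproduct is dual to the negative of the conformal
  bracket at \<open>\<lambda> = x\<close>, \<open>\<partial> = - x - y\<close>.\<close>

lemma conf_cop_dual:
  "conf_cop a (\<lambda>u v. \<omega> (poly_ev s x u) p * \<omega> (poly_ev s y v) q) = \<omega> (poly_ev s (x + y) a) (- G x (- x - y) p q)"
proof -
  let ?c = "poly_ev s (x + y) a"
  have b: "bilinear_map s s (*) (\<lambda>u v. \<omega> (G (- x - y) x ?c u) p * \<omega> v q)"
    "bilinear_map s s (*) (\<lambda>u v. \<omega> u p * \<omega> (G (- x - y) y ?c v) q)"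
    by (simp_all add: bilinear_map_iff lin lin_G vs vector_space_mult algebra_simps)
  have 1: "r (\<lambda>u v. \<omega> (G (- x - y) x ?c u) p * \<omega> v q) = \<omega> (G (- x - y) x ?c q) p"
    by (rule r_contract_eq(1)) (simp_all add: linear_iff vs vector_space_mult lin lin_G)
  have 2: "r (\<lambda>u v. \<omega> u p * \<omega> (G (- x - y) y ?c v) q) = - \<omega> (G (- x - y) y ?c p) q"
    by (rule r_contract_eq(2)) (simp_all add: linear_iff vs vector_space_mult lin lin_G)
  have "conf_cop a (\<lambda>u v. \<omega> (poly_ev s x u) p * \<omega> (poly_ev s y v) q) =
      \<omega> (G (- x - y) x ?c q) p - \<omega> (G (- x - y) y ?c p) q"
    using conf_cop_eval[OF bilinear_prod[OF linear_ops(8,8)], of a p q x y]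
    unfolding ev_form_def tspace_eval(1)[OF r_in b] 1 2 by simp
  also have "\<dots> = \<omega> ?c (- G x (- x - y) p q)"
    using \<omega>_br[of ?c q p] \<omega>_skew[of "br q p" ?c] gdD(6)[of p q] gdD(6)[of p ?c]
    by (simp add: gd_ev_def star_def lin lin_minus bilinear_map_diff[OF bilinear_\<omega>] vs_simps \<omega>_m[of ?c p q] \<omega>_m[of ?c q p] algebra_simps)
  finally show ?thesis .
qed

lemma coproduct_conf: "coproduct sR conf_cop"
proof (rule coproductI[OF separating_\<Phi>R conf_cop_in])
  fix \<phi> \<psi> assume "\<phi> \<in> \<Phi>R" "\<psi> \<in> \<Phi>R"
  then obtain x p y q where "\<phi> = (\<lambda>u. \<omega> (poly_ev s x u) p)" "\<psi> = (\<lambda>u. \<omega> (poly_ev s y u) q)"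
    by (auto simp: \<Phi>R_def)
  then show "Vector_Spaces.linear sR (*) (\<lambda>a. conf_cop a (\<lambda>x y. \<phi> x * \<psi> y))"
    by (simp add: conf_cop_dual linear_iff vsR vector_space_mult lin_ev lin)
qed

text \<open>The index set of the functionals is now the set of pairs \<open>(x, p)\<close>, with \<open>x\<close> the value of \<open>\<partial>\<close>. The operation
  \<open>g\<close> satisfies the Jacobi identity, by \<open>gd_ev_jacobi\<close> with \<open>\<lambda> = x\<close>, \<open>\<mu> = y\<close>, \<open>\<partial> = - x - y - z\<close>.\<close>

lemma conf_cop_coJacobi:
  "id_tens sR conf_cop (conf_cop a) - tflip_id sR (id_tens sR conf_cop (conf_cop a)) = tens_id sR conf_cop (conf_cop a)"
  (is "?L = ?R")
proof (rule tspace3_eqI[OF separating_\<Phi>R])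
  define P where "P = (\<lambda>(x, p) u. \<omega> (poly_ev s x u) p)"
  define g where "g = (\<lambda>(x, p) (y, q). (x + y, - G x (- x - y) p q))"
  have P: "Vector_Spaces.linear sR (*) (P z)" for z
    by (auto simp: P_def linear_iff vsR vector_space_mult lin_ev lin split: prod.split)
  have dual: "conf_cop a (\<lambda>x y. P z x * P z' y) = P (g z z') a" for a z z'
    by (auto simp: P_def g_def conf_cop_dual split: prod.split)
  note d = dual_coproduct[where P = P, OF coproduct_conf conf_cop_in P dual]
  show "?L \<in> tspace3 sR" "?R \<in> tspace3 sR"
    by (intro tspace3_diff vsR tflip_id_in id_tens_in coproduct_conf conf_cop_in)+
  fix \<phi> \<psi> \<chi> assume "\<phi> \<in> \<Phi>R" "\<psi> \<in> \<Phi>R" "\<chi> \<in> \<Phi>R"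
  then obtain x p y q z w where \<phi>: "\<phi> = P (x, p)" "\<psi> = P (y, q)" "\<chi> = P (z, w)"
    by (fastforce simp: \<Phi>R_def P_def)
  \<comment> \<open>the two normal forms in which the parameter \<open>\<partial>\<close> appears\<close>
  have eq: "- y - (x + z) = - x - (y + z)" by simp
  have "?L (\<lambda>u v t. P (x, p) u * P (y, q) v * P (z, w) t) = ?R (\<lambda>u v t. P (x, p) u * P (y, q) v * P (z, w) t)"
    unfolding fun_diff_def d dual
    using gd_ev_jacobi[OF gd, of x "- x - y - z" p y q w]
    by (simp add: P_def g_def bilinear_map_diff[OF bilinear_G] lin lin_minus eq algebra_simps)
  then show "?L (\<lambda>x y z. \<phi> x * \<psi> y * \<chi> z) = ?R (\<lambda>x y z. \<phi> x * \<psi> y * \<chi> z)" by (simp add: \<phi>)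
qed

text \<open>The action of \<open>a\<^sub>\<lambda>\<close> on one factor shifts the value of \<open>\<partial>\<close> on that factor by \<open>\<lambda>\<close>.\<close>

lemma conf_act_ev_form:
  assumes t: "t \<in> tspace sR" and C: "bilinear_map s s (*) C"
  shows "poly_ev tscale l (conformal_act sR brR a t) (ev_form C x y) =
    t (ev_form (\<lambda>u v. C (G l x (poly_ev s (- l) a) u) v) (l + x) y) +
    t (ev_form (\<lambda>u v. C u (G l y (poly_ev s (- l) a) v)) x (l + y))"
proof -
  have b: "bilinear_map s s (*) (\<lambda>u v. C (G l x (poly_ev s (- l) a) u) v)"
      "bilinear_map s s (*) (\<lambda>u v. C u (G l y (poly_ev s (- l) a) v))"
    using C by (simp_all add: bilinear_map_iff lin_G)
  have "poly_ev tscale l (conformal_act sR brR a t) (ev_form C x y) =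
    t (\<lambda>u v. ev_form (\<lambda>u v. C (G l x (poly_ev s (- l) a) u) v) (l + x) y u v +
       ev_form (\<lambda>u v. C u (G l y (poly_ev s (- l) a) v)) x (l + y) u v)"
    unfolding conformal_act_ev[OF bilinear_brR t bilinear_ev_form[OF C]] by (simp add: ev_form_def ev_br)
  also note tspace_eval(1)[OF t bilinear_ev_form[OF b(1)] bilinear_ev_form[OF b(2)]]
  finally show ?thesis .
qed

text \<open>At \<open>\<lambda> = l\<close> and \<open>(x, y)\<close> put \<open>k = - l - x - y\<close>, \<open>c = a(- l)\<close> and \<open>e = b(- k)\<close>. Then
  \<open>a\<^sub>\<lambda> \<delta>(b)\<close> and \<open>b\<^sub>-\<^sub>\<lambda>\<^sub>-\<^sub>\<partial> \<delta>(a)\<close> are interchanged by swapping \<open>(l, c)\<close> and \<open>(k, e)\<close>. In their difference the terms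
  with an operator on each factor cancel, and on a single factor it is a commutator of two operators \<open>G\<close>, which
  \<open>gd_ev_jacobi\<close> identifies with the operator of \<open>[a\<^sub>\<lambda> b]\<close>.\<close>

lemma conf_cocycle:
  "conformal_act sR brR a (conf_cop b)
    - poly_subst (\<lambda>p. - var_mult p - map_poly (tensor_D sR var_mult) p) (\<lambda>t. [:t:]) (conformal_act sR brR b (conf_cop a))
    = map_poly conf_cop (brR a b)" (is "?A - poly_subst ?X ?F ?P = ?R")
proof (rule poly_ev_eqI[OF vector_space_tscale])
  fix l :: 'k
  let ?S = "{Q. \<forall>n. coeff Q n \<in> tspace sR}"
  note co = conformal_act_coeff[OF bilinear_brR conf_cop_in]
  have D0: "tensor_D sR var_mult 0 = 0"
    by (rule tensR_eqI[OF tensor_D_in tspace_0]) (simp_all add: tensor_D_eval tspace_0)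
  have lin_cop: "Vector_Spaces.linear sR tscale conf_cop" using coproduct_conf by (simp add: coproduct_def)
  have X: "?X Q \<in> ?S" if "Q \<in> ?S" for Q
    using that D0 by (auto simp: coeff_pCons coeff_map_poly split: nat.split
      intro!: tspace_diff[OF vsR] tspace_minus[OF vsR] tspace_0 tensor_D_in)
  have F: "?F (coeff ?P n) \<in> ?S" for n using co by (auto simp: coeff_pCons tspace_0 split: nat.split)
  have XP: "poly_subst ?X ?F ?P \<in> ?S"
    by (rule poly_subst_closed[where F = ?F and p = ?P and X = ?X, OF _ _ X F]) (simp_all add: tspace_0 tspace_add)
  show "poly_ev tscale l (?A - poly_subst ?X ?F ?P) = poly_ev tscale l ?R"
    unfolding poly_ev_simps(4)[OF vector_space_tscale] poly_ev_map_poly[OF lin_cop]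
  proof (rule tensR_eqI)
    show "poly_ev tscale l ?A - poly_ev tscale l (poly_subst ?X ?F ?P) \<in> tspace sR"
      using XP by (intro tspace_diff vsR poly_ev_in co) auto
    show "conf_cop (poly_ev sR l (brR a b)) \<in> tspace sR" by (rule conf_cop_in)
    fix C x y assume C: "bilinear_map s s (*) C"
    let ?E = "\<lambda>Q. poly_ev tscale l Q (ev_form C x y)"
    have EX: "?E (?X Q) = (- l - x - y) * ?E Q" if Q: "Q \<in> ?S" for Q
    proof -
      have "?E (map_poly (tensor_D sR var_mult) Q) =
          (\<Sum>n\<le>degree Q. l ^ n * tensor_D sR var_mult (coeff Q n) (ev_form C x y))"
        unfolding poly_ev_sum[OF vector_space_tscale map_poly_degree_leq] linear_sum[OF linear_eval]
        by (simp add: coeff_map_poly D0)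
      also have "\<dots> = (x + y) * ?E Q"
        unfolding poly_ev_sum[OF vector_space_tscale order.refl] linear_sum[OF linear_eval] sum_distrib_left
        using Q by (simp add: tensor_D_eval C mult.left_commute)
      finally show ?thesis by (simp add: poly_ev_simps[OF vector_space_tscale] algebra_simps)
    qed
    have "?E (poly_subst ?X ?F ?P) = ?E [:poly_ev tscale (- l - x - y) ?P:]"
      by (rule poly_subst_ev[where E = ?E and S = ?S and X = ?X and F = ?F and p = ?P and s' = "(*)" and s = tscale, OF _ _ X F _ _ EX])
        (auto simp: tspace_0 tspace_add poly_ev_simps[OF vector_space_tscale] linear_eval)
    then have P: "?E (poly_subst ?X ?F ?P) = poly_ev tscale (- l - x - y) ?P (ev_form C x y)"
      by (simp add: poly_ev_simps[OF vector_space_tscale])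
    obtain rs where rs: "\<And>B. bilinear_map s s (*) B \<Longrightarrow> r B = (\<Sum>z\<leftarrow>rs. B (fst z) (snd z))"
      by (rule r_as_sum) blast
    have Cl: "C (x + x') y = C x y + C x' y" "C x (y + y') = C x y + C x y'" "C (s c x) y = c * C x y"
      "C x (s c y) = c * C x y" for x x' y y' c using C by (auto simp: bilinear_map_iff)
    have bs: "bilinear_map s s (*) (\<lambda>u v. C (G l x c u) v)" "bilinear_map s s (*) (\<lambda>u v. C u (G l x c v))" for l x c
      by (simp_all add: bilinear_map_iff vs vector_space_mult Cl lin_G)
    define c where "c = poly_ev s (- l) a"
    define k where "k = - l - x - y"
    define e where "e = poly_ev s (- k) b"
    have j: "G (- x - y) z (G l (x + y) c e) u = G l z c (G k (l + z) e u) - G k z e (G l (k + z) c u)" for z u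
      using gd_ev_jacobi[OF gd, of l z c k e u] by (simp add: k_def algebra_simps)
    have ar: "- (l + x) - y = k" "- x - (l + y) = k" "l + x + y = - k" "x + (l + y) = - k"
      "- (k + x) - y = l" "- x - (k + y) = l" "k + x + y = - l" "x + (k + y) = - l" "l + (x + y) = - k"
      by (simp_all add: k_def)
    show "(poly_ev tscale l ?A - poly_ev tscale l (poly_subst ?X ?F ?P)) (ev_form C x y) =
        conf_cop (poly_ev sR l (brR a b)) (ev_form C x y)"
      unfolding fun_diff_def P conf_act_ev_form[OF conf_cop_in C] conf_cop_eval[OF C] ev_br
        conf_cop_eval[OF bs(1)] conf_cop_eval[OF bs(2)] k_def[symmetric] ar
        c_def[symmetric]
      by (simp add: ar c_def[symmetric] e_def[symmetric])
         (simp add: rs bilinear_map_iff vs vector_space_mult lin_G Cl j bilinear_map_diff[OF C]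
          sum_list_addf sum_list_subtractf algebra_simps)
  qed
qed

text \<open>The remaining axioms, compatibility with \<open>\<partial>\<close> and skew symmetry, are read off from \<open>conf_cop_dual\<close>.\<close>

lemma conformal_bialgebra: "lie_conformal_bialgebra sR var_mult brR conf_cop"
  unfolding lie_conformal_bialgebra_def
proof (intro conjI allI conf coproduct_conf conf_cop_coJacobi conf_cocycle)
  fix a
  obtain rs where rs: "\<And>B. bilinear_map s s (*) B \<Longrightarrow> r B = (\<Sum>z\<leftarrow>rs. B (fst z) (snd z))"
    by (rule r_as_sum) blast
  show "conf_cop (var_mult a) = tensor_D sR var_mult (conf_cop a)"
  proof (rule tspace_eqI[OF separating_\<Phi>R conf_cop_in tensor_D_in[OF conf_cop_in]])
    fix \<phi> \<psi> assume "\<phi> \<in> \<Phi>R" "\<psi> \<in> \<Phi>R"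
    then obtain x p y q where \<phi>: "\<phi> = (\<lambda>u. \<omega> (poly_ev s x u) p)" "\<psi> = (\<lambda>u. \<omega> (poly_ev s y u) q)"
      by (auto simp: \<Phi>R_def)
    show "conf_cop (var_mult a) (\<lambda>x y. \<phi> x * \<psi> y) = tensor_D sR var_mult (conf_cop a) (\<lambda>x y. \<phi> x * \<psi> y)"
      using tensor_D_eval[OF conf_cop_in bilinear_prod[OF linear_ops(8,8)], of a p q x y]
      unfolding \<phi> conf_cop_dual ev_form_def by (simp add: poly_ev_simps vs lin)
  qed
  show "conf_cop a = - tflip sR (conf_cop a)"
  proof (rule tspace_eqI[OF separating_\<Phi>R conf_cop_in tspace_minus[OF vsR tflip_in[OF vsR conf_cop_in]]])
    fix \<phi> \<psi> assume "\<phi> \<in> \<Phi>R" "\<psi> \<in> \<Phi>R"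
    then obtain x p y q where \<phi>: "\<phi> = (\<lambda>u. \<omega> (poly_ev s x u) p)" "\<psi> = (\<lambda>u. \<omega> (poly_ev s y u) q)"
      by (auto simp: \<Phi>R_def)
    have b: "bilinear_map sR sR (*) (\<lambda>u v. \<omega> (poly_ev s x u) p * \<omega> (poly_ev s y v) q)"
      by (simp add: bilinear_map_iff vsR vector_space_mult lin_ev lin algebra_simps)
    have eq: "- (y + x) = - x - y" "y + x = x + y" "- y - x = - x - y" by simp_all
    have "tflip sR (conf_cop a) (\<lambda>u v. \<omega> (poly_ev s x u) p * \<omega> (poly_ev s y v) q)
        = conf_cop a (\<lambda>u v. \<omega> (poly_ev s y u) q * \<omega> (poly_ev s x v) p)"
      unfolding tflip_eval[OF conf_cop_in b] by (simp add: mult.commute)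
    then have "tflip sR (conf_cop a) (\<lambda>u v. \<omega> (poly_ev s x u) p * \<omega> (poly_ev s y v) q)
        = \<omega> (poly_ev s (x + y) a) (- G y (- x - y) q p)"
      unfolding conf_cop_dual eq .
    then show "conf_cop a (\<lambda>x y. \<phi> x * \<psi> y) = (- tflip sR (conf_cop a)) (\<lambda>x y. \<phi> x * \<psi> y)"
      unfolding \<phi> conf_cop_dual using gd_ev_skew[OF gd, of x "- x - y" p q]
      by (simp add: lin_minus algebra_simps)
  qed
qed

end

section \<open>The double of a pre-Gel'fand-Dorfman algebra\<close>

lemma is_dual_spaceD:
  fixes pair :: "'d::ab_group_add \<Rightarrow> 'a::ab_group_add \<Rightarrow> 'k::field"
  assumes "is_dual_space s sd pair"
  shows "vector_space s" "vector_space sd" "bilinear_map sd s (*) pair"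
    and "(\<And>u. pair f u = pair g u) \<Longrightarrow> f = g"
    and "Vector_Spaces.linear s (*) \<phi> \<Longrightarrow> \<exists>f. pair f = \<phi>"
proof -
  show b: "bilinear_map sd s (*) pair" using assms by (simp add: is_dual_space_def)
  then show "vector_space s" "vector_space sd" by (simp_all add: bilinear_map_iff)
  have bij: "bij_betw pair UNIV {f. Vector_Spaces.linear s (*) f}"
    using assms by (simp add: is_dual_space_def)
  show "f = g" if "\<And>u. pair f u = pair g u"
    using that bij by (auto simp: bij_betw_def inj_def fun_eq_iff)
  show "\<exists>f. pair f = \<phi>" if "Vector_Spaces.linear s (*) \<phi>"
    using that bij unfolding bij_betw_def by (metis (mono_tags) imageE mem_Collect_eq)
qed

lemma pair_dual_act:
  fixes pair :: "'d::ab_group_add \<Rightarrow> 'a::ab_group_add \<Rightarrow> 'k::field"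
  assumes dual: "is_dual_space s sd pair" and \<phi>: "Vector_Spaces.linear s s (\<phi> a)"
  shows "pair (dual_act pair \<phi> a f) u = - pair f (\<phi> a u)"
proof -
  note D = is_dual_spaceD[OF dual]
  have "Vector_Spaces.linear s (*) (\<lambda>u. - pair f (\<phi> a u))"
    using \<phi> D(3) by (simp add: linear_iff bilinear_map_iff)
  from D(5)[OF this] obtain g where g: "\<And>u. pair g u = - pair f (\<phi> a u)" by (auto simp: fun_eq_iff)
  have "\<forall>u. pair (dual_act pair \<phi> a f) u = - pair f (\<phi> a u)"
    unfolding dual_act_def by (rule theI[of _ g]) (auto simp: g intro: D(4))
  then show ?thesis by simp
qed

locale pre_gd_dual =
  fixes s :: "'k::field_char_0 \<Rightarrow> 'a::ab_group_add \<Rightarrow> 'a" and sd :: "'k \<Rightarrow> 'd::ab_group_add \<Rightarrow> 'd"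
    and pair :: "'d \<Rightarrow> 'a \<Rightarrow> 'k" and lhd rhd dia :: "'a \<Rightarrow> 'a \<Rightarrow> 'a"
  assumes pre_gd: "pre_gd_algebra s lhd rhd dia"
    and dual: "is_dual_space s sd pair"
begin

lemmas dualD = is_dual_spaceD[OF dual]

abbreviation "sH \<equiv> prod_scale s sd"
abbreviation "mH \<equiv> hat_mult pair lhd rhd"
abbreviation "bH \<equiv> hat_bracket pair dia"

lemma bilinear_ops:
  "bilinear_map s s s lhd" "bilinear_map s s s rhd" "bilinear_map s s s dia"
  using pre_gd by (auto simp: pre_gd_algebra_def pre_novikov_algebra_def left_symmetric_algebra_def)

lemma ops_linear:
  "lhd (x + x') y = lhd x y + lhd x' y" "lhd x (y + y') = lhd x y + lhd x y'"
  "rhd (x + x') y = rhd x y + rhd x' y" "rhd x (y + y') = rhd x y + rhd x y'"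
  "dia (x + x') y = dia x y + dia x' y" "dia x (y + y') = dia x y + dia x y'"
  "pair (f + f') y = pair f y + pair f' y" "pair f (y + y') = pair f y + pair f y'"
  "lhd (s c x) y = s c (lhd x y)" "lhd x (s c y) = s c (lhd x y)"
  "rhd (s c x) y = s c (rhd x y)" "rhd x (s c y) = s c (rhd x y)"
  "dia (s c x) y = s c (dia x y)" "dia x (s c y) = s c (dia x y)"
  "pair (sd c f) y = c * pair f y" "pair f (s c y) = c * pair f y"
  using bilinear_ops dualD(3) by (simp_all add: bilinear_map_iff)

lemma pair_0: "pair 0 x = 0" "pair f 0 = 0"
  using bilinear_map_diff(1)[OF dualD(3), of 0 0 x] bilinear_map_diff(2)[OF dualD(3), of f 0 0] by simp_all

lemmas ops_diff = bilinear_map_diff[OF bilinear_ops(1)] bilinear_map_diff[OF bilinear_ops(2)]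
  bilinear_map_diff[OF bilinear_ops(3)] bilinear_map_diff[OF dualD(3)] pair_0

text \<open>The axioms are oriented as rewrite rules that move \<open>\<rhd>\<close> inside \<open>\<lhd>\<close>. The rules \<open>pre_novikov_rhd\<close>, \<open>pre_gd_lhd\<close> and
  \<open>left_symmetric_dia\<close> below exchange two of their arguments and are used only at specific arguments.\<close>

lemma pre_novikov:
  "rhd (lhd a b) c = lhd (rhd a c) b - rhd (rhd a b) c"
  "rhd a (lhd b c) = lhd (rhd a b) c + lhd b (lhd a c) + lhd b (rhd a c) - lhd (lhd b a) c"
  "lhd (lhd a b) c = lhd (lhd a c) b"
  using pre_gd by (simp_all add: pre_gd_algebra_def pre_novikov_algebra_def ops_linear algebra_simps)

lemma pre_novikov_rhd: "rhd a (rhd b c) = rhd b (rhd a c) + lhd (rhd a c) b - lhd (rhd b c) a"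
proof -
  have "rhd a (rhd b c) = rhd (rhd a b + lhd a b) c + rhd b (rhd a c) - rhd (rhd b a + lhd b a) c"
    using pre_gd unfolding pre_gd_algebra_def pre_novikov_algebra_def by blast
  then show ?thesis by (simp add: ops_linear pre_novikov(1))
qed

lemma pre_gd_rhd:
  "rhd a (dia b c) = rhd (dia a b) c - rhd (dia b a) c + dia (lhd a b) c + dia (rhd a b) c
     + dia b (rhd a c) - lhd (dia a c) b"
proof -
  have "rhd (dia a b - dia b a) c + dia (lhd a b + rhd a b) c = rhd a (dia b c) - dia b (rhd a c) + lhd (dia a c) b"
    using pre_gd unfolding pre_gd_algebra_def by blast
  then show ?thesis by (simp add: ops_linear ops_diff algebra_simps)
qed

lemma pre_gd_lhd:
  "lhd c (dia a b) = lhd c (dia b a) + dia a (lhd c b) + lhd (dia b c) a - dia b (lhd c a) - lhd (dia a c) b"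
proof -
  have "lhd c (dia a b - dia b a) - dia a (lhd c b) - lhd (dia b c) a = - dia b (lhd c a) - lhd (dia a c) b"
    using pre_gd unfolding pre_gd_algebra_def by blast
  then show ?thesis by (simp add: ops_linear ops_diff algebra_simps)
qed

lemma left_symmetric_dia: "dia a (dia b c) = dia b (dia a c) + dia (dia a b) c - dia (dia b a) c"
  using pre_gd by (simp add: pre_gd_algebra_def left_symmetric_algebra_def algebra_simps)

lemma hat_mult_fst: "fst (mH x y) = lhd (fst x) (fst y) + rhd (fst x) (fst y)"
  by (simp add: hat_mult_def semidirect_mult_def case_prod_unfold)

lemma hat_bracket_fst: "fst (bH x y) = dia (fst x) (fst y) - dia (fst y) (fst x)"
  by (simp add: hat_bracket_def semidirect_bracket_def case_prod_unfold)

lemma hat_mult_snd: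
  "pair (snd (mH x y)) u = - pair (snd y) (rhd (fst x) u) - pair (snd y) (lhd u (fst x)) + pair (snd x) (lhd u (fst y))"
  using bilinear_ops
  by (simp add: hat_mult_def semidirect_mult_def case_prod_unfold ops_linear ops_diff bilinear_map_def
      pair_dual_act[OF dual])

lemma hat_bracket_snd:
  "pair (snd (bH x y)) u = - pair (snd y) (dia (fst x) u) + pair (snd x) (dia (fst y) u)"
  using bilinear_ops
  by (simp add: hat_bracket_def semidirect_bracket_def case_prod_unfold ops_linear ops_diff bilinear_map_def
      pair_dual_act[OF dual])

lemma hat_eqI: "fst x = fst y \<Longrightarrow> (\<And>u. pair (snd x) u = pair (snd y) u) \<Longrightarrow> x = y"
  using dualD(4) by (metis prod_eqI)

lemmas hat_simps = hat_mult_fst hat_mult_snd hat_bracket_fst hat_bracket_snd ops_linear ops_diff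

lemma vector_space_hat: "vector_space sH"
  using dualD(1,2) by unfold_locales (auto simp: prod_scale_def vector_space_simps)

lemma prod_scale_sel: "fst (sH c x) = s c (fst x)" "snd (sH c x) = sd c (snd x)"
  by (simp_all add: prod_scale_def case_prod_unfold)

text \<open>The \<open>A\<close>-component of an identity in \<open>A \<oplus> A\<^sup>*\<close> is the same identity in \<open>A\<close>. Its \<open>A\<^sup>*\<close>-component, paired with
  \<open>u \<in> A\<close>, is linear in the functionals among the arguments and says that certain words in \<open>u\<close> and two of the
  arguments agree in \<open>A\<close>; these are identities for the pre-algebra.\<close>

lemma gd_algebra_hat: "gd_algebra sH mH bH"
  unfolding gd_algebra_def novikov_algebra_def left_symmetric_algebra_def lie_algebra_def
proof (intro conjI allI)
  show "bilinear_map sH sH sH mH" "bilinear_map sH sH sH bH"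
    unfolding bilinear_map_iff
    by (intro conjI allI vector_space_hat hat_eqI;
      simp add: hat_simps prod_scale_sel vector_space_simps[OF dualD(1)] algebra_simps)+
  fix x y z :: "'a \<times> 'd"
  obtain a f b g c h where xyz: "x = (a, f)" "y = (b, g)" "z = (c, h)" by (metis surj_pair)
  note N = hat_simps xyz pre_novikov
  show "bH x x = 0"
    by (rule hat_eqI) (simp_all add: hat_simps)
  show "mH (mH x y) z = mH (mH x z) y"
    by (rule hat_eqI) (simp_all add: N pre_novikov_rhd[of a b] algebra_simps)
  show "mH (mH x y) z - mH x (mH y z) = mH (mH y x) z - mH y (mH x z)"
  proof (rule hat_eqI)
    show "fst (mH (mH x y) z - mH x (mH y z)) = fst (mH (mH y x) z - mH y (mH x z))"
      by (simp add: N pre_novikov_rhd[of a b c] algebra_simps)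
    fix u
    show "pair (snd (mH (mH x y) z - mH x (mH y z))) u = pair (snd (mH (mH y x) z - mH y (mH x z))) u"
      by (simp add: N pre_novikov_rhd[of a b u] algebra_simps)
  qed
  show "bH x (bH y z) + bH y (bH z x) + bH z (bH x y) = 0"
  proof (rule hat_eqI)
    show "fst (bH x (bH y z) + bH y (bH z x) + bH z (bH x y)) = fst 0"
      by (simp add: hat_simps xyz left_symmetric_dia[of a b c] left_symmetric_dia[of a c b] left_symmetric_dia[of b c a] algebra_simps)
    fix u
    show "pair (snd (bH x (bH y z) + bH y (bH z x) + bH z (bH x y))) u = pair (snd 0) u"
      by (simp add: hat_simps xyz left_symmetric_dia[of a b u] left_symmetric_dia[of a c u] left_symmetric_dia[of b c u] algebra_simps)
  qed
  show "bH (mH x y) z - bH (mH x z) y + mH (bH x y) z - mH (bH x z) y - mH x (bH y z) = 0"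
  proof (rule hat_eqI)
    show "fst (bH (mH x y) z - bH (mH x z) y + mH (bH x y) z - mH (bH x z) y - mH x (bH y z)) = fst 0"
      by (simp add: N pre_gd_rhd pre_gd_lhd[of a b c] algebra_simps)
    fix u
    show "pair (snd (bH (mH x y) z - bH (mH x z) y + mH (bH x y) z - mH (bH x z) y - mH x (bH y z))) u = pair (snd 0) u"
      by (simp add: N pre_gd_rhd pre_gd_lhd[of u b c] pre_gd_lhd[of u a c] pre_gd_lhd[of u a b] algebra_simps)
  qed
qed

definition \<omega> :: "'a \<times> 'd \<Rightarrow> 'a \<times> 'd \<Rightarrow> 'k" where
  "\<omega> x y = pair (snd x) (fst y) - pair (snd y) (fst x)"

text \<open>The contraction property of \<open>r\<close> is the pair of expansions \<open>b = \<Sum> e'\<^sub>i(b) e\<^sub>i\<close> and \<open>g = \<Sum> g(e\<^sub>i) e'\<^sub>i\<close>.\<close>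

lemma symplectic_gd_hat:
  fixes n :: nat and e :: "nat \<Rightarrow> 'a" and e' :: "nat \<Rightarrow> 'd"
  assumes span: "module.span s (e ` {1..n}) = UNIV"
    and dual_basis: "\<And>i j. i \<in> {1..n} \<Longrightarrow> j \<in> {1..n} \<Longrightarrow> pair (e' i) (e j) = (if i = j then 1 else 0)"
  shows "symplectic_gd sH mH bH \<omega> (\<Sum>i=1..n. tens sH (e i, 0) (0, e' i) - tens sH (0, e' i) (e i, 0))"
    (is "symplectic_gd _ _ _ _ ?r")
proof
  show gd: "gd_algebra sH mH bH" by (rule gd_algebra_hat)
  show bil: "bilinear_map sH sH (*) \<omega>"
    by (simp add: bilinear_map_iff vector_space_hat vector_space_mult \<omega>_def prod_scale_sel ops_linear algebra_simps)
  show "\<omega> x y = - \<omega> y x" for x y by (simp add: \<omega>_def)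
  show "\<omega> (bH x y) z + \<omega> (bH y z) x + \<omega> (bH z x) y = 0" for x y z
    by (simp add: \<omega>_def hat_simps)
  show "\<omega> x (mH y z) = \<omega> (mH x z) y - \<omega> (mH x y) z - \<omega> (mH y x) z" for x y z
    by (simp add: \<omega>_def hat_simps)
  show "?r \<in> tspace sH"
  proof -
    have "sum g A \<in> tspace sH" if "finite A" "\<And>i. g i \<in> tspace sH" for g :: "nat \<Rightarrow> _" and A
      using that by induction (simp_all add: tspace_0 tspace_add)
    from this[of "{1..n}"] show ?thesis by (simp add: tspace_diff[OF vector_space_hat] tens_in)
  qed
  fix \<phi> and u :: "'a \<times> 'd"
  assume \<phi>: "Vector_Spaces.linear sH (*) \<phi>"
  interpret vector_space s by (rule dualD(1))
  obtain b g where u: "u = (b, g)" by (cases u)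
  have lin: "Vector_Spaces.linear s s (\<lambda>b. \<Sum>i=1..n. s (pair (e' i) b) (e i))"
    by (simp add: linear_iff dualD(1) ops_linear vector_space_simps sum.distrib scale_sum_right scale_left_distrib)
  have exp: "(\<Sum>i=1..n. s (pair (e' i) b) (e i)) = b" for b
  proof -
    let ?S = "{b. (\<Sum>i=1..n. s (pair (e' i) b) (e i)) = b}"
    have "subspace ?S"
      using lin linear_0[OF lin] by (simp add: subspace_def linear_iff)
    moreover have "e ` {1..n} \<subseteq> ?S"
    proof clarify
      fix j assume j: "j \<in> {1..n}"
      have "(\<Sum>i=1..n. s (pair (e' i) (e j)) (e i)) = (\<Sum>i=1..n. if i = j then e i else 0)"
        using dual_basis[OF _ j] by (intro sum.cong refl) auto
      also have "\<dots> = e j" using j by simp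
      finally show "(\<Sum>i=1..n. s (pair (e' i) (e j)) (e i)) = e j" .
    qed
    ultimately have "UNIV \<subseteq> ?S" unfolding assms(1)[symmetric] by (intro span_minimal)
    then show ?thesis by auto
  qed
  have exp': "(\<Sum>i=1..n. sd (pair g (e i)) (e' i)) = g"
  proof (rule dualD(4))
    fix u
    have "pair g u = pair g (\<Sum>i=1..n. s (pair (e' i) u) (e i))" by (simp only: exp)
    also have "\<dots> = (\<Sum>i=1..n. pair (e' i) u * pair g (e i))"
    proof -
      have "Vector_Spaces.linear s (*) (pair g)" using dualD(3) by (simp add: bilinear_map_def)
      from linear_sum[OF this, of "\<lambda>i. s (pair (e' i) u) (e i)" "{1..n}"] show ?thesis
        by (simp add: ops_linear)
    qed
    finally have 1: "pair g u = (\<Sum>i=1..n. pair (e' i) u * pair g (e i))" .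
    have "Vector_Spaces.linear sd (*) (\<lambda>f. pair f u)" using dualD(3) by (simp add: bilinear_map_def)
    from linear_sum[OF this, of "\<lambda>i. sd (pair g (e i)) (e' i)" "{1..n}"]
    show "pair (\<Sum>i=1..n. sd (pair g (e i)) (e' i)) u = pair g u"
      unfolding 1 by (simp add: ops_linear mult.commute)
  qed
  have B: "bilinear_map sH sH (*) (\<lambda>x y. \<phi> x * \<omega> y u)"
    by (rule bilinear_prod[OF \<phi>]) (use bil in \<open>unfold bilinear_map_def, blast\<close>)
  have te: "tens sH x y (\<lambda>x y. \<phi> x * \<omega> y u) = \<phi> x * \<omega> y u" for x y
    using B by (simp add: tens_def)
  have "(sum t A) (\<lambda>x y. \<phi> x * \<omega> y u) = (\<Sum>i\<in>A. t i (\<lambda>x y. \<phi> x * \<omega> y u))" for t :: "nat \<Rightarrow> ('a \<times> 'd, 'k) tensor2" and A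
    by (rule linear_sum[OF linear_eval])
  then have "?r (\<lambda>x y. \<phi> x * \<omega> y u) = (\<Sum>i=1..n. \<phi> (e i, 0) * pair (e' i) b + \<phi> (0, e' i) * pair g (e i))"
    by (simp add: te) (simp add: \<omega>_def u pair_0)
  also have "\<dots> = (\<Sum>i=1..n. \<phi> (sH (pair (e' i) b) (e i, 0) + sH (pair g (e i)) (0, e' i)))"
  proof -
    have "\<phi> (x + y) = \<phi> x + \<phi> y" "\<phi> (sH c x) = c * \<phi> x" for x y c
      using \<phi> unfolding linear_iff by blast+
    then show ?thesis by (simp only: mult.commute)
  qed
  also have "\<dots> = \<phi> (\<Sum>i=1..n. sH (pair (e' i) b) (e i, 0) + sH (pair g (e i)) (0, e' i))"
    by (rule linear_sum[OF \<phi>, symmetric])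
  also have "(\<Sum>i=1..n. sH (pair (e' i) b) (e i, 0) + sH (pair g (e i)) (0, e' i)) = u"
  proof (rule prod_eqI)
    have f: "fst (sum t A) = (\<Sum>i\<in>A. fst (t i))" "snd (sum t A) = (\<Sum>i\<in>A. snd (t i))"
      for t :: "nat \<Rightarrow> 'a \<times> 'd" and A by (induction A rule: infinite_finite_induct) auto
    show "fst (\<Sum>i=1..n. sH (pair (e' i) b) (e i, 0) + sH (pair g (e i)) (0, e' i)) = fst u"
      unfolding f by (simp add: prod_scale_sel u exp[unfolded One_nat_def] vector_space_simps[OF dualD(1)])
    show "snd (\<Sum>i=1..n. sH (pair (e' i) b) (e i, 0) + sH (pair g (e i)) (0, e' i)) = snd u"
      unfolding f by (simp add: prod_scale_sel u exp'[unfolded One_nat_def] vector_space_simps[OF dualD(2)])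
  qed
  finally show "?r (\<lambda>x y. \<phi> x * \<omega> y u) = \<phi> u" .
qed

end

theorem theorem3p37:
  fixes scaleA :: "'k::field_char_0 \<Rightarrow> 'a::ab_group_add \<Rightarrow> 'a"
    and scaleD :: "'k \<Rightarrow> 'd::ab_group_add \<Rightarrow> 'd"
    and pair :: "'d \<Rightarrow> 'a \<Rightarrow> 'k"
    and lhd rhd dia :: "'a \<Rightarrow> 'a \<Rightarrow> 'a"
    and n :: nat and e :: "nat \<Rightarrow> 'a" and e' :: "nat \<Rightarrow> 'd"
  assumes pre_gd: "pre_gd_algebra scaleA lhd rhd dia"
    and dual: "is_dual_space scaleA scaleD pair"
    and basis: "inj_on e {1..n}" "\<not> module.dependent scaleA (e ` {1..n})"
      "module.span scaleA (e ` {1..n}) = UNIV"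
    and dual_basis: "\<And>i j. i \<in> {1..n} \<Longrightarrow> j \<in> {1..n} \<Longrightarrow> pair (e' i) (e j) = (if i = j then 1 else 0)"
    and sH: "sH = prod_scale scaleA scaleD"
    and mH: "mH = hat_mult pair lhd rhd"
    and bH: "bH = hat_bracket pair dia"
    and r: "r = (\<Sum>\<alpha>=1..n. tens sH (e \<alpha>, 0) (0, e' \<alpha>) - tens sH (0, e' \<alpha>) (e \<alpha>, 0))"
    and sR: "sR = poly_scale sH"
    and brR: "brR = gd_conformal_bracket mH bH"
    and emb: "emb = tmap sH sR (\<lambda>x. [:x:]) (\<lambda>x. [:x:])"
    and \<delta>: "\<delta> = (\<lambda>a. poly_subst (\<lambda>t. - tensor_D sR var_mult t) id (conformal_act sR brR a (emb r)))"
    and \<Delta>: "\<Delta> = (\<lambda>a. - (tmap sH sH (mH a) id r + tmap sH sH id (star mH a) r))"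
    and \<delta>\<^sub>0: "\<delta>\<^sub>0 = (\<lambda>a. tmap sH sH (bH a) id r + tmap sH sH id (bH a) r)"
  shows "skew_symmetric sH r \<and> gd_ybe sH mH bH r \<and>
    lie_conformal_bialgebra sR var_mult brR \<delta> \<and>
    gd_bialgebra sH mH bH \<Delta> \<delta>\<^sub>0 \<and>
    (\<forall>a. \<delta> [:a:] = emb (\<delta>\<^sub>0 a) + tmap sR sR var_mult id (emb (\<Delta> a))
                    - tflip sR (tmap sR sR var_mult id (emb (\<Delta> a))))"
proof -
  interpret H: pre_gd_dual scaleA scaleD pair lhd rhd dia
    by (rule pre_gd_dual.intro[OF pre_gd dual])
  interpret symplectic_gd sH mH bH H.\<omega> r
    unfolding sH mH bH r by (rule H.symplectic_gd_hat[OF basis(3) dual_basis])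
  have eqs: "\<delta> = conf_cop" "\<Delta> = cop" "\<delta>\<^sub>0 = cobr"
    by (simp_all add: fun_eq_iff \<delta> \<Delta> \<delta>\<^sub>0 conf_cop_def cop_def cobr_def sR brR emb)
  show ?thesis
    unfolding eqs unfolding sR brR emb skew_symmetric_def
    using r_skew gd_ybe conformal_bialgebra gd_bialgebra conf_cop_const by blast
qed

end
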